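(* Let $\mathcal{A}\subset\mathbb{N}^n$ be a finite set with $0\in\mathcal{A}$. If $f\in\mathbb{C}[x_1,\dots,x_n]$ is general given its support $\mathcal{A}$ and $u\in\mathbb{C}^n$ is general, then polyhedral homotopy is optimal for solving the Lagrange multiplier equations $\mathcal{L}_{f,u}(\lambda,x)=0$.
   Context: "General given its support $\mathcal{A}$" means for all $f$ in some dense open subset of the set of polynomials whose set of exponents (support) is $\mathcal{A}$; "$u$ general" means for all $u$ in the complement of some proper algebraic subvariety of $\mathbb{C}^n$. The Lagrange multiplier equations are the $n+1$ equations in the variables $(\lambda,x_1,\dots,x_n)$ \[ f=0,\qquad \partial_i f-\lambda(u_i-x_i)=0\quad(1\le i\le n),\qquad \partial_i=\partial/\partial x_i . \] Let $F(x)=(f_1(x),\dots,f_m(x))$ be a system of $m$ polynomials in $m$ variables with Newton polytopes $Q_1,\dots,Q_m$ (convex hulls of supports). A homotopy for $F$ with start system $G$ is a system $H(x,t)$ depending on an additional parameter $t$ with $H(x,1)=G(x)$ and $H(x,0)=F(x)$. A continuation path is a path $t\mapsto x(t)$ with $H(x(t),t)=0$ starting, at $t=1$, at a zero of $G$ and followed as $t\to 0$. The polyhedral homotopy (of Huber and Sturmfels) provides a start system $G$ and a homotopy $H$ for $F$ such that for all $t\in(0,1]$ the system $H(\cdot,t)$ has exactly $\mathrm{MV}(Q_1,\dots,Q_m)$ isolated zeros, these being regular zeros in $(\mathbb{C}\setminus\{0\})^m$ which, for $t\in(0,1]$, form $\mathrm{MV}(Q_1,\dots,Q_m)$ smooth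 continuation paths starting at the zeros of $G$; "zeros" of $G$ are these. Here $\mathrm{MV}$ is mixed volume, normalized so that $\mathrm{MV}(Q,\dots,Q)=m!\,\mathrm{Vol}(Q)$. A homotopy is optimal if: (1) the start system $G$ has as many zeros as the input $F$; (2) all continuation paths end (as $t\to0$) in a zero of $F$; and (3) for every zero of $F$ there is a continuation path which converges to it. *)

theory Defs
  imports "HOL-Analysis.Analysis" "HOL-Library.Poly_Mapping"
begin

section \<open>Complex polynomials in the variables \<open>'v\<close>\<close>

text \<open>
  Polynomials are finitely supported functions from exponents to coefficients; the ring
  structure is the one of \<^theory>\<open>HOL-Library.Poly_Mapping\<close>, and the support (set of exponents)
  of \<open>p\<close> is \<open>Poly_Mapping.keys p\<close>.
\<close>

type_synonym 'v exponent = "'v \<Rightarrow>\<^sub>0 nat"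
type_synonym 'v cpoly = "'v exponent \<Rightarrow>\<^sub>0 complex"

definition monom_eval :: "('v \<Rightarrow> 'b::comm_monoid_mult) \<Rightarrow> 'v exponent \<Rightarrow> 'b" where
  "monom_eval x a = (\<Prod>i\<in>Poly_Mapping.keys a. x i ^ Poly_Mapping.lookup a i)"

definition poly_eval :: "('v \<Rightarrow> complex) \<Rightarrow> 'v cpoly \<Rightarrow> complex" where
  "poly_eval x p = (\<Sum>a\<in>Poly_Mapping.keys p. Poly_Mapping.lookup p a * monom_eval x a)"

definition Const :: "complex \<Rightarrow> 'v cpoly" where
  "Const c = Poly_Mapping.single 0 c"

definition Var :: "'v \<Rightarrow> 'v cpoly" where
  "Var i = Poly_Mapping.single (Poly_Mapping.single i 1) 1"

text \<open>
  The subtraction of exponents truncates, but only in terms whose coefficient is \<open>0\<close>.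
\<close>

definition pderiv_at :: "'v \<Rightarrow> 'v cpoly \<Rightarrow> 'v cpoly" where
  "pderiv_at i p = (\<Sum>a\<in>Poly_Mapping.keys p.
     Poly_Mapping.single (a - Poly_Mapping.single i 1)
       (of_nat (Poly_Mapping.lookup a i) * Poly_Mapping.lookup p a))"

definition rename :: "('v \<Rightarrow> 'w) \<Rightarrow> 'v cpoly \<Rightarrow> 'w cpoly" where
  "rename h p = (\<Sum>a\<in>Poly_Mapping.keys p.
     Const (Poly_Mapping.lookup p a) * monom_eval (\<lambda>i. Var (h i)) a)"

lemma monom_eval_superset:
  assumes "finite S" "Poly_Mapping.keys a \<subseteq> S"
  shows "monom_eval x a = (\<Prod>i\<in>S. x i ^ Poly_Mapping.lookup a i)"
  unfolding monom_eval_def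
  by (rule prod.mono_neutral_left) (use assms in \<open>auto simp: in_keys_iff\<close>)

lemma monom_eval_add: "monom_eval x (a + b) = monom_eval x a * monom_eval x b"
proof -
  let ?S = "Poly_Mapping.keys a \<union> Poly_Mapping.keys b"
  have "Poly_Mapping.keys (a + b) \<subseteq> ?S" by (rule keys_add)
  then show ?thesis
    by (simp add: monom_eval_superset[of ?S] lookup_add power_add prod.distrib)
qed

lemma poly_eval_superset:
  assumes "finite S" "Poly_Mapping.keys p \<subseteq> S"
  shows "poly_eval x p = (\<Sum>a\<in>S. Poly_Mapping.lookup p a * monom_eval x a)"
  unfolding poly_eval_def
  by (rule sum.mono_neutral_left) (use assms in \<open>auto simp: in_keys_iff\<close>)

lemma poly_eval_add: "poly_eval x (p + q) = poly_eval x p + poly_eval x q"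
proof -
  let ?S = "Poly_Mapping.keys p \<union> Poly_Mapping.keys q"
  have "Poly_Mapping.keys (p + q) \<subseteq> ?S" by (rule keys_add)
  then show ?thesis
    by (simp add: poly_eval_superset[of ?S] lookup_add distrib_right sum.distrib)
qed

lemma poly_eval_0 [simp]: "poly_eval x 0 = 0"
  by (simp add: poly_eval_def)

lemma poly_eval_sum: "poly_eval x (sum f S) = (\<Sum>i\<in>S. poly_eval x (f i))"
  by (induction S rule: infinite_finite_induct) (simp_all add: poly_eval_add)

lemma poly_eval_single: "poly_eval x (Poly_Mapping.single a c) = c * monom_eval x a"
  by (simp add: poly_eval_def)

lemma poly_eval_Const [simp]: "poly_eval x (Const c) = c"
  by (simp add: Const_def poly_eval_single monom_eval_def)

lemma poly_eval_Var [simp]: "poly_eval x (Var i) = x i"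
  by (simp add: Var_def poly_eval_single monom_eval_def)

lemma cpoly_sum_single:
  "p = (\<Sum>a\<in>Poly_Mapping.keys p. Poly_Mapping.single a (Poly_Mapping.lookup p a))"
  by (rule poly_mapping_eqI) (simp add: lookup_sum lookup_single when_def in_keys_iff)

lemma poly_eval_mult: "poly_eval x (p * q) = poly_eval x p * poly_eval x q"
proof -
  have "p * q = (\<Sum>a\<in>Poly_Mapping.keys p. \<Sum>b\<in>Poly_Mapping.keys q.
      Poly_Mapping.single (a + b) (Poly_Mapping.lookup p a * Poly_Mapping.lookup q b))"
    by (subst (1) cpoly_sum_single[of p], subst (1) cpoly_sum_single[of q])
       (simp only: sum_product mult_single)
  then have "poly_eval x (p * q) = (\<Sum>a\<in>Poly_Mapping.keys p. \<Sum>b\<in>Poly_Mapping.keys q.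
      (Poly_Mapping.lookup p a * monom_eval x a) * (Poly_Mapping.lookup q b * monom_eval x b))"
    by (simp only: poly_eval_sum poly_eval_single monom_eval_add) (simp only: mult_ac)
  then show ?thesis
    by (simp only: poly_eval_def[of x p] poly_eval_def[of x q] sum_product)
qed


section \<open>The Zariski topology and general elements\<close>

definition zariski :: "('v \<Rightarrow> complex) topology" where
  "zariski = topology (\<lambda>U. \<exists>P. U = {x. \<exists>p\<in>P. poly_eval x p \<noteq> 0})"

lemma istopology_zariski: "istopology (\<lambda>U. \<exists>P. U = {x. \<exists>p\<in>P. poly_eval x p \<noteq> 0})"
  unfolding istopology_def
proof (intro conjI allI impI)
  fix S T :: "('v \<Rightarrow> complex) set"
  assume "\<exists>P. S = {x. \<exists>p\<in>P. poly_eval x p \<noteq> 0}" "\<exists>P. T = {x. \<exists>p\<in>P. poly_eval x p \<noteq> 0}"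
  then obtain P Q where "S = {x. \<exists>p\<in>P. poly_eval x p \<noteq> 0}" "T = {x. \<exists>p\<in>Q. poly_eval x p \<noteq> 0}"
    by blast
  moreover have "(\<exists>r\<in>{p * q |p q. p \<in> P \<and> q \<in> Q}. poly_eval x r \<noteq> 0) \<longleftrightarrow>
      (\<exists>p\<in>P. poly_eval x p \<noteq> 0) \<and> (\<exists>q\<in>Q. poly_eval x q \<noteq> 0)" for x
  proof
    assume "\<exists>r\<in>{p * q |p q. p \<in> P \<and> q \<in> Q}. poly_eval x r \<noteq> 0"
    then show "(\<exists>p\<in>P. poly_eval x p \<noteq> 0) \<and> (\<exists>q\<in>Q. poly_eval x q \<noteq> 0)"
      by (auto simp: poly_eval_mult)
  next
    assume "(\<exists>p\<in>P. poly_eval x p \<noteq> 0) \<and> (\<exists>q\<in>Q. poly_eval x q \<noteq> 0)"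
    then obtain p q where "p \<in> P" "q \<in> Q" "poly_eval x (p * q) \<noteq> 0"
      by (auto simp: poly_eval_mult)
    then show "\<exists>r\<in>{p * q |p q. p \<in> P \<and> q \<in> Q}. poly_eval x r \<noteq> 0"
      by blast
  qed
  ultimately have "S \<inter> T = {x. \<exists>r\<in>{p * q |p q. p \<in> P \<and> q \<in> Q}. poly_eval x r \<noteq> 0}"
    by (simp add: Collect_conj_eq)
  then show "\<exists>P. S \<inter> T = {x. \<exists>p\<in>P. poly_eval x p \<noteq> 0}" ..
next
  fix K :: "('v \<Rightarrow> complex) set set"
  assume "\<forall>S\<in>K. \<exists>P. S = {x. \<exists>p\<in>P. poly_eval x p \<noteq> 0}"
  from bchoice[OF this]
  obtain P where P: "\<And>S. S \<in> K \<Longrightarrow> S = {x. \<exists>p\<in>P S. poly_eval x p \<noteq> 0}"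
    by blast
  have "x \<in> S \<longleftrightarrow> (\<exists>p\<in>P S. poly_eval x p \<noteq> 0)" if "S \<in> K" for x S
    by (subst P[OF that]) simp
  then have "\<Union>K = {x. \<exists>p\<in>\<Union>(P ` K). poly_eval x p \<noteq> 0}"
    by (intro set_eqI) (simp only: Union_iff mem_Collect_eq UN_iff, fast)
  then show "\<exists>P. \<Union>K = {x. \<exists>p\<in>P. poly_eval x p \<noteq> 0}" ..
qed

lemma openin_zariski: "openin zariski U \<longleftrightarrow> (\<exists>P. U = {x. \<exists>p\<in>P. poly_eval x p \<noteq> 0})"
  by (simp add: zariski_def topology_inverse'[OF istopology_zariski])

lemma topspace_zariski [simp]: "topspace zariski = UNIV"
proof -
  have "openin zariski (UNIV :: ('v \<Rightarrow> complex) set)"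
    unfolding openin_zariski by (rule exI[of _ "{Const 1}"]) simp
  then show ?thesis
    using openin_subset by blast
qed

lemma closedin_zariski: "closedin zariski Z \<longleftrightarrow> (\<exists>P. Z = {x. \<forall>p\<in>P. poly_eval x p = 0})"
proof -
  have "- Z = {x. \<exists>p\<in>P. poly_eval x p \<noteq> 0} \<longleftrightarrow> Z = {x. \<forall>p\<in>P. poly_eval x p = 0}" for P
    by blast
  then show ?thesis
    unfolding closedin_def openin_zariski topspace_zariski Compl_eq_Diff_UNIV[symmetric] by simp
qed

text \<open>
  The polynomials whose support is exactly \<open>A\<close>, with the Zariski topology on their coefficients.
\<close>

definition support_space :: "'v exponent set \<Rightarrow> 'v cpoly topology" where
  "support_space A = pullback_topology {f. Poly_Mapping.keys f = A} Poly_Mapping.lookup zariski"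

lemma topspace_support_space [simp]:
  "topspace (support_space A) = {f. Poly_Mapping.keys f = A}"
  by (simp add: support_space_def topspace_pullback_topology)

definition holds_for_general_poly :: "'v exponent set \<Rightarrow> ('v cpoly \<Rightarrow> bool) \<Rightarrow> bool" where
  "holds_for_general_poly A P \<longleftrightarrow>
     (\<exists>U. openin (support_space A) U \<and>
          support_space A closure_of U = topspace (support_space A) \<and>
          (\<forall>f\<in>U. P f))"

definition holds_for_general_point :: "(complex ^ 'n::finite \<Rightarrow> bool) \<Rightarrow> bool" where
  "holds_for_general_point P \<longleftrightarrow>
     (\<exists>Z. closedin zariski Z \<and> Z \<noteq> UNIV \<and> (\<forall>u. vec_nth u \<notin> Z \<longrightarrow> P u))"


section \<open>Square polynomial systems\<close>

type_synonym 'v system = "'v \<Rightarrow> 'v cpoly"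

definition zeros :: "'v::finite system \<Rightarrow> (complex ^ 'v) set" where
  "zeros F = {x. \<forall>i. poly_eval (vec_nth x) (F i) = 0}"

definition isolated_zeros :: "'v::finite system \<Rightarrow> (complex ^ 'v) set" where
  "isolated_zeros F = {x. x isolated_in zeros F}"

definition regular_zero :: "'v::finite system \<Rightarrow> complex ^ 'v \<Rightarrow> bool" where
  "regular_zero F x \<longleftrightarrow> x \<in> zeros F \<and>
     det (\<chi> i j. poly_eval (vec_nth x) (pderiv_at j (F i))) \<noteq> 0"

definition torus :: "(complex ^ 'v::finite) set" where
  "torus = {x. \<forall>i. x $ i \<noteq> 0}"

definition newton_polytope :: "'v::finite cpoly \<Rightarrow> (real ^ 'v) set" where
  "newton_polytope p =
     convex hull ((\<lambda>a. \<chi> i. real (Poly_Mapping.lookup a i)) ` Poly_Mapping.keys p)"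

text \<open>
  Mixed volume by the polarization formula; the sum over \<open>j \<in> J\<close> is the Minkowski sum.
  In this normalization \<open>MV(Q, \<dots>, Q) = m! Vol(Q)\<close> for \<open>m = CARD('v)\<close>.
\<close>

definition mixed_volume :: "('v::finite \<Rightarrow> (real ^ 'v) set) \<Rightarrow> real" where
  "mixed_volume Q =
     (\<Sum>J\<in>Pow UNIV. (- 1) ^ (CARD('v) - card J) * measure lebesgue (\<Sum>j\<in>J. Q j))"


section \<open>Homotopies\<close>

text \<open>
  A homotopy is a family of systems \<open>H t\<close>, \<open>0 \<le> t \<le> 1\<close>, whose coefficients depend
  continuously on \<open>t\<close>. The start system is at \<open>t = 1\<close>, the target system at \<open>t = 0\<close>.
\<close>

definition homotopy :: "'v::finite system \<Rightarrow> 'v system \<Rightarrow> (real \<Rightarrow> 'v system) \<Rightarrow> bool" where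
  "homotopy F G H \<longleftrightarrow> H 1 = G \<and> H 0 = F \<and>
     (\<forall>i a. continuous_on {0..1} (\<lambda>t. Poly_Mapping.lookup (H t i) a))"

text \<open>
  The zeros of the start system, at which paths begin, are its isolated zeros.
\<close>

definition continuation_path ::
    "'v::finite system \<Rightarrow> (real \<Rightarrow> 'v system) \<Rightarrow> (real \<Rightarrow> complex ^ 'v) \<Rightarrow> bool" where
  "continuation_path G H \<gamma> \<longleftrightarrow> continuous_on {0<..1} \<gamma> \<and> \<gamma> 1 \<in> isolated_zeros G \<and>
     (\<forall>t\<in>{0<..1}. \<gamma> t \<in> zeros (H t))"

definition smooth_path :: "(real \<Rightarrow> 'a::real_normed_vector) \<Rightarrow> bool" where
  "smooth_path \<gamma> \<longleftrightarrow> (\<exists>D. D 0 = \<gamma> \<and>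
     (\<forall>k::nat. \<forall>t\<in>{0<..1}. (D k has_vector_derivative D (Suc k) t) (at t within {0<..1})))"

text \<open>
  The properties for which the polyhedral homotopy of Huber and Sturmfels is used: it deforms
  the coefficients of \<open>F\<close> within its Newton polytopes, and for \<open>0 < t \<le> 1\<close> the isolated zeros
  are regular, lie in the torus, number the mixed volume of the Newton polytopes of \<open>F\<close>, and are
  swept out by that many smooth continuation paths.
\<close>

definition polyhedral_homotopy ::
    "'v::finite system \<Rightarrow> 'v system \<Rightarrow> (real \<Rightarrow> 'v system) \<Rightarrow> bool" where
  "polyhedral_homotopy F G H \<longleftrightarrow>
     homotopy F G H \<and>
     (\<forall>t\<in>{0..1}. \<forall>i. newton_polytope (H t i) \<subseteq> newton_polytope (F i)) \<and>
     (\<forall>t\<in>{0<..1}. finite (isolated_zeros (H t)) \<and>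
        real (card (isolated_zeros (H t))) = mixed_volume (\<lambda>i. newton_polytope (F i)) \<and>
        (\<forall>x\<in>isolated_zeros (H t). regular_zero (H t) x \<and> x \<in> torus)) \<and>
     (\<exists>\<gamma>. (\<forall>k<card (isolated_zeros G). continuation_path G H (\<gamma> k) \<and> smooth_path (\<gamma> k)) \<and>
        (\<forall>t\<in>{0<..1}.
           bij_betw (\<lambda>k. \<gamma> k t) {..<card (isolated_zeros G)} (isolated_zeros (H t))))"

definition optimal_homotopy ::
    "'v::finite system \<Rightarrow> 'v system \<Rightarrow> (real \<Rightarrow> 'v system) \<Rightarrow> bool" where
  "optimal_homotopy F G H \<longleftrightarrow>
     (finite (isolated_zeros G) \<and> finite (zeros F) \<and> card (isolated_zeros G) = card (zeros F)) \<and>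
     (\<forall>\<gamma>. continuation_path G H \<gamma> \<longrightarrow> (\<exists>z\<in>zeros F. (\<gamma> \<longlongrightarrow> z) (at_right 0))) \<and>
     (\<forall>z\<in>zeros F. \<exists>\<gamma>. continuation_path G H \<gamma> \<and> (\<gamma> \<longlongrightarrow> z) (at_right 0))"


section \<open>The Lagrange multiplier equations\<close>

text \<open>
  The \<open>n + 1\<close> variables and equations are indexed by \<open>'n option\<close>: \<open>None\<close> is the variable
  \<open>\<lambda>\<close> and the equation \<open>f = 0\<close>; \<open>Some i\<close> is the variable \<open>x\<^sub>i\<close> and the equation
  \<open>\<partial>\<^sub>i f - \<lambda>(u\<^sub>i - x\<^sub>i) = 0\<close>.
\<close>

fun lagrange_system :: "'n::finite cpoly \<Rightarrow> complex ^ 'n \<Rightarrow> 'n option system" where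
  "lagrange_system f u None = rename Some f"
| "lagrange_system f u (Some i) =
     rename Some (pderiv_at i f) - Var None * (Const (u $ i) - Var (Some i))"

end

theory Submission
  imports Defs
begin

text \<open>
  A continuation path can fail to converge to a zero in the torus only if, for some weight
  \<open>w \<noteq> 0\<close>, the initial forms of the Lagrange equations have a common zero in the torus: rescale the
  equations along a sequence of zeros whose logarithms diverge. For general \<open>f\<close> and \<open>u\<close> there is
  no such zero, and all zeros of the Lagrange equations are regular and lie in the torus. Compactness
  and continuation of regular zeros then match the paths with the zeros.

  Genericity is shown with derivations. If a set of parameters lies in no hypersurface, an ultrapower
  of \<open>\<complex>\<close> contains a solution of the given equations whose parameters \<open>c\<^sub>k\<close> are algebraically
  independent. As \<open>\<partial>/\<partial>c\<^sub>k\<close> extends to a derivation on the coordinates of the solution, the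
  equations may be differentiated with respect to \<open>c\<^sub>k\<close>.
\<close>

section \<open>A field of generic points\<close>

text \<open>The coefficients of the Lagrange equations are not independent: \<open>f\<close> and its
  partial derivatives share theirs, and the term \<lambda> times \<open>x\<^sub>i\<close> always has
  coefficient 1. Bernstein's theorem for systems with general coefficients therefore does not apply,
  and the initial forms are excluded by direct analysis. The fixed coefficient 1 is the origin of
  the quadrics: where that term competes with \<open>\<partial>\<^sub>i f\<close>, the gradient of a
  part of \<open>f\<close> becomes proportional to that of a sum of squares.

  The constant term of \<open>f\<close> makes the highest weight of \<open>f\<close> nonnegative for
  every weight vector. If all weights are nonpositive, the highest part is thus the restriction of
  \<open>f\<close> to a coordinate subspace; this is why critical points with vanishing coordinates
  have to be excluded as well.

  The genericity statements are of Sard type. Derivations stand in for dimension counts: a parameter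
  in which an equation is differentiated contributes one explicit nonzero term, and everything else
  cancels by tangency. The ultrapower is a field of characteristic 0 in which solutions chosen
  separately for each parameter become a single solution.\<close>

lemma poly_eval_line:
  fixes c d :: "'p \<Rightarrow> complex"
  obtains q where "\<And>s. poly q s = poly_eval (\<lambda>i. c i + s * d i) p"
proof -
  have "\<exists>q. \<forall>s. poly q s = monom_eval (\<lambda>i. c i + s * d i) a" for a
  proof (intro exI allI)
    fix s show "poly (\<Prod>i\<in>Poly_Mapping.keys a. [:c i, d i:] ^ Poly_Mapping.lookup a i) s
        = monom_eval (\<lambda>i. c i + s * d i) a"
      by (simp add: monom_eval_def poly_prod)
  qed
  then obtain Q where Q: "\<And>a s. poly (Q a) s = monom_eval (\<lambda>i. c i + s * d i) a"
    by metis
  show ?thesis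
  proof (rule that)
    fix s show "poly (\<Sum>a\<in>Poly_Mapping.keys p. smult (Poly_Mapping.lookup p a) (Q a)) s
        = poly_eval (\<lambda>i. c i + s * d i) p"
      by (simp add: poly_eval_def poly_sum Q)
  qed
qed

text \<open>
  Along the line through a point where \<open>p\<close> does not vanish and one where \<open>q\<close> does not vanish,
  both have finitely many zeros.
\<close>

lemma nonvanishing_mult:
  assumes "poly_eval c p \<noteq> 0" "poly_eval d q \<noteq> 0"
  obtains s where "poly_eval (\<lambda>i. c i + s * (d i - c i)) (p * q) \<noteq> 0"
proof -
  obtain P where P: "\<And>s. poly P s = poly_eval (\<lambda>i. c i + s * (d i - c i)) p"
    using poly_eval_line[of c "\<lambda>i. d i - c i" p] by metis
  obtain Q where Q: "\<And>s. poly Q s = poly_eval (\<lambda>i. c i + s * (d i - c i)) q"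
    using poly_eval_line[of c "\<lambda>i. d i - c i" q] by metis
  have "P \<noteq> 0" "Q \<noteq> 0"
    using P[of 0] Q[of 1] assms by auto
  then have "finite ({s. poly P s = 0} \<union> {s. poly Q s = 0})"
    by (simp add: poly_roots_finite)
  then obtain s where "s \<notin> {s. poly P s = 0} \<union> {s. poly Q s = 0}"
    using ex_new_if_finite[OF infinite_UNIV_char_0] by blast
  then show ?thesis
    using that[of s] P Q by (auto simp: poly_eval_mult)
qed

lemma nonvanishing_mult_ex:
  "\<exists>c. poly_eval c p \<noteq> 0 \<Longrightarrow> \<exists>c. poly_eval c q \<noteq> 0 \<Longrightarrow> \<exists>c. poly_eval c (p * q) \<noteq> 0"
  using nonvanishing_mult by metis

lemma poly_eval_1 [simp]: "poly_eval x 1 = 1"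
  using poly_eval_Const[of x 1] by (simp add: Const_def)

lemma poly_eval_prod: "poly_eval x (prod f S) = (\<Prod>i\<in>S. poly_eval x (f i))"
proof (induction S rule: infinite_finite_induct)
  case (insert i S)
  then show ?case by (simp add: poly_eval_mult)
qed simp_all

lemma nonvanishing_prod_ex:
  assumes "finite S" "\<And>i. i \<in> S \<Longrightarrow> \<exists>c. poly_eval c (f i) \<noteq> 0"
  shows "\<exists>c. poly_eval c (prod f S) \<noteq> 0"
  using assms
proof (induction S)
  case empty
  then show ?case by (simp add: poly_eval_prod)
next
  case (insert i S)
  then show ?case using nonvanishing_mult_ex[of "f i" "prod f S"] by auto
qed

section \<open>Sets of points contained in a hypersurface\<close>

text \<open>These are the sets that are not Zariski dense. Being nonzero is required of the
  polynomial function, so that products can be handled by restriction to lines, also when there are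
  infinitely many variables.\<close>

definition thin :: "('p \<Rightarrow> complex) set \<Rightarrow> bool" where
  "thin B \<longleftrightarrow> (\<exists>h. (\<exists>c. poly_eval c h \<noteq> 0) \<and> (\<forall>c\<in>B. poly_eval c h = 0))"

lemma thin_mono: "thin B \<Longrightarrow> C \<subseteq> B \<Longrightarrow> thin C"
  unfolding thin_def by blast

lemma thin_UN:
  assumes "finite I" "\<And>i. i \<in> I \<Longrightarrow> thin (B i)"
  shows "thin (\<Union>i\<in>I. B i)"
proof -
  have "\<exists>h. \<forall>i\<in>I. (\<exists>c. poly_eval c (h i) \<noteq> 0) \<and> (\<forall>c\<in>B i. poly_eval c (h i) = 0)"
    by (rule bchoice) (use assms in \<open>auto simp: thin_def\<close>)
  then obtain h where h: "\<And>i. i \<in> I \<Longrightarrow> \<exists>c. poly_eval c (h i) \<noteq> 0"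
    "\<And>i c. i \<in> I \<Longrightarrow> c \<in> B i \<Longrightarrow> poly_eval c (h i) = 0"
    by blast
  show ?thesis
    unfolding thin_def
  proof (intro exI[of _ "prod h I"] conjI ballI)
    show "\<exists>c. poly_eval c (prod h I) \<noteq> 0"
      using assms(1) h(1) by (rule nonvanishing_prod_ex)
    show "poly_eval c (prod h I) = 0" if "c \<in> (\<Union>i\<in>I. B i)" for c
      using that assms(1) h(2) by (auto simp: poly_eval_prod)
  qed
qed

lemma thin_Un: "thin B \<Longrightarrow> thin C \<Longrightarrow> thin (B \<union> C)"
  using thin_UN[of "{True, False}" "\<lambda>b. if b then B else C"] by (simp add: Un_commute)


section \<open>Ultrafilters\<close>

text \<open>Filters are represented by sets of predicates because the union of a chain of them is
  again one, which is what Zorn's lemma asks for.\<close>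

definition proper_filter_set :: "('a \<Rightarrow> bool) set \<Rightarrow> bool" where
  "proper_filter_set Q \<longleftrightarrow> (\<lambda>_. True) \<in> Q \<and> (\<lambda>_. False) \<notin> Q \<and>
     (\<forall>P\<in>Q. \<forall>R\<in>Q. (\<lambda>x. P x \<and> R x) \<in> Q) \<and> (\<forall>P\<in>Q. \<forall>R\<ge>P. R \<in> Q)"

lemma proper_filter_setI:
  assumes "(\<lambda>_. True) \<in> Q" "(\<lambda>_. False) \<notin> Q"
    and "\<And>P R. P \<in> Q \<Longrightarrow> R \<in> Q \<Longrightarrow> (\<lambda>x. P x \<and> R x) \<in> Q"
    and "\<And>P R. P \<in> Q \<Longrightarrow> P \<le> R \<Longrightarrow> R \<in> Q"
  shows "proper_filter_set Q"
  unfolding proper_filter_set_def using assms by blast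

lemma proper_filter_setD:
  assumes "proper_filter_set Q"
  shows "(\<lambda>_. True) \<in> Q" "(\<lambda>_. False) \<notin> Q"
    and "P \<in> Q \<Longrightarrow> R \<in> Q \<Longrightarrow> (\<lambda>x. P x \<and> R x) \<in> Q"
    and "P \<in> Q \<Longrightarrow> P \<le> R \<Longrightarrow> R \<in> Q"
  using assms unfolding proper_filter_set_def by blast+

lemma proper_filter_set_maximal:
  assumes F: "proper_filter_set Q0"
  obtains M where "Q0 \<subseteq> M" "proper_filter_set M" "\<And>P. P \<in> M \<or> (\<lambda>x. \<not> P x) \<in> M"
proof -
  let ?A = "{Q. Q0 \<subseteq> Q \<and> proper_filter_set Q}"
  have "\<exists>M\<in>?A. \<forall>X\<in>?A. M \<subseteq> X \<longrightarrow> X = M"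
  proof (rule subset_Zorn_nonempty)
    show "?A \<noteq> {}" using F by blast
    fix \<C> assume C: "\<C> \<noteq> {}" "subset.chain ?A \<C>"
    have mem: "\<And>Q. Q \<in> \<C> \<Longrightarrow> proper_filter_set Q" "\<And>Q. Q \<in> \<C> \<Longrightarrow> Q0 \<subseteq> Q"
      using C(2) by (auto simp: subset.chain_def)
    have tot: "\<And>Q R. Q \<in> \<C> \<Longrightarrow> R \<in> \<C> \<Longrightarrow> Q \<subseteq> R \<or> R \<subseteq> Q"
      using C(2) by (meson subset_chain_def)
    obtain Q1 where Q1: "Q1 \<in> \<C>" using C(1) by blast
    have "proper_filter_set (\<Union>\<C>)"
    proof (rule proper_filter_setI)
      show "(\<lambda>_. True) \<in> \<Union>\<C>"
        using Q1 proper_filter_setD(1)[OF mem(1)[OF Q1]] by (rule UnionI)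
      show "(\<lambda>_. False) \<notin> \<Union>\<C>"
        using proper_filter_setD(2)[OF mem(1)] by (meson UnionE)
    next
      fix P R assume "P \<in> \<Union>\<C>" "R \<in> \<Union>\<C>"
      then obtain Q2 Q3 where "Q2 \<in> \<C>" "Q3 \<in> \<C>" "P \<in> Q2" "R \<in> Q3" by (meson UnionE)
      then obtain Q where "Q \<in> \<C>" "P \<in> Q" "R \<in> Q" using tot[of Q2 Q3] by (meson subsetD)
      then show "(\<lambda>x. P x \<and> R x) \<in> \<Union>\<C>" using proper_filter_setD(3)[OF mem(1)] by (meson UnionI)
    next
      fix P R :: "'a \<Rightarrow> bool" assume "P \<in> \<Union>\<C>" "P \<le> R"
      then show "R \<in> \<Union>\<C>" using proper_filter_setD(4)[OF mem(1)] by (meson UnionE UnionI)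
    qed
    moreover have "Q0 \<subseteq> \<Union>\<C>" using mem(2)[OF Q1] Q1 by (meson Union_upper subset_trans)
    ultimately show "\<Union>\<C> \<in> ?A" by simp
  qed
  then obtain M where sub: "Q0 \<subseteq> M" and M: "proper_filter_set M"
    and max: "\<And>X. Q0 \<subseteq> X \<Longrightarrow> proper_filter_set X \<Longrightarrow> M \<subseteq> X \<Longrightarrow> X = M"
    by auto
  have "P \<in> M \<or> (\<lambda>x. \<not> P x) \<in> M" for P
  proof (rule disjCI)
    assume nP: "(\<lambda>x. \<not> P x) \<notin> M"
    \<comment> \<open>The filter generated by \<open>M\<close> and \<open>P\<close>. If it were
      improper, some member of \<open>M\<close> would imply the negation of
      \<open>P\<close>.\<close>
    let ?X = "{R. \<exists>Q\<in>M. \<forall>x. Q x \<and> P x \<longrightarrow> R x}"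
    have "M \<subseteq> ?X"
    proof
      fix Q assume "Q \<in> M"
      then show "Q \<in> ?X" by (intro CollectI bexI[of _ Q]) simp_all
    qed
    have "proper_filter_set ?X"
    proof (rule proper_filter_setI)
      show "(\<lambda>_. True) \<in> ?X" using proper_filter_setD(1)[OF M] \<open>M \<subseteq> ?X\<close> by (rule subsetD[rotated])
      show "(\<lambda>_. False) \<notin> ?X"
      proof
        assume "(\<lambda>_. False) \<in> ?X"
        then obtain Q where "Q \<in> M" "\<forall>x. Q x \<and> P x \<longrightarrow> False" by blast
        then have "(\<lambda>x. \<not> P x) \<in> M"
          using proper_filter_setD(4)[OF M, of Q "\<lambda>x. \<not> P x"] by (simp add: le_fun_def)
        then show False using nP by contradiction
      qed
    next
      fix R S assume "R \<in> ?X" "S \<in> ?X"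
      then obtain Q2 Q3 where Q: "Q2 \<in> M" "Q3 \<in> M"
        and "\<forall>x. Q2 x \<and> P x \<longrightarrow> R x" "\<forall>x. Q3 x \<and> P x \<longrightarrow> S x"
        by blast
      then have "\<forall>x. (Q2 x \<and> Q3 x) \<and> P x \<longrightarrow> R x \<and> S x" by simp
      then show "(\<lambda>x. R x \<and> S x) \<in> ?X"
        using proper_filter_setD(3)[OF M Q] by (intro CollectI bexI)
    next
      fix R S :: "'a \<Rightarrow> bool" assume "R \<in> ?X" "R \<le> S"
      then obtain Q where "Q \<in> M" "\<forall>x. Q x \<and> P x \<longrightarrow> R x" by blast
      with \<open>R \<le> S\<close> show "S \<in> ?X" by (intro CollectI bexI[of _ Q]) (auto simp: le_fun_def)
    qed
    from max[OF subset_trans[OF sub \<open>M \<subseteq> ?X\<close>] this \<open>M \<subseteq> ?X\<close>] have "?X = M" .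
    moreover have "P \<in> ?X" using proper_filter_setD(1)[OF M] by (intro CollectI bexI) simp_all
    ultimately show "P \<in> M" by simp
  qed
  then show ?thesis using that sub M by blast
qed

lemma ultrafilter_exists:
  fixes F :: "'a filter"
  assumes "F \<noteq> bot"
  obtains U where "U \<le> F" "U \<noteq> bot" "\<And>P. eventually P U \<or> eventually (\<lambda>x. \<not> P x) U"
proof -
  have "proper_filter_set {P. eventually P F}"
    using assms
    by (intro proper_filter_setI) (auto simp: trivial_limit_def eventually_conj le_fun_def elim: eventually_mono)
  then obtain M where sub: "{P. eventually P F} \<subseteq> M" and M: "proper_filter_set M"
    and ultra: "\<And>P. P \<in> M \<or> (\<lambda>x. \<not> P x) \<in> M"
    by (rule proper_filter_set_maximal) blast
  have "is_filter (\<lambda>P. P \<in> M)"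
    using proper_filter_setD[OF M] by unfold_locales (simp_all add: le_fun_def)
  then have ev: "eventually P (Abs_filter (\<lambda>P. P \<in> M)) \<longleftrightarrow> P \<in> M" for P
    by (rule eventually_Abs_filter)
  show ?thesis
  proof (rule that)
    show "Abs_filter (\<lambda>P. P \<in> M) \<le> F"
      using sub by (auto simp: le_filter_def ev)
    show "Abs_filter (\<lambda>P. P \<in> M) \<noteq> bot"
      using proper_filter_setD(2)[OF M] by (simp add: trivial_limit_def ev)
    show "eventually P (Abs_filter (\<lambda>P. P \<in> M)) \<or> eventually (\<lambda>x. \<not> P x) (Abs_filter (\<lambda>P. P \<in> M))" for P
      using ultra by (simp add: ev)
  qed
qed

section \<open>The filter of complements of hypersurfaces\<close>

text \<open>The indices are the polynomials themselves: for each of them a point off its zero set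
  will be chosen. An index \<open>h\<close> counts as far out, relative to \<open>g\<close>, if a
  point off \<open>h = 0\<close> is automatically off \<open>g = 0\<close>.\<close>

definition generic_base :: "'p cpoly filter" where
  "generic_base = (INF g\<in>{g. \<exists>c. poly_eval c g \<noteq> 0}.
     principal {h. (\<exists>c. poly_eval c h \<noteq> 0) \<and> (\<forall>c. poly_eval c h \<noteq> 0 \<longrightarrow> poly_eval c g \<noteq> 0)})"

text \<open>The base is directed because \<open>p * q\<close> is nonzero exactly where both factors
  are, so the infimum is governed by single polynomials \<open>g\<close>.\<close>

lemma eventually_generic_base:
  "eventually P generic_base \<longleftrightarrow> (\<exists>g. (\<exists>c. poly_eval c g \<noteq> 0) \<and>
     (\<forall>h. (\<exists>c. poly_eval c h \<noteq> 0) \<longrightarrow> (\<forall>c. poly_eval c h \<noteq> 0 \<longrightarrow> poly_eval c g \<noteq> 0) \<longrightarrow> P h))"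
  unfolding generic_base_def
proof (subst eventually_INF_base)
  show "{g :: 'p cpoly. \<exists>c. poly_eval c g \<noteq> 0} \<noteq> {}"
    by (auto intro!: exI[of _ "Const 1"])
  fix p q :: "'p cpoly"
  assume "p \<in> {g. \<exists>c. poly_eval c g \<noteq> 0}" "q \<in> {g. \<exists>c. poly_eval c g \<noteq> 0}"
  then have "p * q \<in> {g. \<exists>c. poly_eval c g \<noteq> 0}"
    using nonvanishing_mult_ex by blast
  then show "\<exists>g\<in>{g. \<exists>c. poly_eval c g \<noteq> 0}.
      principal {h. (\<exists>c. poly_eval c h \<noteq> 0) \<and> (\<forall>c. poly_eval c h \<noteq> 0 \<longrightarrow> poly_eval c g \<noteq> 0)} \<le>
      inf (principal {h. (\<exists>c. poly_eval c h \<noteq> 0) \<and> (\<forall>c. poly_eval c h \<noteq> 0 \<longrightarrow> poly_eval c p \<noteq> 0)})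
          (principal {h. (\<exists>c. poly_eval c h \<noteq> 0) \<and> (\<forall>c. poly_eval c h \<noteq> 0 \<longrightarrow> poly_eval c q \<noteq> 0)})"
    by (intro bexI[of _ "p * q"]) (auto simp: poly_eval_mult)
qed (auto simp: eventually_principal)

lemma generic_base_nontrivial: "generic_base \<noteq> bot"
  unfolding trivial_limit_def eventually_generic_base by auto

definition generic_filter :: "'p cpoly filter" where
  "generic_filter = (SOME U. U \<le> generic_base \<and> U \<noteq> bot \<and>
     (\<forall>P. eventually P U \<or> eventually (\<lambda>x. \<not> P x) U))"

lemma
  shows generic_filter_le: "generic_filter \<le> (generic_base :: 'p cpoly filter)"
    and generic_filter_nontrivial: "(generic_filter :: 'p cpoly filter) \<noteq> bot"
    and generic_filter_ultra: "\<And>P :: 'p cpoly \<Rightarrow> bool. eventually P generic_filter \<or> eventually (\<lambda>x. \<not> P x) generic_filter"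
proof -
  have "\<exists>U :: 'p cpoly filter. U \<le> generic_base \<and> U \<noteq> bot \<and>
     (\<forall>P. eventually P U \<or> eventually (\<lambda>x. \<not> P x) U)"
    using ultrafilter_exists[OF generic_base_nontrivial] by metis
  from someI_ex[OF this, folded generic_filter_def]
  show "generic_filter \<le> (generic_base :: 'p cpoly filter)"
    "(generic_filter :: 'p cpoly filter) \<noteq> bot"
    "\<And>P :: 'p cpoly \<Rightarrow> bool. eventually P generic_filter \<or> eventually (\<lambda>x. \<not> P x) generic_filter"
    by blast+
qed

lemma eventually_generic:
  assumes "poly_eval c g \<noteq> 0"
  shows "eventually (\<lambda>h. (\<exists>c. poly_eval c h \<noteq> 0) \<and> (\<forall>c. poly_eval c h \<noteq> 0 \<longrightarrow> poly_eval c g \<noteq> 0)) generic_filter"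
  by (rule filter_leD[OF generic_filter_le]) (use assms in \<open>auto simp: eventually_generic_base\<close>)

text \<open>
  The ultrapower of \<open>\<complex>\<close> along this filter; the coordinates of its generic points are algebraically
  independent over \<open>\<complex>\<close>.
\<close>

quotient_type 'p hyper = "'p cpoly \<Rightarrow> complex" / "\<lambda>x y. eventually (\<lambda>h. x h = y h) generic_filter"
  by (rule equivpI) (auto simp: reflp_def symp_def transp_def eq_commute elim: eventually_elim2)

instantiation hyper :: (type) field
begin

lift_definition zero_hyper :: "'p hyper" is "\<lambda>_. 0" .
lift_definition one_hyper :: "'p hyper" is "\<lambda>_. 1" .
lift_definition plus_hyper :: "'p hyper \<Rightarrow> 'p hyper \<Rightarrow> 'p hyper" is "\<lambda>x y h. x h + y h"
  by (auto elim: eventually_elim2)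
lift_definition times_hyper :: "'p hyper \<Rightarrow> 'p hyper \<Rightarrow> 'p hyper" is "\<lambda>x y h. x h * y h"
  by (auto elim: eventually_elim2)
lift_definition minus_hyper :: "'p hyper \<Rightarrow> 'p hyper \<Rightarrow> 'p hyper" is "\<lambda>x y h. x h - y h"
  by (auto elim: eventually_elim2)
lift_definition divide_hyper :: "'p hyper \<Rightarrow> 'p hyper \<Rightarrow> 'p hyper" is "\<lambda>x y h. x h / y h"
  by (auto elim: eventually_elim2)
lift_definition uminus_hyper :: "'p hyper \<Rightarrow> 'p hyper" is "\<lambda>x h. - x h"
  by (auto elim: eventually_mono)
lift_definition inverse_hyper :: "'p hyper \<Rightarrow> 'p hyper" is "\<lambda>x h. inverse (x h)"
  by (auto elim: eventually_mono)

instance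
proof
  fix a b c :: "'p hyper"
  show "a + b + c = a + (b + c)" "a + b = b + a" "0 + a = a" "- a + a = 0" "a - b = a + - b"
    "a * b * c = a * (b * c)" "a * b = b * a" "1 * a = a" "(a + b) * c = a * c + b * c"
    "a div b = a * inverse b" "inverse (0 :: 'p hyper) = 0"
    by (transfer; simp add: algebra_simps divide_inverse)+
  show "(0 :: 'p hyper) \<noteq> 1"
    by transfer (simp add: generic_filter_nontrivial)
  \<comment> \<open>A nonzero class only says that \<open>x h = 0\<close> does not hold almost
    everywhere. The ultrafilter property turns this into \<open>x h \<noteq> 0\<close> almost
    everywhere, which makes the ring a field.\<close>
  show "a \<noteq> 0 \<Longrightarrow> inverse a * a = 1"
  proof transfer
    fix x :: "'p cpoly \<Rightarrow> complex"
    assume "\<not> (\<forall>\<^sub>F h in generic_filter. x h = 0)"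
    then have "\<forall>\<^sub>F h in generic_filter. x h \<noteq> 0"
      using generic_filter_ultra by blast
    then show "\<forall>\<^sub>F h in generic_filter. inverse (x h) * x h = 1"
      by (rule eventually_mono) simp
  qed
qed

end

abbreviation mk :: "('p cpoly \<Rightarrow> complex) \<Rightarrow> 'p hyper" where
  "mk \<equiv> abs_hyper"

lemma mk_eq_iff: "mk x = mk y \<longleftrightarrow> eventually (\<lambda>h. x h = y h) generic_filter"
  by (simp add: hyper.abs_eq_iff)

lemma mk_0: "mk (\<lambda>h. 0) = 0" and mk_1: "mk (\<lambda>h. 1) = 1"
  and mk_add: "mk (\<lambda>h. x h + y h) = mk x + mk y"
  and mk_diff: "mk (\<lambda>h. x h - y h) = mk x - mk y"
  and mk_mult: "mk (\<lambda>h. x h * y h) = mk x * mk y"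
  by (simp_all add: zero_hyper.abs_eq one_hyper.abs_eq plus_hyper.abs_eq minus_hyper.abs_eq times_hyper.abs_eq)

lemma mk_eq_0_iff: "mk x = 0 \<longleftrightarrow> eventually (\<lambda>h. x h = 0) generic_filter"
  unfolding mk_0[symmetric] mk_eq_iff ..

lemma mk_eq_0: "(\<And>h. x h = 0) \<Longrightarrow> mk x = 0"
  by (simp add: mk_eq_0_iff)

lemma mk_sum: "mk (\<lambda>h. \<Sum>i\<in>S. x i h) = (\<Sum>i\<in>S. mk (x i))"
  by (induction S rule: infinite_finite_induct) (simp_all add: mk_0 mk_add)

lemma mk_prod: "mk (\<lambda>h. \<Prod>i\<in>S. x i h) = (\<Prod>i\<in>S. mk (x i))"
  by (induction S rule: infinite_finite_induct) (simp_all add: mk_1 mk_mult)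

lemma mk_power: "mk (\<lambda>h. x h ^ n) = mk x ^ n"
  by (induction n) (simp_all add: mk_1 mk_mult)

lemma mk_of_nat: "mk (\<lambda>h. of_nat n) = of_nat n"
  by (induction n) (simp_all add: mk_0 mk_1 mk_add)

lemma mk_monom_eval: "mk (\<lambda>h. monom_eval (x h) a) = monom_eval (\<lambda>i. mk (\<lambda>h. x h i)) a"
  unfolding monom_eval_def by (simp only: mk_prod mk_power)

instance hyper :: (type) field_char_0
proof
  show "inj (of_nat :: nat \<Rightarrow> 'p hyper)"
    by (rule injI) (simp add: mk_of_nat[symmetric] mk_eq_iff generic_filter_nontrivial)
qed

section \<open>Extending derivations\<close>

definition subring :: "'a::comm_ring_1 set \<Rightarrow> bool" where
  "subring K \<longleftrightarrow> 1 \<in> K \<and> (\<forall>x\<in>K. \<forall>y\<in>K. x - y \<in> K \<and> x * y \<in> K)"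

text \<open>Values of \<open>D\<close> may lie outside \<open>K\<close>: extending a derivation
  requires division, and \<open>K\<close> is only a ring.\<close>

definition derivation_on :: "'a::comm_ring_1 set \<Rightarrow> ('a \<Rightarrow> 'a) \<Rightarrow> bool" where
  "derivation_on K D \<longleftrightarrow> (\<forall>x\<in>K. \<forall>y\<in>K. D (x + y) = D x + D y \<and> D (x * y) = x * D y + y * D x)"

context
  fixes K :: "'a::comm_ring_1 set"
  assumes K: "subring K"
begin

lemma subring_1: "1 \<in> K" and subring_diff: "x \<in> K \<Longrightarrow> y \<in> K \<Longrightarrow> x - y \<in> K"
  and subring_mult: "x \<in> K \<Longrightarrow> y \<in> K \<Longrightarrow> x * y \<in> K"
  using K unfolding subring_def by blast+

lemma subring_0: "0 \<in> K"
  using subring_diff[OF subring_1 subring_1] by simp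

lemma subring_minus: "x \<in> K \<Longrightarrow> - x \<in> K"
  using subring_diff[OF subring_0] by simp

lemma subring_add: "x \<in> K \<Longrightarrow> y \<in> K \<Longrightarrow> x + y \<in> K"
  using subring_diff[OF _ subring_minus, of x y] by simp

lemma subring_sum: "(\<And>i. i \<in> S \<Longrightarrow> f i \<in> K) \<Longrightarrow> sum f S \<in> K"
  by (induction S rule: infinite_finite_induct) (simp_all add: subring_0 subring_add)

lemma subring_prod: "(\<And>i. i \<in> S \<Longrightarrow> f i \<in> K) \<Longrightarrow> prod f S \<in> K"
  by (induction S rule: infinite_finite_induct) (simp_all add: subring_1 subring_mult)

lemma subring_power: "x \<in> K \<Longrightarrow> x ^ n \<in> K"
  by (induction n) (simp_all add: subring_1 subring_mult)

lemma subring_of_nat: "of_nat n \<in> K"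
  by (induction n) (simp_all add: subring_0 subring_1 subring_add)

lemma subring_monom_eval: "(\<And>i. x i \<in> K) \<Longrightarrow> monom_eval x a \<in> K"
  unfolding monom_eval_def by (intro subring_prod subring_power)

context
  fixes D :: "'a \<Rightarrow> 'a"
  assumes D: "derivation_on K D"
begin

lemma derivation_add: "x \<in> K \<Longrightarrow> y \<in> K \<Longrightarrow> D (x + y) = D x + D y"
  and derivation_mult: "x \<in> K \<Longrightarrow> y \<in> K \<Longrightarrow> D (x * y) = x * D y + y * D x"
  using D unfolding derivation_on_def by blast+

lemma derivation_0: "D 0 = 0"
  using derivation_add[OF subring_0 subring_0] by simp

lemma derivation_1: "D 1 = 0"
  using derivation_mult[OF subring_1 subring_1] by simp

lemma derivation_minus: "x \<in> K \<Longrightarrow> D (- x) = - D x"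
  using derivation_add[of x "- x"] derivation_0 by (simp add: subring_minus eq_neg_iff_add_eq_0 add.commute)

lemma derivation_diff: "x \<in> K \<Longrightarrow> y \<in> K \<Longrightarrow> D (x - y) = D x - D y"
  using derivation_add[of x "- y"] by (simp add: subring_minus derivation_minus)

lemma derivation_sum: "(\<And>i. i \<in> S \<Longrightarrow> f i \<in> K) \<Longrightarrow> D (sum f S) = (\<Sum>i\<in>S. D (f i))"
  by (induction S rule: infinite_finite_induct) (simp_all add: derivation_0 derivation_add subring_sum)

lemma derivation_power: "x \<in> K \<Longrightarrow> D (x ^ n) = of_nat n * x ^ (n - 1) * D x"
proof (induction n)
  case (Suc n)
  then have "D (x ^ Suc n) = x * (of_nat n * x ^ (n - 1) * D x) + x ^ n * D x"
    by (simp add: derivation_mult subring_power)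
  then show ?case by (cases n) (simp_all add: algebra_simps)
qed (simp add: derivation_1)

lemma derivation_prod:
  assumes "finite S" "\<And>i. i \<in> S \<Longrightarrow> f i \<in> K"
  shows "D (prod f S) = (\<Sum>i\<in>S. D (f i) * prod f (S - {i}))"
  using assms
proof (induction S)
  case (insert j S)
  have "prod f (insert j S - {i}) = f j * prod f (S - {i})" if "i \<in> S" for i
  proof -
    have "insert j S - {i} = insert j (S - {i})" using that insert.hyps by auto
    then show ?thesis using insert.hyps by simp
  qed
  then have "(\<Sum>i\<in>S. D (f i) * prod f (insert j S - {i})) = f j * (\<Sum>i\<in>S. D (f i) * prod f (S - {i}))"
    by (simp add: sum_distrib_left mult_ac)
  then show ?case using insert by (simp add: derivation_mult subring_prod mult.commute add.commute)
qed (simp add: derivation_1)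

end

end

text \<open>The truncated subtractions agree: if \<open>i\<close> does not occur in
  \<open>a\<close>, both sides have exponent 0 at \<open>i\<close>. In derivatives such a term is in
  addition multiplied by \<open>lookup a i = 0\<close>.\<close>

lemma monom_eval_remove:
  assumes "finite I" "Poly_Mapping.keys a \<subseteq> I" "i \<in> I"
  shows "monom_eval x (a - Poly_Mapping.single i 1) =
    x i ^ (Poly_Mapping.lookup a i - 1) * (\<Prod>j\<in>I - {i}. x j ^ Poly_Mapping.lookup a j)"
proof -
  have "Poly_Mapping.keys (a - Poly_Mapping.single i 1) \<subseteq> I"
    using assms(2) by (auto simp: in_keys_iff lookup_minus)
  then have "monom_eval x (a - Poly_Mapping.single i 1) =
      (\<Prod>j\<in>I. x j ^ Poly_Mapping.lookup (a - Poly_Mapping.single i 1) j)"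
    by (rule monom_eval_superset[OF assms(1)])
  also have "\<dots> = x i ^ (Poly_Mapping.lookup a i - 1) *
      (\<Prod>j\<in>I - {i}. x j ^ Poly_Mapping.lookup (a - Poly_Mapping.single i 1) j)"
    using assms by (subst prod.remove[of I i]) (simp_all add: lookup_minus)
  also have "(\<Prod>j\<in>I - {i}. x j ^ Poly_Mapping.lookup (a - Poly_Mapping.single i 1) j) =
      (\<Prod>j\<in>I - {i}. x j ^ Poly_Mapping.lookup a j)"
    by (rule prod.cong) (auto simp: lookup_minus lookup_single when_def)
  finally show ?thesis .
qed

lemma derivation_monom_eval:
  assumes "subring K" "derivation_on K D" "\<And>i. x i \<in> K" "finite I" "Poly_Mapping.keys a \<subseteq> I"
  shows "D (monom_eval x a) = (\<Sum>i\<in>I. of_nat (Poly_Mapping.lookup a i) *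
    monom_eval x (a - Poly_Mapping.single i 1) * D (x i))"
proof -
  have "D (monom_eval x a) = (\<Sum>i\<in>I. D (x i ^ Poly_Mapping.lookup a i) *
      (\<Prod>j\<in>I - {i}. x j ^ Poly_Mapping.lookup a j))"
    unfolding monom_eval_superset[OF assms(4,5)]
    using assms(3,4) by (intro derivation_prod[OF assms(1,2)] subring_power[OF assms(1)])
  also have "\<dots> = (\<Sum>i\<in>I. of_nat (Poly_Mapping.lookup a i) *
      monom_eval x (a - Poly_Mapping.single i 1) * D (x i))"
    by (rule sum.cong[OF refl], subst monom_eval_remove[OF assms(4,5)], assumption)
      (simp add: derivation_power[OF assms(1,2,3)] mult_ac)
  finally show ?thesis .
qed

text \<open>
  If \<open>y\<close> is a root of \<open>p\<close>, of least degree among polynomials over \<open>K\<close>, then necessarily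
  \<open>D y = - p\<^sup>D(y) / p'(y)\<close>; in characteristic \<open>0\<close> the denominator does not vanish.
\<close>

lemma derivation_extend:
  fixes K :: "'a::field_char_0 set"
  assumes K: "subring K" and D: "derivation_on K D"
  obtains K' D' where "subring K'" "derivation_on K' D'" "K \<subseteq> K'" "y \<in> K'" "\<And>x. x \<in> K \<Longrightarrow> D' x = D x"
proof -
  note K_simps = subring_0[OF K] subring_1[OF K] subring_add[OF K] subring_diff[OF K]
    subring_mult[OF K] subring_minus[OF K] subring_sum[OF K] subring_of_nat[OF K]
  note D_simps = derivation_add[OF K D] derivation_diff[OF K D] derivation_mult[OF K D] derivation_sum[OF K D]
  have D0: "D 0 = 0" by (rule derivation_0[OF K D])
  define P where "P = {p :: 'a poly. \<forall>i. coeff p i \<in> K}"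
  have P_add: "p + q \<in> P" and P_diff: "p - q \<in> P" and P_mult: "p * q \<in> P" if "p \<in> P" "q \<in> P" for p q
    using that by (auto simp: P_def coeff_mult K_simps)
  have P_const: "[:a:] \<in> P" and P_monom: "monom a n \<in> P" if "a \<in> K" for a n
    using that by (auto simp: P_def K_simps coeff_pCons split: nat.split)
  have P_pderiv: "pderiv p \<in> P" if "p \<in> P" for p
    using that K_simps(8)[of "Suc _"] by (auto simp: P_def coeff_pderiv K_simps simp del: of_nat_Suc)
  \<comment> \<open>By the Leibniz rule this is the value that an extension with
    \<open>D y = d\<close> must take at \<open>poly q y\<close>.\<close>
  define E where "E d q = poly (map_poly D q) y + poly (pderiv q) y * d" for d q
  have map_add: "map_poly D (p + q) = map_poly D p + map_poly D q" if "p \<in> P" "q \<in> P" for p q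
    using that by (intro poly_eqI) (simp add: coeff_map_poly D0 D_simps P_def)
  have map_mult: "map_poly D (p * q) = p * map_poly D q + map_poly D p * q" if "p \<in> P" "q \<in> P" for p q
  proof (rule poly_eqI)
    fix n
    have c: "coeff p i \<in> K" "coeff q i \<in> K" for i using that by (auto simp: P_def)
    have "coeff (map_poly D (p * q)) n = (\<Sum>i\<le>n. D (coeff p i * coeff q (n - i)))"
      by (simp add: coeff_map_poly D0 coeff_mult D_simps(4) K_simps c)
    also have "\<dots> = (\<Sum>i\<le>n. coeff p i * D (coeff q (n - i)) + D (coeff p i) * coeff q (n - i))"
      by (simp add: D_simps(3) c mult.commute)
    finally show "coeff (map_poly D (p * q)) n = coeff (p * map_poly D q + map_poly D p * q) n"
      by (simp add: coeff_mult coeff_map_poly D0 sum.distrib)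
  qed
  have E_add: "E d (p + q) = E d p + E d q" if "p \<in> P" "q \<in> P" for d p q
    by (simp add: E_def map_add[OF that] pderiv_add algebra_simps)
  have E_mult: "E d (p * q) = poly p y * E d q + poly q y * E d p" if "p \<in> P" "q \<in> P" for d p q
    by (simp add: E_def map_mult[OF that] pderiv_mult algebra_simps)
  have E_diff: "E d (p - q) = E d p - E d q" if "p \<in> P" "q \<in> P" for d p q
    using E_add[OF P_diff[OF that] that(2), of d] by simp
  \<comment> \<open>The extension is well defined once \<open>E d\<close> kills every polynomial
    over \<open>K\<close> that vanishes at \<open>y\<close>. If only 0 does, any \<open>d\<close>
    serves.\<close>
  have "\<exists>d. \<forall>q\<in>P. poly q y = 0 \<longrightarrow> E d q = 0"
  proof (cases "\<exists>p\<in>P. p \<noteq> 0 \<and> poly p y = 0")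
    case False
    have "E 0 0 = 0" by (simp add: E_def)
    then show ?thesis using False by metis
  next
    case True
    then obtain p where p: "p \<in> P" "p \<noteq> 0" "poly p y = 0"
      and min: "\<And>q. q \<in> P \<Longrightarrow> q \<noteq> 0 \<Longrightarrow> poly q y = 0 \<Longrightarrow> degree p \<le> degree q"
      using ex_has_least_nat[of "\<lambda>p. p \<in> P \<and> p \<noteq> 0 \<and> poly p y = 0" _ degree] by blast
    have deg: "degree p > 0"
    proof (rule ccontr)
      assume "\<not> degree p > 0"
      then obtain a where "p = [:a:]" using degree_eq_zeroE by blast
      then show False using p by simp
    qed
    have p': "poly (pderiv p) y \<noteq> 0"
    proof
      assume "poly (pderiv p) y = 0"
      moreover have "pderiv p \<noteq> 0" using deg by (simp add: pderiv_eq_0_iff)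
      ultimately have "degree p \<le> degree (pderiv p)" using min P_pderiv[OF p(1)] by blast
      then show False using deg by (simp add: degree_pderiv)
    qed
    define d where "d = - poly (map_poly D p) y / poly (pderiv p) y"
    have Ep: "E d p = 0" using p' by (simp add: E_def d_def)
    have "E d q = 0" if "q \<in> P" "poly q y = 0" for q
      using that
    proof (induction "degree q" arbitrary: q rule: less_induct)
      case less
      show ?case
      proof (cases "q = 0")
        case True
        then show ?thesis by (simp add: E_def)
      next
        case False
        then have dq: "degree p \<le> degree q" using min less.prems by blast
        let ?a = "lead_coeff p" and ?m = "monom (lead_coeff q) (degree q - degree p)"
        have a: "?a \<in> K" "?a \<noteq> 0" "lead_coeff q \<in> K"
          using p less.prems by (auto simp: P_def)
        \<comment> \<open>Pseudo-division: as \<open>K\<close> need not be a field, \<open>q\<close>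
          is first multiplied by the leading coefficient of \<open>p\<close>.\<close>
        define r where "r = [:?a:] * q - ?m * p"
        have rP: "r \<in> P"
          using less.prems p a unfolding r_def by (intro P_diff P_mult P_const P_monom)
        have ry: "poly r y = 0"
          using less.prems p by (simp add: r_def)
        have "degree r < degree q"
        proof (rule degree_lessI)
          show "r \<noteq> 0 \<or> degree q > 0" using deg dq by simp
          show "\<forall>k\<ge>degree q. coeff r k = 0"
          proof (intro allI impI)
            fix k assume k: "degree q \<le> k"
            then have "coeff (?m * p) k = lead_coeff q * coeff p (k - (degree q - degree p))"
              by (simp add: coeff_monom_mult)
            moreover have "coeff q k = 0 \<and> coeff p (k - (degree q - degree p)) = 0" if "k \<noteq> degree q"
              using that k dq by (auto intro!: coeff_eq_0)
            ultimately show "coeff r k = 0"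
              using dq by (cases "k = degree q") (simp_all add: r_def)
          qed
        qed
        from less.hyps[OF this rP ry] have "E d ([:?a:] * q) = E d (?m * p)"
          using less.prems p a by (simp only: r_def E_diff P_mult P_const P_monom) simp
        then have "?a * E d q = 0"
          using less.prems p a Ep by (simp only: E_mult P_const P_monom) simp
        then show ?thesis using a by simp
      qed
    qed
    then show ?thesis by blast
  qed
  then obtain d where d: "\<And>q. q \<in> P \<Longrightarrow> poly q y = 0 \<Longrightarrow> E d q = 0" by blast
  define D' where "D' z = E d (SOME p. p \<in> P \<and> poly p y = z)" for z
  have D': "D' (poly p y) = E d p" if "p \<in> P" for p
  proof -
    define q where "q = (SOME q. q \<in> P \<and> poly q y = poly p y)"
    have "q \<in> P \<and> poly q y = poly p y"
      unfolding q_def by (rule someI[of _ p]) (simp add: that)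
    then have "E d q = E d p"
      using d[of "q - p"] that by (simp add: P_diff E_diff)
    then show ?thesis by (simp add: D'_def q_def)
  qed
  show ?thesis
  proof (rule that)
    show "subring ((\<lambda>p. poly p y) ` P)"
      unfolding subring_def
    proof (intro conjI ballI)
      show "1 \<in> (\<lambda>p. poly p y) ` P"
        by (rule image_eqI[of _ _ "[:1:]"]) (simp_all add: P_const K_simps)
      fix u v assume "u \<in> (\<lambda>p. poly p y) ` P" "v \<in> (\<lambda>p. poly p y) ` P"
      then obtain p q where "p \<in> P" "q \<in> P" "u = poly p y" "v = poly q y" by blast
      then show "u - v \<in> (\<lambda>p. poly p y) ` P" "u * v \<in> (\<lambda>p. poly p y) ` P"
        using imageI[OF P_diff[of p q], of "\<lambda>p. poly p y"] imageI[OF P_mult[of p q], of "\<lambda>p. poly p y"]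
        by simp_all
    qed
    show "derivation_on ((\<lambda>p. poly p y) ` P) D'"
      unfolding derivation_on_def
    proof (intro ballI)
      fix u v assume "u \<in> (\<lambda>p. poly p y) ` P" "v \<in> (\<lambda>p. poly p y) ` P"
      then obtain p q where pq: "p \<in> P" "q \<in> P" and uv: "u = poly p y" "v = poly q y" by blast
      have "D' (poly p y + poly q y) = E d (p + q)" "D' (poly p y * poly q y) = E d (p * q)"
        using D'[OF P_add[OF pq]] D'[OF P_mult[OF pq]] by simp_all
      then show "D' (u + v) = D' u + D' v \<and> D' (u * v) = u * D' v + v * D' u"
        by (simp add: uv D' pq E_add E_mult)
    qed
    show "y \<in> (\<lambda>p. poly p y) ` P"
      by (rule image_eqI[of _ _ "monom 1 1"]) (simp_all add: P_monom K_simps poly_monom)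
    show "K \<subseteq> (\<lambda>p. poly p y) ` P"
    proof
      fix x assume "x \<in> K"
      then show "x \<in> (\<lambda>p. poly p y) ` P"
        by (intro image_eqI[of _ _ "[:x:]"]) (simp_all add: P_const)
    qed
    show "D' x = D x" if "x \<in> K" for x
      using D'[OF P_const[OF that]] by (simp add: E_def map_poly_pCons D0)
  qed
qed

lemma derivation_extend_finite:
  fixes K :: "'a::field_char_0 set"
  assumes "finite Y" "subring K" "derivation_on K D"
  shows "\<exists>K' D'. subring K' \<and> derivation_on K' D' \<and> K \<subseteq> K' \<and> Y \<subseteq> K' \<and> (\<forall>x\<in>K. D' x = D x)"
  using assms(1)
proof (induction Y)
  case empty
  then show ?case using assms by blast
next
  case (insert y Y)
  then obtain K1 D1 where 1: "subring K1" "derivation_on K1 D1" "K \<subseteq> K1" "Y \<subseteq> K1" "\<forall>x\<in>K. D1 x = D x"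
    by blast
  obtain K2 D2 where "subring K2" "derivation_on K2 D2" "K1 \<subseteq> K2" "y \<in> K2" "\<And>x. x \<in> K1 \<Longrightarrow> D2 x = D1 x"
    by (rule derivation_extend[OF 1(1,2), of y]) blast
  with 1 show ?case by (intro exI[of _ K2] exI[of _ D2]) (auto simp: subset_iff)
qed


section \<open>Partial derivatives\<close>

lemma poly_eval_pderiv_at:
  "poly_eval x (pderiv_at i p) = (\<Sum>a\<in>Poly_Mapping.keys p. Poly_Mapping.lookup p a *
     (of_nat (Poly_Mapping.lookup a i) * monom_eval x (a - Poly_Mapping.single i 1)))"
  by (simp add: pderiv_at_def poly_eval_sum poly_eval_single mult_ac)

text \<open>The domain is an arbitrary normed space, so that the same chain rule serves for one
  complex variable and for maps on balls of \<open>complex ^ 'v\<close>. The finite set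
  \<open>I\<close> replaces finiteness of the type of variables.\<close>

lemma poly_eval_has_derivative:
  fixes X :: "'v \<Rightarrow> 'a::real_normed_vector \<Rightarrow> complex"
  assumes X: "\<And>i. (X i has_derivative X' i) (at t within S)"
    and I: "finite I" "\<And>a. a \<in> Poly_Mapping.keys p \<Longrightarrow> Poly_Mapping.keys a \<subseteq> I"
  shows "((\<lambda>s. poly_eval (\<lambda>i. X i s) p) has_derivative
    (\<lambda>v. \<Sum>i\<in>I. poly_eval (\<lambda>i. X i t) (pderiv_at i p) * X' i v)) (at t within S)"
proof -
  have mon: "((\<lambda>s. monom_eval (\<lambda>i. X i s) a) has_derivative
    (\<lambda>v. \<Sum>i\<in>I. of_nat (Poly_Mapping.lookup a i) * monom_eval (\<lambda>i. X i t) (a - Poly_Mapping.single i 1) * X' i v)) (at t within S)"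
    if "a \<in> Poly_Mapping.keys p" for a
  proof -
    note aI = I(2)[OF that]
    have "((\<lambda>s. \<Prod>i\<in>I. X i s ^ Poly_Mapping.lookup a i) has_derivative
      (\<lambda>v. \<Sum>i\<in>I. (of_nat (Poly_Mapping.lookup a i) * X' i v * X i t ^ (Poly_Mapping.lookup a i - 1)) *
        (\<Prod>j\<in>I - {i}. X j t ^ Poly_Mapping.lookup a j))) (at t within S)"
      by (intro has_derivative_prod has_derivative_power X)
    also have "(\<lambda>s. \<Prod>i\<in>I. X i s ^ Poly_Mapping.lookup a i) = (\<lambda>s. monom_eval (\<lambda>i. X i s) a)"
      by (simp add: monom_eval_superset[OF I(1) aI])
    finally show ?thesis
    proof (rule has_derivative_eq_rhs, intro ext sum.cong[OF refl])
      fix v i assume "i \<in> I"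
      then show "of_nat (Poly_Mapping.lookup a i) * X' i v * X i t ^ (Poly_Mapping.lookup a i - 1) *
          (\<Prod>j\<in>I - {i}. X j t ^ Poly_Mapping.lookup a j) = of_nat (Poly_Mapping.lookup a i) *
          monom_eval (\<lambda>i. X i t) (a - Poly_Mapping.single i 1) * X' i v"
        by (subst monom_eval_remove[OF I(1) aI]) (simp_all add: mult_ac)
    qed
  qed
  have "((\<lambda>s. \<Sum>a\<in>Poly_Mapping.keys p. Poly_Mapping.lookup p a * monom_eval (\<lambda>i. X i s) a) has_derivative
    (\<lambda>v. \<Sum>a\<in>Poly_Mapping.keys p. Poly_Mapping.lookup p a * (\<Sum>i\<in>I. of_nat (Poly_Mapping.lookup a i) *
      monom_eval (\<lambda>i. X i t) (a - Poly_Mapping.single i 1) * X' i v))) (at t within S)"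
    by (intro has_derivative_sum has_derivative_mult_right mon)
  then show ?thesis
    unfolding poly_eval_def[symmetric]
  proof (rule has_derivative_eq_rhs, intro ext)
    fix v
    show "(\<Sum>a\<in>Poly_Mapping.keys p. Poly_Mapping.lookup p a * (\<Sum>i\<in>I. of_nat (Poly_Mapping.lookup a i) *
        monom_eval (\<lambda>i. X i t) (a - Poly_Mapping.single i 1) * X' i v)) =
      (\<Sum>i\<in>I. poly_eval (\<lambda>i. X i t) (pderiv_at i p) * X' i v)"
      unfolding poly_eval_pderiv_at sum_distrib_left sum_distrib_right
      by (subst sum.swap) (simp add: mult_ac)
  qed
qed

lemma poly_eval_has_field_derivative:
  "((\<lambda>s. poly_eval (x(k := s)) p) has_field_derivative poly_eval x (pderiv_at k p)) (at (x k))"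
proof -
  define I where "I = insert k (\<Union>a\<in>Poly_Mapping.keys p. Poly_Mapping.keys a)"
  have "((\<lambda>s. poly_eval (\<lambda>i. if i = k then s else x i) p) has_derivative
    (\<lambda>v. \<Sum>i\<in>I. poly_eval (\<lambda>i. if i = k then x k else x i) (pderiv_at i p) * (if i = k then v else 0))) (at (x k))"
  proof (rule poly_eval_has_derivative)
    show "((\<lambda>s. if i = k then s else x i) has_derivative (\<lambda>v. if i = k then v else 0)) (at (x k))" for i
      by (cases "i = k") simp_all
  qed (auto simp: I_def)
  moreover have "(\<lambda>i. if i = k then s else x i) = x(k := s)" for s
    by auto
  moreover have "finite I" "k \<in> I" by (auto simp: I_def)
  ultimately show ?thesis
    by (simp add: has_field_derivative_def if_distrib[of "\<lambda>z. _ * z"] sum.delta' cong: if_cong)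
qed

lemma poly_eval_diff: "poly_eval x (p - q) = poly_eval x p - poly_eval x q"
  using poly_eval_add[of x "p - q" q] by (simp add: algebra_simps)

text \<open>Analytic derivatives are unique, so the formal derivative depends on the polynomial
  function only. The sum and product rules below are obtained in the same way.\<close>

lemma poly_eval_pderiv_at_cong:
  assumes "\<And>x. poly_eval x p = poly_eval x q"
  shows "poly_eval x (pderiv_at k p) = poly_eval x (pderiv_at k q)"
  using poly_eval_has_field_derivative[of x k p] poly_eval_has_field_derivative[of x k q]
  unfolding assms by (rule DERIV_unique)

lemma poly_eval_pderiv_at_add:
  "poly_eval x (pderiv_at k (p + q)) = poly_eval x (pderiv_at k p) + poly_eval x (pderiv_at k q)"
  using poly_eval_has_field_derivative[of x k "p + q"]
    DERIV_add[OF poly_eval_has_field_derivative[of x k p] poly_eval_has_field_derivative[of x k q]]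
  unfolding poly_eval_add by (rule DERIV_unique)

lemma poly_eval_pderiv_at_diff:
  "poly_eval x (pderiv_at k (p - q)) = poly_eval x (pderiv_at k p) - poly_eval x (pderiv_at k q)"
  using poly_eval_pderiv_at_add[of x k "p - q" q] by (simp add: algebra_simps)

lemma poly_eval_pderiv_at_mult:
  "poly_eval x (pderiv_at k (p * q)) =
     poly_eval x p * poly_eval x (pderiv_at k q) + poly_eval x q * poly_eval x (pderiv_at k p)"
  using poly_eval_has_field_derivative[of x k "p * q"]
    DERIV_mult[OF poly_eval_has_field_derivative[of x k p] poly_eval_has_field_derivative[of x k q]]
  unfolding poly_eval_mult by (auto dest: DERIV_unique simp: mult.commute)

lemma poly_eval_pderiv_at_Const [simp]: "poly_eval x (pderiv_at k (Const z)) = 0"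
  by (simp add: Const_def pderiv_at_def)

lemma poly_eval_pderiv_at_Var [simp]: "poly_eval x (pderiv_at k (Var i)) = (if i = k then 1 else 0)"
  by (auto simp: Var_def pderiv_at_def poly_eval_single monom_eval_def lookup_single)


section \<open>Derivations at generic points\<close>

definition generic_point :: "('p cpoly \<Rightarrow> 'p \<Rightarrow> complex) \<Rightarrow> bool" where
  "generic_point c \<longleftrightarrow> (\<forall>g. (\<exists>x. poly_eval x g \<noteq> 0) \<longrightarrow> eventually (\<lambda>h. poly_eval (c h) g \<noteq> 0) generic_filter)"

text \<open>At the index \<open>h\<close> a point of \<open>B\<close> with
  \<open>h \<noteq> 0\<close> is taken, which exists because \<open>B\<close> is not thin. Almost
  every \<open>h\<close> vanishes wherever a given \<open>g\<close> does, so these points avoid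
  \<open>g = 0\<close> almost everywhere.\<close>

lemma generic_point_exists:
  assumes "\<not> thin B"
  obtains c where "\<And>h. c h \<in> B" "generic_point c"
proof -
  have "\<exists>x\<in>B. (\<exists>c. poly_eval c h \<noteq> 0) \<longrightarrow> poly_eval x h \<noteq> 0" for h
  proof -
    have "\<exists>x\<in>B. poly_eval x h \<noteq> 0" if "\<exists>c. poly_eval c h \<noteq> 0" for h
      using assms that unfolding thin_def by blast
    \<comment> \<open>Makes \<open>B\<close> nonempty, which supplies a point also at those
      \<open>h\<close> that vanish identically.\<close>
    moreover have "\<exists>c. poly_eval c 1 \<noteq> 0" by simp
    ultimately show ?thesis by blast
  qed
  then obtain c where c: "\<And>h. c h \<in> B" "\<And>h. (\<exists>c. poly_eval c h \<noteq> 0) \<Longrightarrow> poly_eval (c h) h \<noteq> 0"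
    by metis
  have "generic_point c"
    unfolding generic_point_def
  proof (intro allI impI)
    fix g :: "'a cpoly" assume "\<exists>x. poly_eval x g \<noteq> 0"
    then obtain x where "poly_eval x g \<noteq> 0" by blast
    from eventually_generic[OF this] show "eventually (\<lambda>h. poly_eval (c h) g \<noteq> 0) generic_filter"
      by (rule eventually_mono) (use c(2) in blast)
  qed
  then show ?thesis using that c(1) by blast
qed

text \<open>By algebraic independence the value of a polynomial at the generic point determines its
  polynomial function, so the partial derivative descends to the ring generated by the constants and
  the parameters. The set \<open>Y\<close> is meant for the remaining coordinates of a solution,
  about which nothing but finiteness is known.\<close>

lemma generic_derivation:
  fixes c :: "'p cpoly \<Rightarrow> 'p \<Rightarrow> complex"
  assumes c: "generic_point c" and Y: "finite Y"
  obtains K D where "subring K" "derivation_on K D" "Y \<subseteq> K"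
    "\<And>i. mk (\<lambda>h. c h i) \<in> K" "\<And>i. D (mk (\<lambda>h. c h i)) = (if i = k then 1 else 0)"
    "\<And>z. mk (\<lambda>h. z) \<in> K" "\<And>z. D (mk (\<lambda>h. z)) = 0"
proof -
  define ev where "ev p = mk (\<lambda>h. poly_eval (c h) p)" for p
  define K0 where "K0 = range ev"
  define D0 where "D0 z = ev (pderiv_at k (SOME p. ev p = z))" for z
  have inj: "poly_eval x p = poly_eval x q" if "ev p = ev q" for p q x
  proof (rule ccontr)
    assume "poly_eval x p \<noteq> poly_eval x q"
    then have "\<exists>x. poly_eval x (p - q) \<noteq> 0" by (auto simp: poly_eval_diff)
    then have "eventually (\<lambda>h. poly_eval (c h) (p - q) \<noteq> 0) generic_filter"
      using c unfolding generic_point_def by blast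
    moreover have "eventually (\<lambda>h. poly_eval (c h) p = poly_eval (c h) q) generic_filter"
      using that by (simp add: ev_def mk_eq_iff)
    ultimately have "eventually (\<lambda>h :: 'p cpoly. False) generic_filter"
      by (rule eventually_elim2) (simp add: poly_eval_diff)
    then show False by (simp add: generic_filter_nontrivial)
  qed
  have D0: "D0 (ev p) = ev (pderiv_at k p)" for p
  proof -
    have "ev (SOME q. ev q = ev p) = ev p" by (rule someI) (rule refl)
    then show ?thesis
      unfolding D0_def ev_def by (intro arg_cong[of _ _ mk] ext poly_eval_pderiv_at_cong inj) (simp add: ev_def)
  qed
  have ev: "ev (p + q) = ev p + ev q" "ev (p - q) = ev p - ev q" "ev (p * q) = ev p * ev q" for p q
    by (simp_all add: ev_def poly_eval_add poly_eval_diff poly_eval_mult mk_add mk_diff mk_mult)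
  have Const: "mk (\<lambda>h. z) = ev (Const z)" and Var: "mk (\<lambda>h. c h i) = ev (Var i)" for z i
    by (simp_all add: ev_def)
  have "subring K0"
    unfolding subring_def K0_def
  proof (intro conjI ballI)
    show "1 \<in> range ev"
      by (rule image_eqI[of _ _ "Const 1"]) (simp_all flip: Const mk_1)
  next
    fix x y assume "x \<in> range ev" "y \<in> range ev"
    then show "x - y \<in> range ev" "x * y \<in> range ev"
      by (auto simp flip: ev)
  qed
  moreover have "derivation_on K0 D0"
    unfolding derivation_on_def K0_def
    by (auto simp: D0 simp flip: ev)
      (simp_all add: ev_def poly_eval_pderiv_at_add poly_eval_pderiv_at_mult mk_add mk_mult poly_eval_add poly_eval_mult)
  ultimately obtain K D where K: "subring K" "derivation_on K D" "Y \<subseteq> K" "K0 \<subseteq> K" "\<And>x. x \<in> K0 \<Longrightarrow> D x = D0 x"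
    using derivation_extend_finite[OF Y] by metis
  have K0: "ev p \<in> K0" for p by (simp add: K0_def)
  show ?thesis
  proof (rule that[OF K(1-3)])
    show "mk (\<lambda>h. c h i) \<in> K" "mk (\<lambda>h. z) \<in> K" for i z
      using K0 K(4) unfolding Const Var by blast+
    show "D (mk (\<lambda>h. c h i)) = (if i = k then 1 else 0)" for i
      unfolding Var K(5)[OF K0] D0 by (simp add: ev_def mk_0 mk_1)
    show "D (mk (\<lambda>h. z)) = 0" for z
      unfolding Const K(5)[OF K0] D0 by (simp add: ev_def mk_0)
  qed
qed

section \<open>General coefficients and general data points\<close>

lemma monom_eval_pred:
  assumes "Poly_Mapping.lookup a i \<noteq> 0"
  shows "monom_eval x a = x i * monom_eval x (a - Poly_Mapping.single i 1)"
proof -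
  have "a = Poly_Mapping.single i 1 + (a - Poly_Mapping.single i 1)"
    by (rule poly_mapping_eqI) (use assms in \<open>auto simp: lookup_add lookup_minus lookup_single when_def\<close>)
  then have "monom_eval x a = monom_eval x (Poly_Mapping.single i 1) * monom_eval x (a - Poly_Mapping.single i 1)"
    by (metis monom_eval_add)
  then show ?thesis by (simp add: monom_eval_def)
qed

lemma monom_eval_nonzero:
  fixes x :: "'v \<Rightarrow> 'a::field"
  shows "(\<And>i. x i \<noteq> 0) \<Longrightarrow> monom_eval x a \<noteq> 0"
  by (simp add: monom_eval_def)

lemma mk_nonzero: "(\<And>h. x h \<noteq> 0) \<Longrightarrow> mk x \<noteq> 0"
  by (simp add: mk_eq_0_iff generic_filter_nontrivial)

text \<open>
  Differentiating \<open>\<Sum> c\<^sub>a x\<^sup>a = 0\<close> with respect to one coefficient \<open>c\<^sub>b\<close> at a generic point gives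
  \<open>x\<^sup>b + \<mu> \<Sum> x\<^sub>i \<partial>x\<^sub>i = 0\<close>, where the sum vanishes because \<open>\<Sum> x\<^sub>i\<^sup>2 = 0\<close>.
\<close>

lemma thin_tangent_coefficients:
  fixes B :: "'n::finite exponent set"
  assumes "finite B" "B \<noteq> {}"
  shows "thin {c. \<exists>x \<mu>. (\<forall>i. x i \<noteq> 0) \<and> (\<Sum>a\<in>B. c a * monom_eval x a) = 0 \<and>
    (\<forall>i. (\<Sum>a\<in>B. of_nat (Poly_Mapping.lookup a i) * (c a * monom_eval x a)) =
      (if i \<in> I then \<mu> * x i ^ 2 else 0)) \<and> (\<Sum>i\<in>I. x i ^ 2) = 0}"
    (is "thin {c. \<exists>x \<mu>. ?P c x \<mu>}")
proof (rule ccontr)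
  assume "\<not> ?thesis"
  then obtain c where c: "\<And>h. c h \<in> {c. \<exists>x \<mu>. ?P c x \<mu>}" and gen: "generic_point c"
    by (rule generic_point_exists) blast
  then have "\<forall>h. \<exists>x \<mu>. ?P (c h) x \<mu>" by blast
  from choice[OF this] obtain x where "\<forall>h. \<exists>\<mu>. ?P (c h) (x h) \<mu>" ..
  from choice[OF this] obtain \<mu> where "\<forall>h. ?P (c h) (x h) (\<mu> h)" ..
  note x = spec[OF this]
  obtain b where b: "b \<in> B" using assms(2) by blast
  define X where "X = (\<lambda>i. mk (\<lambda>h. x h i))"
  define C where "C a = mk (\<lambda>h. c h a)" for a
  define M where "M = mk \<mu>"
  let ?m = "monom_eval X"
  have X: "X i \<noteq> 0" for i
    unfolding X_def using x by (intro mk_nonzero) blast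
  have "mk (\<lambda>h. \<Sum>a\<in>B. c h a * monom_eval (x h) a) = 0"
    using x by (intro mk_eq_0) blast
  then have eq1: "(\<Sum>a\<in>B. C a * ?m a) = 0"
    by (simp add: mk_sum mk_mult mk_monom_eval C_def X_def)
  have "mk (\<lambda>h. \<Sum>a\<in>B. of_nat (Poly_Mapping.lookup a i) * (c h a * monom_eval (x h) a)) =
      mk (\<lambda>h. if i \<in> I then \<mu> h * x h i ^ 2 else 0)" for i
    using x by (intro arg_cong[of _ _ mk] ext) blast
  then have eq2: "(\<Sum>a\<in>B. of_nat (Poly_Mapping.lookup a i) * (C a * ?m a)) = (if i \<in> I then M * X i ^ 2 else 0)" for i
    by (simp add: mk_sum mk_mult mk_monom_eval mk_of_nat mk_power mk_0 C_def X_def M_def cong: if_cong)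
  have "mk (\<lambda>h. \<Sum>i\<in>I. x h i ^ 2) = 0"
    using x by (intro mk_eq_0) blast
  then have eq3: "(\<Sum>i\<in>I. X i ^ 2) = 0"
    by (simp add: mk_sum mk_power X_def)
  obtain K D where K: "subring K" "derivation_on K D" "range X \<subseteq> K"
    "\<And>a. C a \<in> K" "\<And>a. D (C a) = (if a = b then 1 else 0)"
    unfolding C_def by (rule generic_derivation[OF gen, of "range X" b]) auto
  have XK: "X i \<in> K" for i using K(3) by blast
  have mK: "?m a \<in> K" for a by (rule subring_monom_eval[OF K(1) XK])
  \<comment> \<open>All \<open>X i\<close> are invertible. In terms of the logarithmic derivatives
    \<open>D (X i) / X i\<close> the coefficients become the sums over \<open>B\<close> that
    \<open>eq2\<close> evaluates.\<close>
  have Dm: "D (?m a) = (\<Sum>i\<in>UNIV. of_nat (Poly_Mapping.lookup a i) * ?m a * (D (X i) / X i))" for a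
  proof -
    have "of_nat (Poly_Mapping.lookup a i) * ?m (a - Poly_Mapping.single i 1) * D (X i) =
      of_nat (Poly_Mapping.lookup a i) * ?m a * (D (X i) / X i)" for i
      using X monom_eval_pred[of a i X] by (cases "Poly_Mapping.lookup a i = 0") simp_all
    then show ?thesis
      using derivation_monom_eval[OF K(1,2) XK, of UNIV a] by simp
  qed
  have "0 = D (\<Sum>a\<in>B. C a * ?m a)"
    by (simp only: eq1 derivation_0[OF K(1,2)])
  also have "\<dots> = (\<Sum>a\<in>B. C a * D (?m a) + (if a = b then ?m a else 0))"
    by (subst derivation_sum[OF K(1,2)])
      (auto simp: subring_mult[OF K(1)] derivation_mult[OF K(1,2)] K(4,5) mK intro!: sum.cong)
  also have "\<dots> = (\<Sum>a\<in>B. C a * D (?m a)) + ?m b"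
    using assms(1) b by (simp add: sum.distrib)
  also have "(\<Sum>a\<in>B. C a * D (?m a)) =
      (\<Sum>i\<in>UNIV. (\<Sum>a\<in>B. of_nat (Poly_Mapping.lookup a i) * (C a * ?m a)) * (D (X i) / X i))"
    unfolding Dm sum_distrib_left sum_distrib_right by (subst sum.swap) (simp add: mult_ac)
  also have "\<dots> = (\<Sum>i\<in>UNIV. if i \<in> I then M * (X i * D (X i)) else 0)"
    unfolding eq2 by (rule sum.cong) (use X in \<open>auto simp: power2_eq_square\<close>)
  also have "\<dots> = M * (\<Sum>i\<in>I. X i * D (X i))"
    by (simp add: sum.If_cases sum_distrib_left)
  finally have main: "0 = M * (\<Sum>i\<in>I. X i * D (X i)) + ?m b" .
  have "0 = D (\<Sum>i\<in>I. X i ^ 2)"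
    by (simp only: eq3 derivation_0[OF K(1,2)])
  also have "\<dots> = (\<Sum>i\<in>I. 2 * (X i * D (X i)))"
    by (subst derivation_sum[OF K(1,2)])
      (auto simp: subring_power[OF K(1)] derivation_power[OF K(1,2)] XK mult_ac intro!: sum.cong)
  also have "\<dots> = 2 * (\<Sum>i\<in>I. X i * D (X i))"
    by (simp add: sum_distrib_left)
  finally have "(\<Sum>i\<in>I. X i * D (X i)) = 0" by simp
  with main have "?m b = 0" by simp
  then show False using monom_eval_nonzero[of X b] X by blast
qed

lemma mk_poly_eval:
  "mk (\<lambda>h. poly_eval (x h) p) = (\<Sum>a\<in>Poly_Mapping.keys p.
     mk (\<lambda>h. Poly_Mapping.lookup p a) * monom_eval (\<lambda>i. mk (\<lambda>h. x h i)) a)"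
  unfolding poly_eval_def by (simp add: mk_sum mk_mult mk_monom_eval)

text \<open>The coefficients of \<open>p\<close> are complex constants, which \<open>D\<close>
  kills, so only the chain rule in the coordinates remains.\<close>

lemma derivation_poly_eval:
  fixes x :: "'p cpoly \<Rightarrow> 'v::finite \<Rightarrow> complex"
  assumes K: "subring K" "derivation_on K D" and x: "\<And>i. mk (\<lambda>h. x h i) \<in> K"
    and const: "\<And>z. mk (\<lambda>h. z) \<in> K" "\<And>z. D (mk (\<lambda>h. z)) = 0"
  shows "mk (\<lambda>h. poly_eval (x h) p) \<in> K"
    and "D (mk (\<lambda>h. poly_eval (x h) p)) =
      (\<Sum>i\<in>UNIV. mk (\<lambda>h. poly_eval (x h) (pderiv_at i p)) * D (mk (\<lambda>h. x h i)))"
proof -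
  note mK = subring_monom_eval[OF K(1) x]
  show "mk (\<lambda>h. poly_eval (x h) p) \<in> K"
    unfolding mk_poly_eval by (intro subring_sum[OF K(1)] subring_mult[OF K(1)] mK const)
  let ?X = "\<lambda>i. mk (\<lambda>h. x h i)"
  have "D (mk (\<lambda>h. poly_eval (x h) p)) = (\<Sum>a\<in>Poly_Mapping.keys p. mk (\<lambda>h. Poly_Mapping.lookup p a) * D (monom_eval ?X a))"
    unfolding mk_poly_eval
    by (subst derivation_sum[OF K])
      (simp_all add: subring_mult[OF K(1)] mK const derivation_mult[OF K])
  also have "\<dots> = (\<Sum>a\<in>Poly_Mapping.keys p. mk (\<lambda>h. Poly_Mapping.lookup p a) *
      (\<Sum>i\<in>UNIV. of_nat (Poly_Mapping.lookup a i) * monom_eval ?X (a - Poly_Mapping.single i 1) * D (?X i)))"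
    by (subst derivation_monom_eval[OF K x, of UNIV]) simp_all
  also have "\<dots> = (\<Sum>i\<in>UNIV. (\<Sum>a\<in>Poly_Mapping.keys p. mk (\<lambda>h. Poly_Mapping.lookup p a) *
      (of_nat (Poly_Mapping.lookup a i) * monom_eval ?X (a - Poly_Mapping.single i 1))) * D (?X i))"
    unfolding sum_distrib_left sum_distrib_right by (subst sum.swap) (simp add: mult_ac)
  also have "\<dots> = (\<Sum>i\<in>UNIV. mk (\<lambda>h. poly_eval (x h) (pderiv_at i p)) * D (?X i))"
    unfolding poly_eval_pderiv_at by (simp add: mk_sum mk_mult mk_of_nat mk_monom_eval)
  finally show "D (mk (\<lambda>h. poly_eval (x h) p)) =
      (\<Sum>i\<in>UNIV. mk (\<lambda>h. poly_eval (x h) (pderiv_at i p)) * D (mk (\<lambda>h. x h i)))" .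
qed

text \<open>
  Here \<open>(\<alpha>, \<beta>)\<close> is a left kernel vector of the Jacobian of the Lagrange system with respect to
  \<open>\<lambda>\<close> and the variables \<open>x\<^sub>j\<close> with \<open>j \<in> J\<close>. Applied to the equations differentiated with respect to
  \<open>u\<^sub>k\<close> it gives \<open>\<lambda> \<beta>\<^sub>k = 0\<close>.
\<close>

lemma thin_degenerate_critical_points:
  fixes f :: "'n::finite cpoly"
  assumes smooth: "\<And>x. (\<forall>j. x j \<noteq> 0 \<longleftrightarrow> j \<in> J) \<Longrightarrow> poly_eval x f = 0 \<Longrightarrow>
    (\<forall>j\<in>J. poly_eval x (pderiv_at j f) = 0) \<Longrightarrow> False"
  shows "thin {u. \<exists>l x \<alpha> \<beta>. (\<forall>j. x j \<noteq> 0 \<longleftrightarrow> j \<in> J) \<and> poly_eval x f = 0 \<and>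
    (\<forall>i. poly_eval x (pderiv_at i f) = l * (u i - x i)) \<and> l \<noteq> 0 \<and> (\<alpha> \<noteq> 0 \<or> (\<exists>i. \<beta> i \<noteq> 0)) \<and>
    (\<forall>j\<in>J. \<alpha> * poly_eval x (pderiv_at j f) +
      (\<Sum>k\<in>UNIV. \<beta> k * poly_eval x (pderiv_at j (pderiv_at k f))) + l * \<beta> j = 0) \<and>
    (\<Sum>k\<in>UNIV. \<beta> k * (u k - x k)) = 0}"
    (is "thin {u. \<exists>l x \<alpha> \<beta>. ?P u l x \<alpha> \<beta>}")
proof (rule ccontr)
  assume "\<not> ?thesis"
  then obtain u where u: "\<And>h. u h \<in> {u. \<exists>l x \<alpha> \<beta>. ?P u l x \<alpha> \<beta>}" and gen: "generic_point u"
    by (rule generic_point_exists) blast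
  then have "\<forall>h. \<exists>l x \<alpha> \<beta>. ?P (u h) l x \<alpha> \<beta>" by blast
  from choice[OF this] obtain l where "\<forall>h. \<exists>x \<alpha> \<beta>. ?P (u h) (l h) x \<alpha> \<beta>" ..
  from choice[OF this] obtain x where "\<forall>h. \<exists>\<alpha> \<beta>. ?P (u h) (l h) (x h) \<alpha> \<beta>" ..
  from choice[OF this] obtain \<alpha> where "\<forall>h. \<exists>\<beta>. ?P (u h) (l h) (x h) (\<alpha> h) \<beta>" ..
  from choice[OF this] obtain \<beta> where "\<forall>h. ?P (u h) (l h) (x h) (\<alpha> h) (\<beta> h)" ..
  note P = spec[OF this]
  define X where "X i = mk (\<lambda>h. x h i)" for i
  define U where "U i = mk (\<lambda>h. u h i)" for i
  define L where "L = mk l"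
  define AL where "AL = mk \<alpha>"
  define BE where "BE i = mk (\<lambda>h. \<beta> h i)" for i
  define F where "F j = mk (\<lambda>h. poly_eval (x h) (pderiv_at j f))" for j
  define H where "H j k = mk (\<lambda>h. poly_eval (x h) (pderiv_at j (pderiv_at k f)))" for j k
  have L: "L \<noteq> 0"
    unfolding L_def using P by (intro mk_nonzero) blast
  have X0: "X j = 0" if "j \<notin> J" for j
    unfolding X_def using P that by (intro mk_eq_0) blast
  have eq1: "mk (\<lambda>h. poly_eval (x h) f) = 0"
    using P by (intro mk_eq_0) blast
  have "mk (\<lambda>h. poly_eval (x h) (pderiv_at i f)) = mk (\<lambda>h. l h * (u h i - x h i))" for i
    using P by (intro arg_cong[of _ _ mk] ext) blast
  then have eq2: "mk (\<lambda>h. poly_eval (x h) (pderiv_at i f)) = L * (U i - X i)" for i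
    by (simp add: mk_mult mk_diff L_def U_def X_def)
  have "mk (\<lambda>h. \<alpha> h * poly_eval (x h) (pderiv_at j f) +
      (\<Sum>k\<in>UNIV. \<beta> h k * poly_eval (x h) (pderiv_at j (pderiv_at k f))) + l h * \<beta> h j) = 0" if "j \<in> J" for j
    using P that by (intro mk_eq_0) blast
  then have eq3: "AL * F j + (\<Sum>k\<in>UNIV. BE k * H j k) = - (L * BE j)" if "j \<in> J" for j
    using that by (simp add: mk_add mk_sum mk_mult AL_def F_def BE_def H_def L_def eq_neg_iff_add_eq_0)
  have "mk (\<lambda>h. \<Sum>k\<in>UNIV. \<beta> h k * (u h k - x h k)) = 0"
    using P by (intro mk_eq_0) blast
  then have eq4: "(\<Sum>k\<in>UNIV. BE k * (U k - X k)) = 0"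
    by (simp add: mk_sum mk_mult mk_diff BE_def U_def X_def)
  have BE: "BE k = 0" for k
  proof -
    obtain K D where K: "subring K" "derivation_on K D" "insert L (range X) \<subseteq> K"
      "\<And>i. U i \<in> K" "\<And>i. D (U i) = (if i = k then 1 else 0)"
      "\<And>z. mk (\<lambda>h. z) \<in> K" "\<And>z. D (mk (\<lambda>h. z)) = 0"
      unfolding U_def by (rule generic_derivation[OF gen, of "insert L (range X)" k]) auto
    have XK: "X i \<in> K" and LK: "L \<in> K" for i using K(3) by blast+
    have chain: "D (mk (\<lambda>h. poly_eval (x h) p)) =
        (\<Sum>i\<in>UNIV. mk (\<lambda>h. poly_eval (x h) (pderiv_at i p)) * D (X i))" for p
      unfolding X_def
      by (rule derivation_poly_eval(2)[OF K(1,2) _ K(6,7)]) (use XK in \<open>simp add: X_def\<close>)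
    \<comment> \<open>Coordinates outside \<open>J\<close> vanish in the ultrapower, and so do their
      derivatives. This is why the kernel condition is imposed for \<open>j \<in> J\<close>
      only.\<close>
    have DX0: "D (X j) = 0" if "j \<notin> J" for j
      using X0[OF that] derivation_0[OF K(1,2)] by simp
    have d1: "(\<Sum>j\<in>UNIV. F j * D (X j)) = 0"
      using chain[of f] eq1 derivation_0[OF K(1,2)] by (simp add: F_def)
    have d2: "(\<Sum>j\<in>UNIV. H j i * D (X j)) = L * ((if i = k then 1 else 0) - D (X i)) + (U i - X i) * D L" for i
      using chain[of "pderiv_at i f"] eq2[of i]
      by (simp add: H_def derivation_mult[OF K(1,2)] derivation_diff[OF K(1,2)] subring_diff[OF K(1)] K(4,5) XK LK)
    \<comment> \<open>The differentiated equations are paired with the kernel vector and the double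
      sum is evaluated by rows and by columns. The terms with \<open>D (X i)\<close> agree on both
      sides, \<open>D L\<close> drops out by \<open>eq4\<close>, and \<open>BE k * L\<close> is left
      over.\<close>
    have "(\<Sum>j\<in>UNIV. (AL * F j + (\<Sum>i\<in>UNIV. BE i * H j i)) * D (X j)) =
        AL * (\<Sum>j\<in>UNIV. F j * D (X j)) + (\<Sum>i\<in>UNIV. BE i * (\<Sum>j\<in>UNIV. H j i * D (X j)))"
      unfolding sum_distrib_left distrib_right sum.distrib sum_distrib_right
      by (subst (2) sum.swap) (simp add: mult_ac)
    also have "\<dots> = (\<Sum>i\<in>UNIV. BE i * (L * ((if i = k then 1 else 0) - D (X i)) + (U i - X i) * D L))"
      by (simp add: d1 d2)
    also have "\<dots> = (\<Sum>i\<in>UNIV. (if i = k then BE i * L else 0)) - (\<Sum>i\<in>UNIV. L * BE i * D (X i)) +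
        (\<Sum>i\<in>UNIV. BE i * (U i - X i)) * D L"
      unfolding sum_distrib_right sum_subtractf[symmetric] sum.distrib[symmetric]
      by (rule sum.cong) (auto simp: algebra_simps)
    also have "\<dots> = BE k * L - (\<Sum>i\<in>UNIV. L * BE i * D (X i))"
      by (simp add: eq4)
    finally have "(\<Sum>j\<in>UNIV. (AL * F j + (\<Sum>i\<in>UNIV. BE i * H j i)) * D (X j)) =
        BE k * L - (\<Sum>i\<in>UNIV. L * BE i * D (X i))" .
    moreover have "(\<Sum>j\<in>UNIV. (AL * F j + (\<Sum>i\<in>UNIV. BE i * H j i)) * D (X j)) =
        (\<Sum>j\<in>UNIV. - (L * BE j * D (X j)))"
    proof (rule sum.cong[OF refl])
      fix j
      show "(AL * F j + (\<Sum>i\<in>UNIV. BE i * H j i)) * D (X j) = - (L * BE j * D (X j))"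
        by (cases "j \<in> J") (simp_all add: eq3 DX0)
    qed
    ultimately show ?thesis using L by (simp add: sum_negf)
  qed
  \<comment> \<open>Finitely many equations in the ultrapower hold together at some index. There the
    kernel vector reduces to its entry \<alpha>, which must be nonzero, and the point is a singular
    zero.\<close>
  have "eventually (\<lambda>h. \<forall>k. \<beta> h k = 0) generic_filter"
    using BE by (intro eventually_all_finite) (simp add: BE_def mk_eq_0_iff)
  then obtain h where h: "\<And>k. \<beta> h k = 0"
    using eventually_happens'[OF generic_filter_nontrivial] by blast
  have Ph: "?P (u h) (l h) (x h) (\<alpha> h) (\<beta> h)" by (rule P)
  then have "\<alpha> h \<noteq> 0" using h by blast
  moreover have "\<forall>j\<in>J. \<alpha> h * poly_eval (x h) (pderiv_at j f) +
      (\<Sum>k\<in>UNIV. \<beta> h k * poly_eval (x h) (pderiv_at j (pderiv_at k f))) + l h * \<beta> h j = 0"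
    using Ph by blast
  ultimately have "\<forall>j\<in>J. poly_eval (x h) (pderiv_at j f) = 0" using h by simp
  then show False using smooth[of "x h"] Ph by blast
qed

section \<open>Initial forms of the Lagrange multiplier equations\<close>

lemma sum_option: "(\<Sum>i\<in>(UNIV :: 'n::finite option set). g i) = g None + (\<Sum>i\<in>UNIV. g (Some i))"
  by (simp add: UNIV_option_conv sum.reindex)

lemma monom_eval_single: "monom_eval x (Poly_Mapping.single i n) = x i ^ n"
  by (simp add: monom_eval_def)

lemma monom_eval_sum: "monom_eval x (sum f S) = (\<Prod>i\<in>S. monom_eval x (f i))"
proof (induction S rule: infinite_finite_induct)
  case (insert i S)
  then show ?case by (simp add: monom_eval_add)
qed (simp_all add: monom_eval_def)

lemma poly_eval_power: "poly_eval x (p ^ n) = poly_eval x p ^ n"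
  by (induction n) (simp_all add: poly_eval_mult)

lemma poly_eval_rename: "poly_eval x (rename h p) = poly_eval (\<lambda>i. x (h i)) p"
  unfolding rename_def poly_eval_def[of "\<lambda>i. x (h i)"]
  by (simp add: poly_eval_sum poly_eval_mult monom_eval_def poly_eval_prod poly_eval_power)

definition rename_exponent :: "('v \<Rightarrow> 'w) \<Rightarrow> 'v exponent \<Rightarrow> 'w exponent" where
  "rename_exponent h a = (\<Sum>i\<in>Poly_Mapping.keys a. Poly_Mapping.single (h i) (Poly_Mapping.lookup a i))"

lemma monom_eval_Var:
  fixes h :: "'v \<Rightarrow> 'w"
  shows "monom_eval (\<lambda>i. Var (h i)) a = Poly_Mapping.single (rename_exponent h a) 1"
proof -
  have "Var i ^ n = Poly_Mapping.single (Poly_Mapping.single i n) 1" for i :: 'w and n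
  proof (induction n)
    case (Suc n)
    then show ?case by (simp add: Var_def mult_single flip: single_add)
  qed simp
  moreover have "(\<Prod>i\<in>S. Poly_Mapping.single (g i) (1 :: complex)) = Poly_Mapping.single (sum g S) 1"
    for S :: "'v set" and g :: "'v \<Rightarrow> 'w exponent"
    by (induction S rule: infinite_finite_induct) (simp_all add: mult_single)
  ultimately show ?thesis by (simp add: monom_eval_def rename_exponent_def)
qed

lemma rename_alt: "rename h p = (\<Sum>a\<in>Poly_Mapping.keys p. Poly_Mapping.single (rename_exponent h a) (Poly_Mapping.lookup p a))"
  by (simp add: rename_def monom_eval_Var Const_def mult_single)

lemma monom_eval_rename_exponent: "monom_eval x (rename_exponent h a) = monom_eval (\<lambda>i. x (h i)) a"
  by (simp add: rename_exponent_def monom_eval_sum monom_eval_single) (simp add: monom_eval_def)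

lemma keys_rename: "Poly_Mapping.keys (rename h p) \<subseteq> rename_exponent h ` Poly_Mapping.keys p"
  unfolding rename_alt by (rule order_trans[OF keys_sum]) auto

section \<open>Weights of exponents and initial forms\<close>

definition weight :: "('v::finite \<Rightarrow> real) \<Rightarrow> 'v exponent \<Rightarrow> real" where
  "weight w a = (\<Sum>i\<in>UNIV. w i * real (Poly_Mapping.lookup a i))"

lemma weight_0 [simp]: "weight w 0 = 0"
  by (simp add: weight_def)

lemma weight_add: "weight w (a + b) = weight w a + weight w b"
  by (simp add: weight_def lookup_add algebra_simps sum.distrib)

lemma weight_sum: "weight w (sum f S) = (\<Sum>i\<in>S. weight w (f i))"
  by (induction S rule: infinite_finite_induct) (simp_all add: weight_add)

lemma weight_single: "weight w (Poly_Mapping.single i n) = w i * real n"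
proof -
  have "weight w (Poly_Mapping.single i n) = (\<Sum>j\<in>UNIV. if i = j then w j * real n else 0)"
    unfolding weight_def by (rule sum.cong) (auto simp: lookup_single when_def)
  then show ?thesis by simp
qed

lemma weight_rename_exponent: "weight w (rename_exponent h a) = weight (\<lambda>i. w (h i)) a"
proof -
  have "weight (\<lambda>i. w (h i)) a = (\<Sum>i\<in>Poly_Mapping.keys a. w (h i) * real (Poly_Mapping.lookup a i))"
    unfolding weight_def by (rule sum.mono_neutral_right) (auto simp: in_keys_iff)
  then show ?thesis by (simp add: rename_exponent_def weight_sum weight_single)
qed

lemma weight_pred:
  assumes "Poly_Mapping.lookup a i \<noteq> 0"
  shows "weight w (a - Poly_Mapping.single i 1) = weight w a - w i"
proof -
  have "a = Poly_Mapping.single i 1 + (a - Poly_Mapping.single i 1)"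
    by (rule poly_mapping_eqI) (use assms in \<open>auto simp: lookup_add lookup_minus lookup_single when_def\<close>)
  then have "weight w a = weight w (Poly_Mapping.single i 1) + weight w (a - Poly_Mapping.single i 1)"
    by (metis weight_add)
  then show ?thesis by (simp add: weight_single)
qed

text \<open>For \<open>v\<close> the highest weight in the support this is the value of the initial
  form. Allowing any \<open>v\<close> makes the expression additive in \<open>p\<close>, and it is 0
  at levels that do not occur.\<close>

definition weight_part :: "('v::finite \<Rightarrow> real) \<Rightarrow> real \<Rightarrow> 'v cpoly \<Rightarrow> ('v \<Rightarrow> complex) \<Rightarrow> complex" where
  "weight_part w v p x = (\<Sum>a | a \<in> Poly_Mapping.keys p \<and> weight w a = v. Poly_Mapping.lookup p a * monom_eval x a)"

lemma weight_part_superset: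
  assumes "finite S" "Poly_Mapping.keys p \<subseteq> S"
  shows "weight_part w v p x = (\<Sum>a\<in>S. if weight w a = v then Poly_Mapping.lookup p a * monom_eval x a else 0)"
proof -
  have "weight_part w v p x = (\<Sum>a | a \<in> S \<and> weight w a = v. Poly_Mapping.lookup p a * monom_eval x a)"
    unfolding weight_part_def
    by (rule sum.mono_neutral_left) (use assms in \<open>auto simp: in_keys_iff\<close>)
  also have "{a. a \<in> S \<and> weight w a = v} = S \<inter> {a. weight w a = v}" by auto
  finally show ?thesis using assms(1) by (simp add: sum.If_cases)
qed

lemma weight_part_add: "weight_part w v (p + q) x = weight_part w v p x + weight_part w v q x"
proof -
  let ?S = "Poly_Mapping.keys p \<union> Poly_Mapping.keys q"
  have "Poly_Mapping.keys (p + q) \<subseteq> ?S" by (rule keys_add)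
  then show ?thesis
    by (simp add: weight_part_superset[of ?S] flip: sum.distrib)
      (rule sum.cong, simp_all add: lookup_add distrib_right)
qed

lemma weight_part_0 [simp]: "weight_part w v 0 x = 0"
  by (simp add: weight_part_def)

lemma weight_part_sum: "weight_part w v (sum f S) x = (\<Sum>i\<in>S. weight_part w v (f i) x)"
  by (induction S rule: infinite_finite_induct) (simp_all add: weight_part_add)

lemma weight_part_diff: "weight_part w v (p - q) x = weight_part w v p x - weight_part w v q x"
  using weight_part_add[of w v "p - q" q x] by simp

lemma weight_part_single: "weight_part w v (Poly_Mapping.single a c) x = (if weight w a = v then c * monom_eval x a else 0)"
  by (subst weight_part_superset[of "{a}"]) auto

lemma weight_part_rename:
  "weight_part w v (rename h p) x = weight_part (\<lambda>i. w (h i)) v p (\<lambda>i. x (h i))"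
  unfolding rename_alt
  by (simp add: weight_part_sum weight_part_single weight_rename_exponent monom_eval_rename_exponent
      weight_part_superset[of "Poly_Mapping.keys p"] cong: if_cong)

text \<open>Multiplication by \<open>x i\<close> turns the derivative into an Euler operator, which
  preserves exponents; the weight level is shifted by \<open>w i\<close>. Terms without
  \<open>x i\<close> have coefficient 0 on both sides.\<close>

lemma weight_part_pderiv_at:
  "x i * weight_part w v (pderiv_at i p) x =
    (\<Sum>a\<in>Poly_Mapping.keys p. if weight w a = v + w i
       then of_nat (Poly_Mapping.lookup a i) * (Poly_Mapping.lookup p a * monom_eval x a) else 0)"
  unfolding pderiv_at_def weight_part_sum weight_part_single sum_distrib_left
proof (rule sum.cong[OF refl])
  fix a
  show "x i * (if weight w (a - Poly_Mapping.single i 1) = v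
      then of_nat (Poly_Mapping.lookup a i) * Poly_Mapping.lookup p a * monom_eval x (a - Poly_Mapping.single i 1) else 0) =
    (if weight w a = v + w i then of_nat (Poly_Mapping.lookup a i) * (Poly_Mapping.lookup p a * monom_eval x a) else 0)"
  proof (cases "Poly_Mapping.lookup a i = 0")
    case False
    then have "weight w (a - Poly_Mapping.single i 1) = v \<longleftrightarrow> weight w a = v + w i"
      using weight_pred[OF False, of w] by auto
    then show ?thesis using monom_eval_pred[OF False, of x] by (simp add: mult_ac)
  qed simp
qed

lemma keys_pderiv_at:
  assumes "b \<in> Poly_Mapping.keys (pderiv_at i p)"
  obtains a where "a \<in> Poly_Mapping.keys p" "Poly_Mapping.lookup a i \<noteq> 0" "b = a - Poly_Mapping.single i 1"
proof -
  have "b \<in> (\<Union>a\<in>Poly_Mapping.keys p. Poly_Mapping.keys (Poly_Mapping.single (a - Poly_Mapping.single i 1)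
       (of_nat (Poly_Mapping.lookup a i) * Poly_Mapping.lookup p a)))"
    using assms keys_sum unfolding pderiv_at_def by fast
  then show ?thesis using that by (auto split: if_splits)
qed

lemma lagrange_system_Some:
  "lagrange_system f u (Some i) = rename Some (pderiv_at i f)
     - Poly_Mapping.single (Poly_Mapping.single None 1) (u $ i)
     + Poly_Mapping.single (Poly_Mapping.single None 1 + Poly_Mapping.single (Some i) 1) 1"
  by (simp add: Var_def Const_def right_diff_distrib mult_single)

lemma keys_lagrange_system_Some:
  assumes "b \<in> Poly_Mapping.keys (lagrange_system f u (Some i))"
  obtains a where "a \<in> Poly_Mapping.keys f" "Poly_Mapping.lookup a i \<noteq> 0" "b = rename_exponent Some (a - Poly_Mapping.single i 1)"
  | "b = Poly_Mapping.single None 1" | "b = Poly_Mapping.single None 1 + Poly_Mapping.single (Some i) 1"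
proof -
  let ?p = "rename Some (pderiv_at i f)" and ?q = "Poly_Mapping.single (Poly_Mapping.single None 1) (u $ i)"
  let ?r = "Poly_Mapping.single (Poly_Mapping.single None 1 + Poly_Mapping.single (Some i) 1) (1 :: complex)"
  have "b \<in> Poly_Mapping.keys ?p \<union> Poly_Mapping.keys ?q \<union> Poly_Mapping.keys ?r"
    using assms keys_add[of "?p - ?q" ?r] keys_diff[of ?p ?q] unfolding lagrange_system_Some by blast
  then consider "b \<in> Poly_Mapping.keys ?p" | "b \<in> Poly_Mapping.keys ?q" | "b \<in> Poly_Mapping.keys ?r" by blast
  then show ?thesis
  proof cases
    case 1
    then obtain a' where a': "a' \<in> Poly_Mapping.keys (pderiv_at i f)" "b = rename_exponent Some a'"
      using keys_rename by blast
    from a'(1) show ?thesis by (rule keys_pderiv_at) (use a'(2) that(1) in blast)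
  qed (use that in \<open>auto split: if_splits\<close>)
qed

lemma weight_part_lagrange_Some:
  "weight_part w v (lagrange_system f u (Some i)) x =
     weight_part (\<lambda>i. w (Some i)) v (pderiv_at i f) (\<lambda>i. x (Some i))
     - (if w None = v then u $ i * x None else 0)
     + (if w None + w (Some i) = v then x None * x (Some i) else 0)"
  unfolding lagrange_system_Some
  by (simp add: weight_part_add weight_part_diff weight_part_rename weight_part_single
      weight_add weight_single monom_eval_add monom_eval_single)

text \<open>A sum of nonpositive terms is 0 only if all of them are, so the exponents of weight 0
  are those without variables of negative weight. Keeping only them has the same effect as setting
  these variables to 0.\<close>

lemma weight_part_nonpos:
  assumes "\<And>i. w i \<le> 0" and z: "\<And>i. z i = (if w i = 0 then y i else 0)"
  shows "weight_part w 0 p y = poly_eval z p"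
  unfolding poly_eval_def weight_part_superset[OF finite_keys order_refl]
proof (rule sum.cong[OF refl])
  fix a
  have "weight w a = 0 \<longleftrightarrow> (\<Sum>i\<in>UNIV. - (w i * real (Poly_Mapping.lookup a i))) = 0"
    by (simp add: weight_def sum_negf)
  also have "\<dots> \<longleftrightarrow> (\<forall>i. w i * real (Poly_Mapping.lookup a i) = 0)"
    using assms(1) by (subst sum_nonneg_eq_0_iff) (auto simp: mult_nonpos_nonneg)
  also have "\<dots> \<longleftrightarrow> (\<forall>i\<in>Poly_Mapping.keys a. w i = 0)"
    by (auto simp: in_keys_iff)
  finally have *: "weight w a = 0 \<longleftrightarrow> (\<forall>i\<in>Poly_Mapping.keys a. w i = 0)" .
  show "(if weight w a = 0 then Poly_Mapping.lookup p a * monom_eval y a else 0) =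
      Poly_Mapping.lookup p a * monom_eval z a"
  proof (cases "weight w a = 0")
    case True
    then have "monom_eval z a = monom_eval y a"
      unfolding monom_eval_def using * z by (intro prod.cong) simp_all
    then show ?thesis using True by simp
  next
    case False
    then obtain i where "i \<in> Poly_Mapping.keys a" "w i \<noteq> 0" using * by blast
    then have "monom_eval z a = 0"
      unfolding monom_eval_def using z by (subst prod_zero_iff) (auto simp: in_keys_iff)
    then show ?thesis using False by simp
  qed
qed

lemma poly_eval_pderiv_at_times:
  fixes x :: "'v::finite \<Rightarrow> complex"
  shows "x i * poly_eval x (pderiv_at i p) = (\<Sum>a\<in>Poly_Mapping.keys p.
     of_nat (Poly_Mapping.lookup a i) * (Poly_Mapping.lookup p a * monom_eval x a))"
proof -
  have "weight_part (\<lambda>_. 0) 0 q x = poly_eval x q" for q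
    by (rule weight_part_nonpos) simp_all
  moreover have "weight (\<lambda>_. 0) a = 0" for a :: "'v exponent"
    by (simp add: weight_def)
  ultimately show ?thesis using weight_part_pderiv_at[of x i "\<lambda>_. 0" 0 p] by simp
qed


section \<open>The genericity conditions\<close>

text \<open>
  The hypersurface that the terms in \<open>B\<close> define in the torus is smooth and not tangent to the
  quadric \<open>\<Sum>\<^sub>I x\<^sub>i\<^sup>2 = 0\<close>; smoothness is the case of empty \<open>I\<close>.
\<close>

definition transversal_coeffs :: "'n::finite exponent set \<Rightarrow> ('n exponent \<Rightarrow> complex) \<Rightarrow> bool" where
  "transversal_coeffs A c \<longleftrightarrow> (\<forall>B I. B \<subseteq> A \<longrightarrow> B \<noteq> {} \<longrightarrow>
     c \<notin> {c. \<exists>x \<mu>. (\<forall>i. x i \<noteq> 0) \<and> (\<Sum>a\<in>B. c a * monom_eval x a) = 0 \<and>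
      (\<forall>i. (\<Sum>a\<in>B. of_nat (Poly_Mapping.lookup a i) * (c a * monom_eval x a)) =
        (if i \<in> I then \<mu> * x i ^ 2 else 0)) \<and> (\<Sum>i\<in>I. x i ^ 2) = 0})"

lemma transversal_coeffsD:
  assumes "transversal_coeffs A c" "B \<subseteq> A" "B \<noteq> {}" "\<And>i. x i \<noteq> 0"
    and "(\<Sum>a\<in>B. c a * monom_eval x a) = 0"
    and "\<And>i. (\<Sum>a\<in>B. of_nat (Poly_Mapping.lookup a i) * (c a * monom_eval x a)) = (if i \<in> I then \<mu> * x i ^ 2 else 0)"
    and "(\<Sum>i\<in>I. x i ^ 2) = 0"
  shows False
  using assms unfolding transversal_coeffs_def by blast

lemma transversal_coeffs_cong:
  assumes "\<And>a. a \<in> A \<Longrightarrow> c a = d a"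
  shows "transversal_coeffs A c \<longleftrightarrow> transversal_coeffs A d"
proof -
  have imp: "transversal_coeffs A d" if c: "transversal_coeffs A c" and eq: "\<And>a. a \<in> A \<Longrightarrow> c a = d a" for c d
    unfolding transversal_coeffs_def
  proof (intro allI impI notI)
    fix B I assume B: "B \<subseteq> A" "B \<noteq> {}"
      and "d \<in> {c. \<exists>x \<mu>. (\<forall>i. x i \<noteq> 0) \<and> (\<Sum>a\<in>B. c a * monom_eval x a) = 0 \<and>
        (\<forall>i. (\<Sum>a\<in>B. of_nat (Poly_Mapping.lookup a i) * (c a * monom_eval x a)) =
          (if i \<in> I then \<mu> * x i ^ 2 else 0)) \<and> (\<Sum>i\<in>I. x i ^ 2) = 0}"
    then obtain x \<mu> where x: "\<And>i. x i \<noteq> 0" "(\<Sum>a\<in>B. d a * monom_eval x a) = 0"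
      "\<And>i. (\<Sum>a\<in>B. of_nat (Poly_Mapping.lookup a i) * (d a * monom_eval x a)) = (if i \<in> I then \<mu> * x i ^ 2 else 0)"
      "(\<Sum>i\<in>I. x i ^ 2) = 0" by blast
    have eqB: "c a = d a" if "a \<in> B" for a using that B eq by blast
    have "(\<Sum>a\<in>B. c a * monom_eval x a) = (\<Sum>a\<in>B. d a * monom_eval x a)"
      "\<And>i. (\<Sum>a\<in>B. of_nat (Poly_Mapping.lookup a i) * (c a * monom_eval x a)) =
        (\<Sum>a\<in>B. of_nat (Poly_Mapping.lookup a i) * (d a * monom_eval x a))"
      by (simp_all add: eqB cong: sum.cong)
    then show False using transversal_coeffsD[OF c B, of x I \<mu>] x by simp
  qed
  show ?thesis using imp[of c d] imp[of d c] assms by metis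
qed

lemma thin_not_transversal:
  assumes "finite A"
  shows "thin {c. \<not> transversal_coeffs A c}"
proof -
  have "thin (\<Union>(B, I)\<in>{B. B \<subseteq> A \<and> B \<noteq> {}} \<times> UNIV.
     {c. \<exists>x \<mu>. (\<forall>i. x i \<noteq> 0) \<and> (\<Sum>a\<in>B. c a * monom_eval x a) = 0 \<and>
      (\<forall>i. (\<Sum>a\<in>B. of_nat (Poly_Mapping.lookup a i) * (c a * monom_eval x a)) =
        (if i \<in> I then \<mu> * x i ^ 2 else 0)) \<and> (\<Sum>i\<in>I. x i ^ 2) = 0})"
  proof (rule thin_UN)
    show "finite ({B. B \<subseteq> A \<and> B \<noteq> {}} \<times> (UNIV :: 'a set set))"
      using assms by simp
    fix q :: "'a exponent set \<times> 'a set" assume "q \<in> {B. B \<subseteq> A \<and> B \<noteq> {}} \<times> UNIV"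
    then obtain B I where q: "q = (B, I)" "B \<subseteq> A" "B \<noteq> {}" by blast
    show "thin (case q of (B, I) \<Rightarrow> {c. \<exists>x \<mu>. (\<forall>i. x i \<noteq> 0) \<and> (\<Sum>a\<in>B. c a * monom_eval x a) = 0 \<and>
      (\<forall>i. (\<Sum>a\<in>B. of_nat (Poly_Mapping.lookup a i) * (c a * monom_eval x a)) =
        (if i \<in> I then \<mu> * x i ^ 2 else 0)) \<and> (\<Sum>i\<in>I. x i ^ 2) = 0})"
      unfolding q(1) prod.case
      by (rule thin_tangent_coefficients[OF finite_subset[OF q(2) assms] q(3)])
  qed
  then show ?thesis
    by (rule thin_mono) (unfold transversal_coeffs_def, blast)
qed

text \<open>Passes from functions on all exponents, where thinness lives, to polynomials with
  support exactly \<open>A\<close>.\<close>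

lemma holds_for_general_poly_transversal:
  fixes A :: "'n::finite exponent set"
  assumes A: "finite A" and P: "\<And>f. Poly_Mapping.keys f = A \<Longrightarrow> transversal_coeffs A (Poly_Mapping.lookup f) \<Longrightarrow> P f"
  shows "holds_for_general_poly A P"
proof -
  obtain h c0 where h: "poly_eval c0 h \<noteq> 0" "\<And>c. \<not> transversal_coeffs A c \<Longrightarrow> poly_eval c h = 0"
    using thin_not_transversal[OF A] unfolding thin_def by blast
  \<comment> \<open>The polynomial \<open>h\<close> may involve coefficients at exponents outside
    \<open>A\<close>. Fixing these at the values of \<open>c0\<close> keeps a polynomial that does
    not vanish identically and depends on the coefficients in \<open>A\<close> only.\<close>
  define h' where "h' = (\<Sum>a\<in>Poly_Mapping.keys h. Const (Poly_Mapping.lookup h a) *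
    monom_eval (\<lambda>i. if i \<in> A then Var i else Const (c0 i)) a)"
  have h': "poly_eval x h' = poly_eval (\<lambda>i. if i \<in> A then x i else c0 i) h" for x
  proof -
    have "poly_eval x (if i \<in> A then Var i else Const (c0 i)) = (if i \<in> A then x i else c0 i)" for i
      by simp
    then show ?thesis
      unfolding h'_def poly_eval_def[of "\<lambda>i. if i \<in> A then x i else c0 i"]
      by (simp add: poly_eval_sum poly_eval_mult monom_eval_def poly_eval_prod poly_eval_power)
  qed
  let ?U = "{f. Poly_Mapping.keys f = A \<and> poly_eval (Poly_Mapping.lookup f) h' \<noteq> 0}"
  have "openin (support_space A) ?U"
    unfolding support_space_def openin_pullback_topology
  proof (intro exI conjI)
    show "openin zariski {x. \<exists>p\<in>{h'}. poly_eval x p \<noteq> 0}"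
      unfolding openin_zariski by blast
  qed auto
  moreover have "P f" if "f \<in> ?U" for f
  proof (rule P)
    have "transversal_coeffs A (\<lambda>i. if i \<in> A then Poly_Mapping.lookup f i else c0 i)"
      using that h(2) h' by force
    then show "transversal_coeffs A (Poly_Mapping.lookup f)"
      by (subst transversal_coeffs_cong[of A _ "\<lambda>i. if i \<in> A then Poly_Mapping.lookup f i else c0 i"]) simp_all
  qed (use that in simp)
  moreover have "support_space A closure_of ?U = topspace (support_space A)"
  proof (intro equalityI subsetI)
    fix f assume "f \<in> topspace (support_space A)"
    then have f: "Poly_Mapping.keys f = A" by simp
    show "f \<in> support_space A closure_of ?U"
      unfolding in_closure_of
    proof (intro conjI allI impI)
      show "f \<in> topspace (support_space A)" using f by simp
      fix T assume T: "f \<in> T \<and> openin (support_space A) T"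
      then obtain p where p: "poly_eval (Poly_Mapping.lookup f) p \<noteq> 0"
        "\<And>g. Poly_Mapping.keys g = A \<Longrightarrow> poly_eval (Poly_Mapping.lookup g) p \<noteq> 0 \<Longrightarrow> g \<in> T"
        unfolding support_space_def openin_pullback_topology openin_zariski by auto
      \<comment> \<open>For density a point of \<open>?U\<close> is found on the line from
        \<open>f\<close> to \<open>?d\<close>. The factor \<open>\<Prod>a\<in>A. Var a\<close> keeps
        the coefficients at \<open>A\<close> nonzero, and cutting \<open>c0\<close> off outside of
        \<open>A\<close> keeps the others zero.\<close>
      let ?q = "p * (\<Prod>a\<in>A. Var a)" and ?d = "\<lambda>i. if i \<in> A then c0 i else 0"
      have "poly_eval (Poly_Mapping.lookup f) ?q \<noteq> 0"
        using p(1) f A by (auto simp: poly_eval_mult poly_eval_prod in_keys_iff)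
      moreover have "poly_eval ?d h' \<noteq> 0"
      proof -
        have "(\<lambda>i. if i \<in> A then ?d i else c0 i) = c0" by auto
        then show ?thesis using h(1) by (simp only: h') simp
      qed
      ultimately obtain s where
        s: "poly_eval (\<lambda>i. Poly_Mapping.lookup f i + s * (?d i - Poly_Mapping.lookup f i)) (?q * h') \<noteq> 0"
        by (rule nonvanishing_mult)
      define c where "c = (\<lambda>i. Poly_Mapping.lookup f i + s * (?d i - Poly_Mapping.lookup f i))"
      have c: "poly_eval c p \<noteq> 0" "poly_eval c h' \<noteq> 0" "\<And>a. a \<in> A \<Longrightarrow> c a \<noteq> 0"
        using s A unfolding c_def[symmetric] by (auto simp: poly_eval_mult poly_eval_prod)
      have c0: "c a = 0" if "a \<notin> A" for a
        using that f by (auto simp: c_def in_keys_iff)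
      define g where "g = Abs_poly_mapping c"
      have lg: "Poly_Mapping.lookup g = c"
        unfolding g_def by (rule lookup_Abs_poly_mapping) (use A c0 in \<open>auto intro: finite_subset\<close>)
      have kg: "Poly_Mapping.keys g = A"
        using c(3) c0 by (intro set_eqI) (metis in_keys_iff lg)
      show "\<exists>g. g \<in> ?U \<and> g \<in> T"
        using p(2)[of g] c kg lg by auto
    qed
  qed (use closure_of_subset_topspace in force)
  ultimately show ?thesis
    unfolding holds_for_general_poly_def by blast
qed

lemma sum_plus_delta:
  fixes g v :: "'n::finite \<Rightarrow> complex"
  shows "(\<Sum>k\<in>UNIV. (g k + (if k = j then l else 0)) * v k) = (\<Sum>k\<in>UNIV. v k * g k) + l * v j"
proof -
  have "(\<Sum>k\<in>UNIV. (g k + (if k = j then l else 0)) * v k) =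
      (\<Sum>k\<in>UNIV. v k * g k + (if k = j then l * v j else 0))"
    by (rule sum.cong) (auto simp: algebra_simps)
  then show ?thesis by (simp add: sum.distrib)
qed

lemma zeros_lagrange_system:
  fixes f :: "'n::finite cpoly"
  shows "z \<in> zeros (lagrange_system f u) \<longleftrightarrow> poly_eval (\<lambda>i. z $ Some i) f = 0 \<and>
     (\<forall>i. poly_eval (\<lambda>i. z $ Some i) (pderiv_at i f) = z $ None * (u $ i - z $ Some i))"
proof -
  note split = split_option_all[of "\<lambda>i. poly_eval (vec_nth z) (lagrange_system f u i) = 0"]
  show ?thesis
    unfolding zeros_def mem_Collect_eq split
    by (simp add: poly_eval_rename poly_eval_diff poly_eval_mult)
qed

lemma poly_eval_pderiv_at_rename_Some:
  "poly_eval x (pderiv_at k (rename Some p)) =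
     (case k of None \<Rightarrow> 0 | Some j \<Rightarrow> poly_eval (\<lambda>i. x (Some i)) (pderiv_at j p))"
proof -
  have "((\<lambda>s. poly_eval (\<lambda>i. (x(k := s)) (Some i)) p) has_field_derivative
      poly_eval x (pderiv_at k (rename Some p))) (at (x k))"
    using poly_eval_has_field_derivative[of x k "rename Some p"] by (simp only: poly_eval_rename)
  moreover have "((\<lambda>s. poly_eval (\<lambda>i. (x(k := s)) (Some i)) p) has_field_derivative
      (case k of None \<Rightarrow> 0 | Some j \<Rightarrow> poly_eval (\<lambda>i. x (Some i)) (pderiv_at j p))) (at (x k))"
  proof (cases k)
    case (Some j)
    have "(\<lambda>i. (x(k := s)) (Some i)) = (\<lambda>i. x (Some i))(j := s)" for s
      by (auto simp: Some)
    then show ?thesis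
      using poly_eval_has_field_derivative[of "\<lambda>i. x (Some i)" j p] by (simp only: Some option.case)
  qed simp
  ultimately show ?thesis by (rule DERIV_unique)
qed

definition degenerate_data :: "'n::finite cpoly \<Rightarrow> 'n set \<Rightarrow> ('n \<Rightarrow> complex) set" where
  "degenerate_data f J = {u. \<exists>l x \<alpha> \<beta>. (\<forall>j. x j \<noteq> 0 \<longleftrightarrow> j \<in> J) \<and> poly_eval x f = 0 \<and>
    (\<forall>i. poly_eval x (pderiv_at i f) = l * (u i - x i)) \<and> l \<noteq> 0 \<and> (\<alpha> \<noteq> 0 \<or> (\<exists>i. \<beta> i \<noteq> 0)) \<and>
    (\<forall>j\<in>J. \<alpha> * poly_eval x (pderiv_at j f) +
      (\<Sum>k\<in>UNIV. \<beta> k * poly_eval x (pderiv_at j (pderiv_at k f))) + l * \<beta> j = 0) \<and>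
    (\<Sum>k\<in>UNIV. \<beta> k * (u k - x k)) = 0}"

text \<open>The first condition keeps the term \<lambda> times \<open>u i\<close> present in each
  equation, the second serves the weights for which the multiplier terms dominate, and the third
  treats critical points on all coordinate strata \<open>J\<close>, not only in the torus.\<close>

definition general_data :: "'n::finite cpoly \<Rightarrow> ('n \<Rightarrow> complex) \<Rightarrow> bool" where
  "general_data f u \<longleftrightarrow> (\<forall>i. u i \<noteq> 0) \<and>
     (\<forall>B\<subseteq>Poly_Mapping.keys f. B \<noteq> {} \<longrightarrow> (\<Sum>a\<in>B. Poly_Mapping.lookup f a * monom_eval u a) \<noteq> 0) \<and>
     (\<forall>J. u \<notin> degenerate_data f J)"

section \<open>Critical points for general coefficients and general data\<close>

context
  fixes f :: "'n::finite cpoly"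
  assumes f: "transversal_coeffs (Poly_Mapping.keys f) (Poly_Mapping.lookup f)"
    and const: "0 \<in> Poly_Mapping.keys f"
begin

text \<open>On the stratum \<open>J\<close> only exponents supported in \<open>J\<close> survive;
  \<open>B\<close> is the set of these, nonempty because it contains 0. Replacing the vanishing
  coordinates by 1 gives a torus point to which transversality with empty \<open>I\<close>
  applies.\<close>

lemma no_singular_zero:
  assumes J: "\<forall>j. x j \<noteq> 0 \<longleftrightarrow> j \<in> J" and x: "poly_eval x f = 0" "\<forall>j\<in>J. poly_eval x (pderiv_at j f) = 0"
  shows False
proof -
  define w where "w i = (if i \<in> J then 0 else - 1 :: real)" for i
  define y where "y i = (if i \<in> J then x i else 1)" for i
  define B where "B = {a \<in> Poly_Mapping.keys f. weight w a = 0}"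
  have xy: "x i = (if w i = 0 then y i else 0)" for i
    using J by (auto simp: w_def y_def)
  have part: "weight_part w 0 p y = poly_eval x p" for p
    using xy by (intro weight_part_nonpos) (auto simp: w_def)
  have "(\<Sum>a\<in>B. Poly_Mapping.lookup f a * monom_eval y a) = 0"
    using part[of f] x(1) by (simp add: weight_part_def B_def)
  moreover have "(\<Sum>a\<in>B. of_nat (Poly_Mapping.lookup a i) * (Poly_Mapping.lookup f a * monom_eval y a)) = 0" for i
  proof (cases "i \<in> J")
    case True
    then have "(\<Sum>a\<in>Poly_Mapping.keys f. if weight w a = 0
       then of_nat (Poly_Mapping.lookup a i) * (Poly_Mapping.lookup f a * monom_eval y a) else 0) = 0"
      using weight_part_pderiv_at[of y i w 0 f] x(2) by (simp add: part w_def)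
    then show ?thesis by (simp add: B_def sum.If_cases Int_def)
  next
    case False
    have "Poly_Mapping.lookup a i = 0" if "a \<in> B" for a
    proof -
      have "(\<Sum>j\<in>UNIV. - (w j * real (Poly_Mapping.lookup a j))) = 0"
        using that by (simp add: B_def weight_def sum_negf)
      then have "\<forall>j\<in>UNIV. - (w j * real (Poly_Mapping.lookup a j)) = 0"
        by (subst (asm) sum_nonneg_eq_0_iff) (auto simp: w_def)
      then have "- (w i * real (Poly_Mapping.lookup a i)) = 0" by blast
      then show ?thesis using False by (simp add: w_def)
    qed
    then show ?thesis by simp
  qed
  moreover have "B \<subseteq> Poly_Mapping.keys f" "B \<noteq> {}"
    using const by (auto simp: B_def intro: exI[of _ 0])
  moreover have "y i \<noteq> 0" for i
    using J by (simp add: y_def)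
  ultimately show False
    using transversal_coeffsD[OF f, of B y "{}" 0] by simp
qed

lemma thin_degenerate_data: "thin (degenerate_data f J)"
  unfolding degenerate_data_def by (rule thin_degenerate_critical_points) (rule no_singular_zero)

text \<open>If this part of \<open>f\<close> vanished identically, so would its partial derivatives,
  and the point with all coordinates 1 would contradict transversality.\<close>

lemma thin_face_zero:
  assumes B: "B \<subseteq> Poly_Mapping.keys f" "B \<noteq> {}"
  shows "thin {u. (\<Sum>a\<in>B. Poly_Mapping.lookup f a * monom_eval u a) = 0}"
proof -
  have finB: "finite B" by (rule finite_subset[OF B(1) finite_keys])
  define g where "g = (\<Sum>a\<in>B. Poly_Mapping.single a (Poly_Mapping.lookup f a))"
  have lookup_g: "Poly_Mapping.lookup g a = (if a \<in> B then Poly_Mapping.lookup f a else 0)" for a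
    using finB by (simp add: g_def lookup_sum lookup_single when_def)
  have keys_g: "Poly_Mapping.keys g = B"
    using B(1) by (auto simp: in_keys_iff lookup_g split: if_splits)
  have g: "poly_eval x g = (\<Sum>a\<in>B. Poly_Mapping.lookup f a * monom_eval x a)" for x
    by (simp add: g_def poly_eval_sum poly_eval_single)
  have "\<exists>x. poly_eval x g \<noteq> 0"
  proof (rule ccontr)
    assume "\<nexists>x. poly_eval x g \<noteq> 0"
    then have g0: "poly_eval x g = 0" for x by blast
    have "poly_eval x (pderiv_at i g) = poly_eval x (pderiv_at i (Const 0))" for x i
      by (rule poly_eval_pderiv_at_cong) (simp add: g0)
    then have "(\<Sum>a\<in>B. of_nat (Poly_Mapping.lookup a i) * (Poly_Mapping.lookup g a * monom_eval x a)) = 0" for x i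
      using poly_eval_pderiv_at_times[of x i g] by (simp add: keys_g)
    then have "(\<Sum>a\<in>B. of_nat (Poly_Mapping.lookup a i) * (Poly_Mapping.lookup f a * monom_eval x a)) = 0" for x i
      by (simp add: lookup_g)
    then show False
      using transversal_coeffsD[OF f B, of "\<lambda>_. 1" "{}" 0] g0 g by simp
  qed
  then show ?thesis unfolding thin_def by (intro exI[of _ g]) (simp add: g)
qed

lemma holds_for_general_point_general_data:
  assumes "\<And>u. general_data f (vec_nth u) \<Longrightarrow> P u"
  shows "holds_for_general_point P"
proof -
  have "thin ((\<Union>i\<in>UNIV. {u. u i = 0}) \<union>
    (\<Union>B\<in>{B. B \<subseteq> Poly_Mapping.keys f \<and> B \<noteq> {}}. {u. (\<Sum>a\<in>B. Poly_Mapping.lookup f a * monom_eval u a) = 0}) \<union>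
    (\<Union>J\<in>UNIV. degenerate_data f J))" (is "thin ?S")
  proof (intro thin_Un thin_UN)
    show "thin {u. u i = 0}" for i :: 'n
      unfolding thin_def by (rule exI[of _ "Var i"]) (auto intro: exI[of _ "\<lambda>_. 1"])
  qed (auto simp: thin_face_zero thin_degenerate_data)
  then obtain h where h: "\<exists>c. poly_eval c h \<noteq> 0" "\<And>c. c \<in> ?S \<Longrightarrow> poly_eval c h = 0"
    unfolding thin_def by blast
  show ?thesis
    unfolding holds_for_general_point_def
  proof (intro exI[of _ "{x. \<forall>p\<in>{h}. poly_eval x p = 0}"] conjI allI impI)
    show "closedin zariski {x. \<forall>p\<in>{h}. poly_eval x p = 0}"
      unfolding closedin_zariski by blast
    show "{x. \<forall>p\<in>{h}. poly_eval x p = 0} \<noteq> UNIV"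
      using h(1) by blast
    fix u :: "complex ^ 'n"
    assume "vec_nth u \<notin> {x. \<forall>p\<in>{h}. poly_eval x p = 0}"
    then have "vec_nth u \<notin> ?S" using h(2)[of "vec_nth u"] by auto
    then show "P u"
      by (intro assms) (unfold general_data_def, blast)
  qed
qed

context
  fixes u :: "complex ^ 'n"
  assumes u: "general_data f (vec_nth u)"
begin

text \<open>If \<open>l = 0\<close>, the point would be a singular zero of \<open>f\<close> on its
  stratum. Hence \<open>l \<noteq> 0\<close>, and a nonzero kernel vector would make the data
  degenerate.\<close>

lemma kernel_trivial:
  assumes "\<And>j. x j \<noteq> 0 \<longleftrightarrow> j \<in> J" "poly_eval x f = 0" "\<And>i. poly_eval x (pderiv_at i f) = l * (u $ i - x i)"
    and "\<And>j. j \<in> J \<Longrightarrow> \<alpha> * poly_eval x (pderiv_at j f) +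
      (\<Sum>k\<in>UNIV. \<beta> k * poly_eval x (pderiv_at j (pderiv_at k f))) + l * \<beta> j = 0"
    and "(\<Sum>k\<in>UNIV. \<beta> k * (u $ k - x k)) = 0"
  shows "l \<noteq> 0 \<and> \<alpha> = 0 \<and> (\<forall>i. \<beta> i = 0)"
proof -
  have l: "l \<noteq> 0"
    using no_singular_zero[of x J] assms(1-3) by auto
  have "vec_nth u \<notin> degenerate_data f J"
    using u unfolding general_data_def by blast
  then have "\<not> (\<alpha> \<noteq> 0 \<or> (\<exists>i. \<beta> i \<noteq> 0))"
    unfolding degenerate_data_def using assms l by blast
  then show ?thesis using l by blast
qed

text \<open>The kernel conditions are one equation for each \<open>j \<in> J\<close> and one more.
  If some coordinate vanishes, these are fewer than the unknowns \<alpha> and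
  \<open>\<beta> i\<close>, so a nonzero kernel vector exists.\<close>

lemma critical_point_in_torus:
  assumes x: "poly_eval x f = 0" "\<And>i. poly_eval x (pderiv_at i f) = l * (u $ i - x i)"
  shows "l \<noteq> 0 \<and> (\<forall>i. x i \<noteq> 0)"
proof -
  define J where "J = {j. x j \<noteq> 0}"
  have J: "x j \<noteq> 0 \<longleftrightarrow> j \<in> J" for j by (simp add: J_def)
  have "x i \<noteq> 0" for i
  proof (rule ccontr)
    assume i: "\<not> x i \<noteq> 0"
    \<comment> \<open>The kernel conditions as a square matrix; the column \<open>None\<close>
      belongs to \<alpha>, and indices outside \<open>J\<close> give zero rows.\<close>
    define N :: "complex ^ 'n option ^ 'n option" where
      "N = (\<chi> r c. case r of None \<Rightarrow> (case c of None \<Rightarrow> 0 | Some k \<Rightarrow> u $ k - x k)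
        | Some j \<Rightarrow> if j \<in> J then (case c of None \<Rightarrow> poly_eval x (pderiv_at j f)
            | Some k \<Rightarrow> poly_eval x (pderiv_at j (pderiv_at k f)) + (if k = j then l else 0)) else 0)"
    have "row (Some i) N = 0"
      using i J by (simp add: row_def N_def vec_eq_iff)
    then have "det N = 0" by (rule det_zero_row)
    then have "\<not> (\<exists>B. B ** N = mat 1)"
      using invertible_left_inverse invertible_det_nz by blast
    then obtain v where v: "N *v v = 0" "v \<noteq> 0"
      unfolding matrix_left_invertible_ker by blast
    have row: "(\<Sum>c\<in>UNIV. N $ r $ c * v $ c) = 0" for r
      using v(1) by (simp add: matrix_vector_mult_def vec_eq_iff)
    have "l \<noteq> 0 \<and> v $ None = 0 \<and> (\<forall>k. v $ Some k = 0)"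
    proof (rule kernel_trivial[OF J x])
      show "(\<Sum>k\<in>UNIV. v $ Some k * (u $ k - x k)) = 0"
        using row[of None] by (simp add: sum_option N_def mult.commute)
      show "v $ None * poly_eval x (pderiv_at j f) +
          (\<Sum>k\<in>UNIV. v $ Some k * poly_eval x (pderiv_at j (pderiv_at k f))) + l * v $ Some j = 0" if "j \<in> J" for j
      proof -
        have "(\<Sum>k\<in>UNIV. (poly_eval x (pderiv_at j (pderiv_at k f)) + (if k = j then l else 0)) * v $ Some k) =
          (\<Sum>k\<in>UNIV. v $ Some k * poly_eval x (pderiv_at j (pderiv_at k f))) + l * v $ Some j"
          by (rule sum_plus_delta)
        then show ?thesis
          using row[of "Some j"] that by (simp add: sum_option N_def mult.commute add.assoc)
      qed
    qed
    then show False using v(2) by (simp add: vec_eq_iff split_option_all)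
  qed
  moreover have "l \<noteq> 0"
    using kernel_trivial[OF J x, of 0 "\<lambda>_. 0"] by simp
  ultimately show ?thesis by blast
qed

lemma zeros_lagrange_torus: "zeros (lagrange_system f u) \<subseteq> torus"
proof
  fix z assume "z \<in> zeros (lagrange_system f u)"
  then have "z $ None \<noteq> 0 \<and> (\<forall>i. z $ Some i \<noteq> 0)"
    by (intro critical_point_in_torus) (simp_all add: zeros_lagrange_system)
  then show "z \<in> torus"
    by (simp add: torus_def split_option_all)
qed

text \<open>Zeros lie in the torus, where the kernel conditions with \<open>J = UNIV\<close>
  describe the left kernel of the Jacobian; therefore the transposed matrix is considered.\<close>

lemma regular_zero_lagrange:
  assumes z: "z \<in> zeros (lagrange_system f u)"
  shows "regular_zero (lagrange_system f u) z"
  unfolding regular_zero_def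
proof (intro conjI notI)
  show "z \<in> zeros (lagrange_system f u)" by (rule z)
  let ?x = "\<lambda>i. z $ Some i"
  have x: "poly_eval ?x f = 0" "\<And>i. poly_eval ?x (pderiv_at i f) = z $ None * (u $ i - z $ Some i)"
    using z by (simp_all add: zeros_lagrange_system)
  let ?M = "\<chi> i j. poly_eval (vec_nth z) (pderiv_at j (lagrange_system f u i))"
  assume "det ?M = 0"
  then have "det (transpose ?M) = 0" by (simp add: det_transpose)
  then have "\<not> (\<exists>B. B ** transpose ?M = mat 1)"
    using invertible_left_inverse invertible_det_nz by blast
  then obtain v where v: "transpose ?M *v v = 0" "v \<noteq> 0"
    unfolding matrix_left_invertible_ker by blast
  have col: "(\<Sum>r\<in>UNIV. poly_eval (vec_nth z) (pderiv_at c (lagrange_system f u r)) * v $ r) = 0" for c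
    using v(1) by (simp add: matrix_vector_mult_def vec_eq_iff transpose_def)
  have "z $ None \<noteq> 0 \<and> v $ None = 0 \<and> (\<forall>k. v $ Some k = 0)"
  proof (rule kernel_trivial[OF _ x, of UNIV])
    show "z $ Some j \<noteq> 0 \<longleftrightarrow> j \<in> UNIV" for j
      using zeros_lagrange_torus z by (auto simp: torus_def)
    have "poly_eval (vec_nth z) (pderiv_at None (lagrange_system f u (Some k))) = - (u $ k - z $ Some k)" for k
      by (simp add: poly_eval_pderiv_at_rename_Some poly_eval_pderiv_at_diff poly_eval_pderiv_at_mult poly_eval_diff)
    then have "(\<Sum>k\<in>UNIV. - (u $ k - z $ Some k) * v $ Some k) = 0"
      using col[of None]
      by (simp add: sum_option poly_eval_pderiv_at_rename_Some del: lagrange_system.simps(2))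
    moreover have "(\<Sum>k\<in>UNIV. - (u $ k - z $ Some k) * v $ Some k) = - (\<Sum>k\<in>UNIV. v $ Some k * (u $ k - z $ Some k))"
      unfolding sum_negf[symmetric] by (rule sum.cong) (simp_all add: algebra_simps)
    ultimately show "(\<Sum>k\<in>UNIV. v $ Some k * (u $ k - z $ Some k)) = 0"
      by simp
    fix j
    have "poly_eval (vec_nth z) (pderiv_at (Some j) (lagrange_system f u (Some k))) =
        poly_eval ?x (pderiv_at j (pderiv_at k f)) + (if k = j then z $ None else 0)" for k
      by (simp add: poly_eval_pderiv_at_rename_Some poly_eval_pderiv_at_diff poly_eval_pderiv_at_mult)
    then have "poly_eval ?x (pderiv_at j f) * v $ None +
       (\<Sum>k\<in>UNIV. (poly_eval ?x (pderiv_at j (pderiv_at k f)) + (if k = j then z $ None else 0)) * v $ Some k) = 0"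
      using col[of "Some j"]
      by (simp add: sum_option poly_eval_pderiv_at_rename_Some del: lagrange_system.simps(2))
    moreover have "(\<Sum>k\<in>UNIV. (poly_eval ?x (pderiv_at j (pderiv_at k f)) + (if k = j then z $ None else 0)) * v $ Some k) =
        (\<Sum>k\<in>UNIV. v $ Some k * poly_eval ?x (pderiv_at j (pderiv_at k f))) + z $ None * v $ Some j"
      by (rule sum_plus_delta)
    ultimately show "v $ None * poly_eval ?x (pderiv_at j f) +
        (\<Sum>k\<in>UNIV. v $ Some k * poly_eval ?x (pderiv_at j (pderiv_at k f))) + z $ None * v $ Some j = 0"
      by (simp add: mult.commute add.assoc)
  qed
  then show False using v(2) by (simp add: vec_eq_iff split_option_all)
qed

end

end

text \<open>
  Initial forms are taken with respect to the highest weight. With \<open>M\<close> the highest weight of \<open>f\<close> and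
  \<open>c = M - w\<^sub>\<lambda>\<close>, the part of weight \<open>M - w\<^sub>i\<close> of \<open>\<partial>\<^sub>i f\<close> competes with the parts of weight \<open>w\<^sub>\<lambda>\<close> and
  \<open>w\<^sub>\<lambda> + w\<^sub>i\<close> of \<open>\<lambda>(u\<^sub>i - x\<^sub>i)\<close>. If \<open>c < 0\<close>, the point \<open>u\<close> lies on a face hypersurface of \<open>f\<close>; if \<open>c > 0\<close>,
  Euler's relation shows that a face hypersurface is tangent to a quadric; if \<open>c = 0\<close>, setting the
  coordinates of negative weight to \<open>0\<close> gives a critical point outside of the torus.
\<close>

lemma initial_lagrange_system_no_torus_zero:
  fixes f :: "'n::finite cpoly" and x :: "'n option \<Rightarrow> complex"
  assumes f: "transversal_coeffs (Poly_Mapping.keys f) (Poly_Mapping.lookup f)"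
    and const: "0 \<in> Poly_Mapping.keys f" and u: "general_data f (vec_nth u)"
    and x: "\<And>i. x i \<noteq> 0"
    and initial: "\<And>i v. (\<And>a. a \<in> Poly_Mapping.keys (lagrange_system f u i) \<Longrightarrow> weight w a \<le> v) \<Longrightarrow>
      weight_part w v (lagrange_system f u i) x = 0"
  shows "w i = 0"
proof -
  define p where "p i = w (Some i)" for i
  define y where "y i = x (Some i)" for i
  define l where "l = x None"
  define q where "q = w None"
  define M where "M = Max (weight p ` Poly_Mapping.keys f)"
  define B where "B = {a \<in> Poly_Mapping.keys f. weight p a = M}"
  let ?c = "Poly_Mapping.lookup f"
  define T where "T i = (\<Sum>a\<in>B. of_nat (Poly_Mapping.lookup a i) * (?c a * monom_eval y a))" for i
  have le_M: "weight p a \<le> M" if "a \<in> Poly_Mapping.keys f" for a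
    using that by (simp add: M_def)
  have M0: "0 \<le> M" using le_M[OF const] by simp
  have "M \<in> weight p ` Poly_Mapping.keys f"
    unfolding M_def using const by (intro Max_in) auto
  then have B: "B \<subseteq> Poly_Mapping.keys f" "B \<noteq> {}" "finite B" by (auto simp: B_def)
  have y0: "y i \<noteq> 0" and l0: "l \<noteq> 0" and u0: "u $ i \<noteq> 0" for i
    using x u by (simp_all add: y_def l_def general_data_def)
  have face_u: "(\<Sum>a\<in>B. ?c a * monom_eval (vec_nth u) a) \<noteq> 0"
    using u B unfolding general_data_def by blast
  have "weight_part w M (lagrange_system f u None) x = 0"
  proof (rule initial)
    fix a assume "a \<in> Poly_Mapping.keys (lagrange_system f u None)"
    then obtain b where "b \<in> Poly_Mapping.keys f" "a = rename_exponent Some b"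
      using keys_rename[of Some f] by auto
    then show "weight w a \<le> M" using le_M by (simp add: weight_rename_exponent p_def[abs_def])
  qed
  then have "weight_part p M f y = 0"
    by (simp add: weight_part_rename p_def[abs_def] y_def[abs_def])
  then have face: "(\<Sum>a\<in>B. ?c a * monom_eval y a) = 0"
    by (simp add: weight_part_def B_def)
  have key: "weight_part p v (pderiv_at i f) y =
      (if q = v then u $ i * l else 0) - (if q + p i = v then l * y i else 0)"
    if "\<And>a. a \<in> Poly_Mapping.keys f \<Longrightarrow> Poly_Mapping.lookup a i \<noteq> 0 \<Longrightarrow> weight p a - p i \<le> v" "q \<le> v" "q + p i \<le> v" for i v
  proof -
    have "weight_part w v (lagrange_system f u (Some i)) x = 0"
    proof (rule initial)
      fix b assume "b \<in> Poly_Mapping.keys (lagrange_system f u (Some i))"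
      then show "weight w b \<le> v"
      proof (cases rule: keys_lagrange_system_Some)
        case (1 a)
        then have "weight w b = weight p a - p i"
          using weight_pred[of a i p] by (simp add: weight_rename_exponent p_def[abs_def])
        then show ?thesis using that(1) 1 by simp
      qed (use that in \<open>simp_all add: weight_add weight_single q_def p_def\<close>)
    qed
    then show ?thesis
      unfolding weight_part_lagrange_Some
      by (simp only: p_def[abs_def] y_def[abs_def] q_def l_def) (simp add: algebra_simps)
  qed
  have eq: "(if v = M - p i then T i else 0) =
      y i * ((if q = v then u $ i * l else 0) - (if q + p i = v then l * y i else 0))"
    if v: "M - p i \<le> v" "q \<le> v" "q + p i \<le> v" for i v
  proof -
    have "weight_part p v (pderiv_at i f) y =
        (if q = v then u $ i * l else 0) - (if q + p i = v then l * y i else 0)"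
      using v le_M by (intro key) force+
    moreover have "y i * weight_part p v (pderiv_at i f) y = (if v = M - p i then T i else 0)"
      unfolding weight_part_pderiv_at
    proof (cases "v = M - p i")
      case True
      then show "(\<Sum>a\<in>Poly_Mapping.keys f. if weight p a = v + p i
         then of_nat (Poly_Mapping.lookup a i) * (?c a * monom_eval y a) else 0) = (if v = M - p i then T i else 0)"
        by (simp add: T_def B_def sum.If_cases Int_def)
    next
      case False
      then have "weight p a \<noteq> v + p i" if "a \<in> Poly_Mapping.keys f" for a
        using le_M[OF that] v(1) by auto
      then show "(\<Sum>a\<in>Poly_Mapping.keys f. if weight p a = v + p i
         then of_nat (Poly_Mapping.lookup a i) * (?c a * monom_eval y a) else 0) = (if v = M - p i then T i else 0)"
        using False by simp
    qed
    ultimately show ?thesis by simp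
  qed
  \<comment> \<open>Otherwise only multiplier terms have the highest weight. As
    \<open>p i \<noteq> 0\<close>, their weights differ, so a single nonzero term,
    \<open>u $ i * l\<close> or \<open>l * y i\<close>, would have to vanish.\<close>
  have bound: "max q (q + p i) \<le> M - p i" if "p i \<noteq> 0" for i
  proof (rule ccontr)
    assume "\<not> max q (q + p i) \<le> M - p i"
    then show False
      using eq[of i "max q (q + p i)"] that y0[of i] l0 u0[of i] by (auto simp: max_def split: if_splits)
  qed
  \<comment> \<open>Here the two multiplier terms share the highest weight \<open>q\<close> and must
    cancel each other.\<close>
  have data: "y i = u $ i" if "p i = 0" "M < q" for i
    using eq[of i q] that y0[of i] l0 by (auto simp: algebra_simps)
  have Euler: "(\<Sum>i\<in>UNIV. of_real (p i) * T i) = 0"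
  proof -
    have "(\<Sum>i\<in>UNIV. of_real (p i) * T i) = (\<Sum>a\<in>B. of_real (weight p a) * (?c a * monom_eval y a))"
      unfolding T_def weight_def of_real_sum sum_distrib_left sum_distrib_right
      by (subst sum.swap) (simp add: mult_ac)
    also have "\<dots> = of_real M * (\<Sum>a\<in>B. ?c a * monom_eval y a)"
      unfolding sum_distrib_left by (rule sum.cong) (simp_all add: B_def)
    finally show ?thesis using face by simp
  qed
  have nonpos: "M = 0" if p: "\<And>i. p i \<le> 0"
  proof -
    obtain b where "b \<in> B" using B(2) by blast
    then have "M = weight p b" by (simp add: B_def)
    also have "\<dots> \<le> 0"
      unfolding weight_def using p by (intro sum_nonpos) (simp add: mult_nonpos_nonneg)
    finally show ?thesis using M0 by simp
  qed
  consider "M < q" | "M > q" | "M = q" by linarith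
  then show ?thesis
  proof cases
    case 1
    have p: "p i \<le> 0" for i using bound[of i] 1 by (cases "p i = 0") auto
    have "weight_part p 0 f y = poly_eval (\<lambda>i. if p i = 0 then y i else 0) f"
      by (rule weight_part_nonpos[OF p]) simp
    moreover have "weight_part p 0 f (vec_nth u) = poly_eval (\<lambda>i. if p i = 0 then u $ i else 0) f"
      by (rule weight_part_nonpos[OF p]) simp
    moreover have "(\<lambda>i. if p i = 0 then y i else 0) = (\<lambda>i. if p i = 0 then u $ i else 0)"
      using data 1 by auto
    ultimately have "(\<Sum>a\<in>B. ?c a * monom_eval y a) = (\<Sum>a\<in>B. ?c a * monom_eval (vec_nth u) a)"
      by (simp add: weight_part_def B_def nonpos[OF p])
    then show ?thesis using face face_u by simp
  next
    case 2
    \<comment> \<open>By \<open>bound\<close> the weight of \<open>u $ i * l\<close> is below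
      \<open>M - p i\<close>, while \<open>l * y i\<close> reaches this level exactly if
      \<open>q + p i = M - p i\<close>. All \<open>i \<in> I\<close> have the same weight, so
      Euler's relation becomes the equation of the quadric.\<close>
    define I where "I = {i. 2 * p i = M - q}"
    have T: "T i = (if i \<in> I then - l * y i ^ 2 else 0)" for i
    proof -
      have "p i \<noteq> 0 \<Longrightarrow> max q (q + p i) \<le> M - p i" by (rule bound)
      then have v: "q < M - p i" "q + p i \<le> M - p i" "q + p i = M - p i \<longleftrightarrow> i \<in> I"
        using 2 by (cases "p i" "0 :: real" rule: linorder_cases; auto simp: I_def)+
      then show ?thesis
        using eq[of i "M - p i"] by (auto simp: power2_eq_square algebra_simps)
    qed
    have "(\<Sum>i\<in>UNIV. of_real (p i) * T i) = (\<Sum>i\<in>I. of_real ((M - q) / 2) * (- l * y i ^ 2))"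
    proof -
      have "(\<Sum>i\<in>UNIV. of_real (p i) * T i) = (\<Sum>i\<in>I. of_real (p i) * T i)"
        by (rule sum.mono_neutral_right) (auto simp: T)
      also have "\<dots> = (\<Sum>i\<in>I. of_real ((M - q) / 2) * (- l * y i ^ 2))"
      proof (rule sum.cong[OF refl])
        fix i assume i: "i \<in> I"
        then have "p i = (M - q) / 2" by (simp add: I_def)
        then show "of_real (p i) * T i = of_real ((M - q) / 2) * (- l * y i ^ 2)"
          using i by (simp only: T if_True)
      qed
      finally show ?thesis .
    qed
    also have "\<dots> = of_real ((M - q) / 2) * (- l) * (\<Sum>i\<in>I. y i ^ 2)"
      by (simp add: sum_distrib_left mult.assoc)
    finally have "of_real ((M - q) / 2) * (- l) * (\<Sum>i\<in>I. y i ^ 2) = (0 :: complex)"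
      using Euler by simp
    moreover have "complex_of_real ((M - q) / 2) \<noteq> 0" using 2 unfolding of_real_eq_0_iff by simp
    ultimately have "(\<Sum>i\<in>I. y i ^ 2) = 0" using l0 by (metis mult_eq_0_iff neg_equal_0_iff_equal)
    then have False
      using transversal_coeffsD[OF f B(1,2) y0 face, of I "- l"] T by (simp add: T_def)
    then show ?thesis ..
  next
    case 3
    have p: "p i \<le> 0" for i using bound[of i] 3 by (cases "p i = 0") auto
    have M: "M = 0" by (rule nonpos[OF p])
    define z where "z i = (if p i = 0 then y i else 0)" for i
    have part: "weight_part p 0 g y = poly_eval z g" for g
      by (rule weight_part_nonpos[OF p]) (simp add: z_def)
    have "poly_eval z f = 0"
      using face part[of f] by (simp add: weight_part_def B_def M)
    moreover have "poly_eval z (pderiv_at i f) = l * (u $ i - z i)" for i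
    proof -
      have "weight p a - p i \<le> 0" if a: "Poly_Mapping.lookup a i \<noteq> 0" for a
      proof -
        have "weight p a - p i = weight p (a - Poly_Mapping.single i 1)"
          using weight_pred[OF a, of p] by simp
        also have "\<dots> \<le> 0"
          unfolding weight_def using p by (intro sum_nonpos) (simp add: mult_nonpos_nonneg)
        finally show ?thesis .
      qed
      then have "weight_part p 0 (pderiv_at i f) y =
          (if q = 0 then u $ i * l else 0) - (if q + p i = 0 then l * y i else 0)"
        using 3 M p[of i] by (intro key) auto
      then have "poly_eval z (pderiv_at i f) = u $ i * l - (if p i = 0 then l * y i else 0)"
        using 3 M part by simp
      then show ?thesis by (cases "p i = 0") (simp_all add: z_def algebra_simps)
    qed
    ultimately have "z i \<noteq> 0" for i
      using critical_point_in_torus[OF f const u, of z l] by blast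
    then have "p i = 0" for i by (metis z_def)
    then show ?thesis using 3 M by (cases i) (simp_all add: p_def q_def)
  qed
qed

section \<open>Limits of zeros in the torus\<close>

text \<open>The extended reals are sequentially compact, so that unbounded directions converge too,
  to an infinite limit. Finitely many directions are treated by successive subsequences.\<close>

lemma subsequence_convergent_ereal:
  fixes g :: "'d \<Rightarrow> nat \<Rightarrow> ereal"
  assumes "finite \<Delta>"
  shows "\<exists>r. strict_mono (r :: nat \<Rightarrow> nat) \<and> (\<forall>d\<in>\<Delta>. \<exists>l. (\<lambda>k. g d (r k)) \<longlonglongrightarrow> l)"
  using assms
proof (induction \<Delta>)
  case empty
  then show ?case using strict_mono_id by auto
next
  case (insert d \<Delta>)
  then obtain r where r: "strict_mono r" "\<forall>d\<in>\<Delta>. \<exists>l. (\<lambda>k. g d (r k)) \<longlonglongrightarrow> l" by blast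
  obtain l s where s: "strict_mono s" "((\<lambda>k. g d (r k)) \<circ> s) \<longlonglongrightarrow> l"
    using compact_complete_linorder by blast
  have "\<exists>l. (\<lambda>k. g e ((r \<circ> s) k)) \<longlonglongrightarrow> l" if "e \<in> insert d \<Delta>" for e
  proof (cases "e = d")
    case True
    then show ?thesis using s(2) by (auto simp: comp_def)
  next
    case False
    then have "e \<in> \<Delta>" using that by simp
    from bspec[OF r(2) this] obtain l' where "(\<lambda>k. g e (r k)) \<longlonglongrightarrow> l'" ..
    from LIMSEQ_subseq_LIMSEQ[OF this s(1)] show ?thesis by (auto simp: comp_def)
  qed
  then have "\<forall>e\<in>insert d \<Delta>. \<exists>l. (\<lambda>k. g e ((r \<circ> s) k)) \<longlonglongrightarrow> l" ..
  with strict_mono_o[OF r(1) s(1)] show ?case by (intro exI[of _ "r \<circ> s"] conjI)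
qed

text \<open>
  The vector \<open>w\<close> is a term \<open>y\<^sub>k\<close> of the sequence, far out, minus its projection to the span of those
  directions in \<open>\<Delta>\<close> along which the sequence stays bounded.
\<close>

lemma sequence_directions:
  fixes y :: "nat \<Rightarrow> real ^ 'v::finite"
  assumes \<Delta>: "finite \<Delta>"
  obtains r :: "nat \<Rightarrow> nat" and w z z' where "strict_mono r" "z \<longlonglongrightarrow> z'"
    "\<And>d k. d \<in> \<Delta> \<Longrightarrow> w \<bullet> d = 0 \<Longrightarrow> d \<bullet> y (r k) = d \<bullet> z k"
    "\<And>d. d \<in> \<Delta> \<Longrightarrow> w \<bullet> d < 0 \<Longrightarrow> filterlim (\<lambda>k. d \<bullet> y (r k)) at_bot sequentially"
proof -
  obtain r where r: "strict_mono r" "\<forall>d\<in>\<Delta>. \<exists>l. (\<lambda>k. ereal (d \<bullet> y (r k))) \<longlonglongrightarrow> l"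
    using subsequence_convergent_ereal[OF \<Delta>, of "\<lambda>d k. ereal (d \<bullet> y k)"] by blast
  from bchoice[OF r(2)] obtain L where L: "\<And>d. d \<in> \<Delta> \<Longrightarrow> (\<lambda>k. ereal (d \<bullet> y (r k))) \<longlonglongrightarrow> L d" by blast
  define \<Delta>0 where "\<Delta>0 = {d \<in> \<Delta>. \<bar>L d\<bar> \<noteq> \<infinity>}"
  have "\<exists>u. u \<in> span \<Delta>0 \<and> (\<forall>w\<in>span \<Delta>0. orthogonal (x - u) w)" for x
  proof -
    obtain u v where "u \<in> span \<Delta>0" "\<And>w. w \<in> span \<Delta>0 \<Longrightarrow> orthogonal v w" "x = u + v"
      using orthogonal_subspace_decomp_exists[of \<Delta>0 x] by blast
    then show ?thesis by (intro exI[of _ u]) simp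
  qed
  then have "\<forall>x. \<exists>u. u \<in> span \<Delta>0 \<and> (\<forall>w\<in>span \<Delta>0. orthogonal (x - u) w)" by blast
  from choice[OF this] obtain pr
    where pr_pe: "\<forall>x. pr x \<in> span \<Delta>0 \<and> (\<forall>w\<in>span \<Delta>0. orthogonal (x - pr x) w)" ..
  define pe where "pe x = x - pr x" for x
  have pr: "pr x \<in> span \<Delta>0" and pe: "w \<in> span \<Delta>0 \<Longrightarrow> orthogonal (pe x) w" for x w
    using pr_pe by (auto simp: pe_def)
  define z where "z k = pr (y (r k))" for k
  have z_eq: "d \<bullet> y (r k) = d \<bullet> z k" if "d \<in> span \<Delta>0" for d k
    using pe[OF that, of "y (r k)"]
    by (simp add: z_def pe_def orthogonal_def inner_diff_right inner_commute)
  \<comment> \<open>Convergence along \<open>\<Delta>0\<close> passes to its span, and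
    \<open>z\<close> has no component orthogonal to that span; hence \<open>z\<close> converges in
    every direction.\<close>
  have conv: "convergent (\<lambda>k. a \<bullet> z k)" for a
  proof -
    let ?W = "{a. convergent (\<lambda>k. a \<bullet> z k)}"
    have "subspace ?W"
      unfolding subspace_def by (auto simp: inner_add_left intro: convergent_add convergent_mult convergent_const)
    moreover have "\<Delta>0 \<subseteq> ?W"
    proof
      fix d assume d: "d \<in> \<Delta>0"
      then obtain l where "L d = ereal l" "d \<in> \<Delta>" by (auto simp: \<Delta>0_def)
      then have "(\<lambda>k. d \<bullet> y (r k)) \<longlonglongrightarrow> l" using L[of d] by simp
      then show "d \<in> ?W" using z_eq[OF span_base[OF d]] by (auto simp: convergent_def)
    qed
    ultimately have "pr a \<in> ?W" using span_minimal pr by blast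
    moreover have "a \<bullet> z k = pr a \<bullet> z k" for k
      using pe[OF pr, of a "y (r k)"]
      by (simp add: z_def pe_def orthogonal_def inner_diff_left)
    ultimately show ?thesis by simp
  qed
  define z' where "z' = (\<chi> i. lim (\<lambda>k. z k $ i))"
  have z': "z \<longlonglongrightarrow> z'"
  proof (rule vec_tendstoI)
    fix i
    have "convergent (\<lambda>k. z k $ i)" using conv[of "axis i 1"] by (simp add: inner_axis')
    then show "(\<lambda>k. z k $ i) \<longlonglongrightarrow> z' $ i" by (simp add: z'_def convergent_LIMSEQ_iff)
  qed
  \<comment> \<open>As \<open>d \<bullet> z k\<close> converges, removing the projection does not
    affect divergence along \<open>d\<close>. So the signs are right from some index on, and since
    \<open>\<Delta>\<close> is finite one index serves all \<open>d\<close>.\<close>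
  have "eventually (\<lambda>k. (L d = \<infinity> \<longrightarrow> pe (y (r k)) \<bullet> d > 0) \<and> (L d = - \<infinity> \<longrightarrow> pe (y (r k)) \<bullet> d < 0)) sequentially"
    if d: "d \<in> \<Delta>" for d
  proof -
    have lz: "(\<lambda>k. d \<bullet> z k) \<longlonglongrightarrow> d \<bullet> z'" by (intro tendsto_intros z')
    have eq: "pe (y (r k)) \<bullet> d = d \<bullet> y (r k) - d \<bullet> z k" for k
      by (simp add: z_def pe_def inner_diff_left inner_diff_right inner_commute)
    have ez: "eventually (\<lambda>k. dist (d \<bullet> z k) (d \<bullet> z') < 1) sequentially"
      using tendstoD[OF lz, of 1] by simp
    consider "L d = \<infinity>" | "L d = - \<infinity>" | "\<bar>L d\<bar> \<noteq> \<infinity>" by auto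
    then show ?thesis
    proof cases
      case 1
      then have "eventually (\<lambda>k. ereal (d \<bullet> y (r k)) > ereal (d \<bullet> z' + 1)) sequentially"
        using L[OF d] tendsto_PInfty by metis
      then show ?thesis using ez by eventually_elim (use 1 in \<open>auto simp: eq dist_real_def\<close>)
    next
      case 2
      then have "eventually (\<lambda>k. ereal (d \<bullet> y (r k)) < ereal (d \<bullet> z' - 1)) sequentially"
        using L[OF d] tendsto_MInfty by metis
      then show ?thesis using ez by eventually_elim (use 2 in \<open>auto simp: eq dist_real_def\<close>)
    qed auto
  qed
  then have "eventually (\<lambda>k. \<forall>d\<in>\<Delta>. (L d = \<infinity> \<longrightarrow> pe (y (r k)) \<bullet> d > 0) \<and> (L d = - \<infinity> \<longrightarrow> pe (y (r k)) \<bullet> d < 0)) sequentially"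
    using \<Delta> by (intro eventually_ball_finite) auto
  then obtain k where k: "\<forall>d\<in>\<Delta>. (L d = \<infinity> \<longrightarrow> pe (y (r k)) \<bullet> d > 0) \<and> (L d = - \<infinity> \<longrightarrow> pe (y (r k)) \<bullet> d < 0)"
    using eventually_happens' sequentially_bot by blast
  define w where "w = pe (y (r k))"
  have w: "L d = \<infinity> \<Longrightarrow> w \<bullet> d > 0" "L d = - \<infinity> \<Longrightarrow> w \<bullet> d < 0" "\<bar>L d\<bar> \<noteq> \<infinity> \<Longrightarrow> w \<bullet> d = 0" if "d \<in> \<Delta>" for d
    using k that pe[OF span_base, of d "y (r k)"] by (auto simp: w_def \<Delta>0_def orthogonal_def)
  show ?thesis
  proof (rule that[OF r(1) z'])
    fix d k assume d: "d \<in> \<Delta>" "w \<bullet> d = 0"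
    then have "\<bar>L d\<bar> \<noteq> \<infinity>" using w(1,2)[OF d(1)] by (cases "L d") auto
    then show "d \<bullet> y (r k) = d \<bullet> z k" using d(1) by (intro z_eq span_base) (simp add: \<Delta>0_def)
  next
    fix d assume d: "d \<in> \<Delta>" "w \<bullet> d < 0"
    then have "L d = - \<infinity>" using w[OF d(1)] by (cases "L d") auto
    then show "filterlim (\<lambda>k. d \<bullet> y (r k)) at_bot sequentially"
      using L[OF d(1)] by (simp add: tendsto_MInfty filterlim_at_bot_dense)
  qed
qed

section \<open>Exponents and Newton polytopes\<close>

definition exponent_vec :: "'v::finite exponent \<Rightarrow> real ^ 'v" where
  "exponent_vec a = (\<chi> i. real (Poly_Mapping.lookup a i))"

lemma newton_polytope_alt: "newton_polytope p = convex hull (exponent_vec ` Poly_Mapping.keys p)"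
  by (simp add: newton_polytope_def exponent_vec_def)

lemma weight_eq_inner: "weight (vec_nth w) a = w \<bullet> exponent_vec a"
  by (simp add: weight_def exponent_vec_def inner_vec_def)

text \<open>The bound describes a half-space, which contains the convex hull of the exponents of
  \<open>q\<close> as soon as it contains these. Thus weight bounds for the target system hold along
  the whole homotopy.\<close>

lemma weight_le_newton_polytope:
  assumes "newton_polytope p \<subseteq> newton_polytope q" "a \<in> Poly_Mapping.keys p"
    and "\<And>b. b \<in> Poly_Mapping.keys q \<Longrightarrow> weight w b \<le> v"
  shows "weight w a \<le> v"
proof -
  have w: "weight w b = (\<chi> i. w i) \<bullet> exponent_vec b" for b
    unfolding weight_eq_inner[symmetric] by (simp add: vec_lambda_inverse)
  have "exponent_vec a \<in> newton_polytope q"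
    using assms(1,2) hull_inc[of "exponent_vec a"] unfolding newton_polytope_alt by blast
  moreover have "newton_polytope q \<subseteq> {x. (\<chi> i. w i) \<bullet> x \<le> v}"
    unfolding newton_polytope_alt
    using assms(3) by (intro hull_minimal convex_halfspace_le) (auto simp: w)
  ultimately show ?thesis by (auto simp: w)
qed

lemma finite_bounded_exponents: "finite {a :: 'v::finite exponent. \<forall>j. Poly_Mapping.lookup a j \<le> N}"
proof (rule finite_imageD[where f = Poly_Mapping.lookup])
  have "Poly_Mapping.lookup ` {a :: 'v exponent. \<forall>j. Poly_Mapping.lookup a j \<le> N} \<subseteq> (\<Pi>\<^sub>E j\<in>UNIV. {..N})"
    by auto
  then show "finite (Poly_Mapping.lookup ` {a :: 'v exponent. \<forall>j. Poly_Mapping.lookup a j \<le> N})"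
    by (rule finite_subset) (simp add: finite_PiE)
  show "inj_on Poly_Mapping.lookup {a :: 'v exponent. \<forall>j. Poly_Mapping.lookup a j \<le> N}"
    by (rule inj_onI, rule poly_mapping_eqI) simp
qed

text \<open>Weights that pick out one coordinate bound the entries of all exponents occurring in
  \<open>p\<close>. With one finite support the equations at all times are sums over the same index
  set, and limits can be taken term by term.\<close>

lemma common_support:
  fixes F :: "'v::finite system"
  obtains S where "finite S" "\<And>i p. newton_polytope p \<subseteq> newton_polytope (F i) \<Longrightarrow> Poly_Mapping.keys p \<subseteq> S"
proof -
  define R where "R = (\<Union>i. \<Union>a\<in>Poly_Mapping.keys (F i). range (Poly_Mapping.lookup a))"
  have "finite R" by (simp add: R_def)
  then have R: "n \<le> Max R" if "n \<in> R" for n using that by simp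
  define N where "N = Max R"
  have N: "Poly_Mapping.lookup a j \<le> N" if "a \<in> Poly_Mapping.keys (F i)" for i a j
    unfolding N_def by (rule R) (use that in \<open>auto simp: R_def\<close>)
  have "Poly_Mapping.keys p \<subseteq> {a. \<forall>j. Poly_Mapping.lookup a j \<le> N}" if p: "newton_polytope p \<subseteq> newton_polytope (F i)" for i p
  proof (intro subsetI CollectI allI)
    fix a j assume a: "a \<in> Poly_Mapping.keys p"
    have w: "weight (\<lambda>i. if i = j then 1 else 0) b = real (Poly_Mapping.lookup b j)" for b :: "'v exponent"
      by (simp add: weight_def if_distrib[of "\<lambda>z. z * _"] cong: if_cong)
    have "weight (\<lambda>i. if i = j then 1 else 0) a \<le> real N"
    proof (rule weight_le_newton_polytope[OF p a])
      fix b assume "b \<in> Poly_Mapping.keys (F i)"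
      then show "weight (\<lambda>i. if i = j then 1 else 0) b \<le> real N" unfolding w of_nat_le_iff by (rule N)
    qed
    then show "Poly_Mapping.lookup a j \<le> N" unfolding w of_nat_le_iff .
  qed
  then show ?thesis by (rule that[OF finite_bounded_exponents])
qed

lemma monom_eval_exp:
  fixes x :: "'v::finite \<Rightarrow> complex"
  assumes "\<And>i. x i = of_real (exp (y $ i)) * s i"
  shows "monom_eval x a = of_real (exp (exponent_vec a \<bullet> y)) * monom_eval s a"
proof -
  have "monom_eval x a = (\<Prod>i\<in>UNIV. of_real (exp (real (Poly_Mapping.lookup a i) * y $ i)) * s i ^ Poly_Mapping.lookup a i)"
    by (simp add: monom_eval_superset[of UNIV] assms power_mult_distrib exp_of_nat_mult)
  also have "\<dots> = of_real (\<Prod>i\<in>UNIV. exp (real (Poly_Mapping.lookup a i) * y $ i)) * monom_eval s a"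
    by (simp add: prod.distrib monom_eval_superset[of UNIV])
  also have "(\<Prod>i\<in>UNIV. exp (real (Poly_Mapping.lookup a i) * y $ i)) = exp (exponent_vec a \<bullet> y)"
    by (simp add: exp_sum exponent_vec_def inner_vec_def)
  finally show ?thesis .
qed

lemma tendsto_monom_eval:
  fixes f :: "'b \<Rightarrow> 'v \<Rightarrow> complex"
  assumes "\<And>i. ((\<lambda>k. f k i) \<longlongrightarrow> l i) F"
  shows "((\<lambda>k. monom_eval (f k) a) \<longlongrightarrow> monom_eval l a) F"
  unfolding monom_eval_def by (intro tendsto_intros assms)

section \<open>Homotopies within the Newton polytopes of the target\<close>

locale convex_homotopy =
  fixes F :: "'v::finite system" and H :: "real \<Rightarrow> 'v system"
  assumes H_0: "H 0 = F"
    and H_cont: "\<And>i a. continuous_on {0..1} (\<lambda>t. Poly_Mapping.lookup (H t i) a)"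
    and H_newton: "\<And>t i. t \<in> {0..1} \<Longrightarrow> newton_polytope (H t i) \<subseteq> newton_polytope (F i)"
begin

definition support :: "'v exponent set" where
  "support = (SOME S. finite S \<and> (\<forall>t\<in>{0..1}. \<forall>i. Poly_Mapping.keys (H t i) \<subseteq> S))"

lemma finite_support: "finite support"
  and keys_support: "t \<in> {0..1} \<Longrightarrow> Poly_Mapping.keys (H t i) \<subseteq> support"
proof -
  obtain S where "finite S" "\<And>i p. newton_polytope p \<subseteq> newton_polytope (F i) \<Longrightarrow> Poly_Mapping.keys p \<subseteq> S"
    by (rule common_support[of F]) blast
  then have "\<exists>S. finite S \<and> (\<forall>t\<in>{0..1}. \<forall>i. Poly_Mapping.keys (H t i) \<subseteq> S)"
    using H_newton by blast
  from someI_ex[OF this, folded support_def]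
  show "finite support" "t \<in> {0..1} \<Longrightarrow> Poly_Mapping.keys (H t i) \<subseteq> support"
    by blast+
qed

lemma poly_eval_H:
  "t \<in> {0..1} \<Longrightarrow> poly_eval x (H t i) = (\<Sum>a\<in>support. Poly_Mapping.lookup (H t i) a * monom_eval x a)"
  by (rule poly_eval_superset[OF finite_support keys_support])

text \<open>
  Write \<open>x\<^sub>k = exp(y\<^sub>k) \<sigma>\<^sub>k\<close> with \<open>y\<^sub>k\<close> real and \<open>\<bar>\<sigma>\<^sub>k\<bar> = 1\<close>. Divided by the modulus of a monomial of
  highest weight in the sense of \<open>sequence_directions\<close>, the equations converge to their initial
  forms at the limit of \<open>exp(z\<^sub>k) \<sigma>\<^sub>k\<close>.
\<close>

lemma zeros_subsequence:
  fixes x :: "nat \<Rightarrow> complex ^ 'v"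
  assumes initial: "\<And>w \<xi> i. (\<And>i. \<xi> i \<noteq> 0) \<Longrightarrow>
      (\<And>i v. (\<And>a. a \<in> Poly_Mapping.keys (F i) \<Longrightarrow> weight w a \<le> v) \<Longrightarrow> weight_part w v (F i) \<xi> = 0) \<Longrightarrow> w i = 0"
    and T: "T \<longlonglongrightarrow> 0" "\<And>k. T k \<in> {0..1}"
    and x: "\<And>k. x k \<in> torus" "\<And>k. x k \<in> zeros (H (T k))"
  obtains r z where "strict_mono r" "z \<in> zeros F" "(x \<circ> r) \<longlonglongrightarrow> z"
proof -
  define y where "y k = (\<chi> i. ln (norm (x k $ i)))" for k
  define \<sigma> where "\<sigma> k = (\<chi> i. sgn (x k $ i))" for k
  have x0: "x k $ i \<noteq> 0" for k i using x(1)[of k] by (simp add: torus_def)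
  have x_eq: "x k $ i = of_real (exp (y k $ i)) * \<sigma> k $ i" for k i
    using x0[of k i] by (simp add: y_def \<sigma>_def sgn_eq)
  have "bounded (range \<sigma>)"
  proof (rule boundedI)
    fix v assume "v \<in> range \<sigma>"
    then obtain k where v: "v = \<sigma> k" by blast
    have "norm v \<le> (\<Sum>i\<in>UNIV. norm (v $ i))"
      unfolding norm_vec_def by (rule L2_set_le_sum) simp
    also have "\<dots> \<le> (\<Sum>i\<in>(UNIV :: 'v set). 1)"
      by (rule sum_mono) (simp add: v \<sigma>_def norm_sgn)
    finally show "norm v \<le> (\<Sum>i\<in>(UNIV :: 'v set). 1)" .
  qed
  then obtain \<sigma>l r1 where r1: "strict_mono r1" "(\<sigma> \<circ> r1) \<longlonglongrightarrow> \<sigma>l"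
    using bounded_imp_convergent_subsequence by blast
  \<comment> \<open>Differences of exponents compare monomials. The axes are included so that, once
    \<open>w = 0\<close> is known, each coordinate of the logarithms agrees with that of the
    convergent sequence \<open>z\<close>.\<close>
  let ?\<Delta> = "(\<lambda>(a, b). exponent_vec a - exponent_vec b) ` (support \<times> support) \<union> range (\<lambda>i. axis i 1)"
  have "finite ?\<Delta>" using finite_support by simp
  then obtain r2 w z zl where r2: "strict_mono r2" and zl: "z \<longlonglongrightarrow> zl"
    and dir0: "\<And>d k. d \<in> ?\<Delta> \<Longrightarrow> w \<bullet> d = 0 \<Longrightarrow> d \<bullet> (y \<circ> r1) (r2 k) = d \<bullet> z k"
    and dir1: "\<And>d. d \<in> ?\<Delta> \<Longrightarrow> w \<bullet> d < 0 \<Longrightarrow> filterlim (\<lambda>k. d \<bullet> (y \<circ> r1) (r2 k)) at_bot sequentially"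
    by (rule sequence_directions[of ?\<Delta> "y \<circ> r1"]) blast
  define r where "r = r1 \<circ> r2"
  have r: "strict_mono r" unfolding r_def by (rule strict_mono_o[OF r1(1) r2])
  have \<sigma>: "(\<lambda>k. \<sigma> (r k) $ i) \<longlonglongrightarrow> \<sigma>l $ i" for i
    using LIMSEQ_subseq_LIMSEQ[OF r1(2) r2] by (intro tendsto_intros) (simp add: comp_def r_def)
  have Tr: "(\<lambda>k. T (r k)) \<longlonglongrightarrow> 0"
    using LIMSEQ_subseq_LIMSEQ[OF T(1) r] by (simp add: comp_def)
  have coeff: "(\<lambda>k. Poly_Mapping.lookup (H (T (r k)) i) a) \<longlonglongrightarrow> Poly_Mapping.lookup (F i) a" for i a
    using continuous_on_tendsto_compose[OF H_cont Tr, of i a] T(2) by (simp add: H_0)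
  define \<xi> where "\<xi> i = of_real (exp (zl $ i)) * \<sigma>l $ i" for i
  have \<xi>0: "\<xi> i \<noteq> 0" for i
  proof -
    have "(\<lambda>k. norm (\<sigma> (r k) $ i)) \<longlonglongrightarrow> norm (\<sigma>l $ i)" by (intro tendsto_norm \<sigma>)
    then have "norm (\<sigma>l $ i) = 1"
      using x0 by (simp add: \<sigma>_def norm_sgn LIMSEQ_const_iff)
    then show ?thesis by (auto simp: \<xi>_def)
  qed
  have init: "weight_part (vec_nth w) v (F i) \<xi> = 0"
    if v: "\<And>a. a \<in> Poly_Mapping.keys (F i) \<Longrightarrow> weight (vec_nth w) a \<le> v" for i v
  proof (cases "\<exists>b\<in>Poly_Mapping.keys (F i). weight (vec_nth w) b = v")
    case False
    then have "{a. a \<in> Poly_Mapping.keys (F i) \<and> weight (vec_nth w) a = v} = {}" by blast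
    then show ?thesis unfolding weight_part_def by (simp only: sum.empty)
  next
    case True
    then obtain b where b: "b \<in> Poly_Mapping.keys (F i)" "weight (vec_nth w) b = v" by blast
    have bS: "b \<in> support" using keys_support[of 0 i] b(1) H_0 by auto
    let ?d = "\<lambda>a. exponent_vec a - exponent_vec b"
    define summand where "summand a k = Poly_Mapping.lookup (H (T (r k)) i) a *
      (of_real (exp (?d a \<bullet> y (r k))) * monom_eval (vec_nth (\<sigma> (r k))) a)" for a k
    have sum0: "(\<Sum>a\<in>support. summand a k) = 0" for k
    proof -
      have "0 = (\<Sum>a\<in>support. Poly_Mapping.lookup (H (T (r k)) i) a * monom_eval (vec_nth (x (r k))) a)"
        using x(2)[of "r k"] poly_eval_H[OF T(2)] by (simp add: zeros_def)
      also have "\<dots> = of_real (exp (exponent_vec b \<bullet> y (r k))) * (\<Sum>a\<in>support. summand a k)"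
        unfolding sum_distrib_left
      proof (rule sum.cong[OF refl])
        fix a
        have "exp (exponent_vec a \<bullet> y (r k)) = exp (exponent_vec b \<bullet> y (r k)) * exp (?d a \<bullet> y (r k))"
          by (simp add: inner_diff_left flip: exp_add)
        then show "Poly_Mapping.lookup (H (T (r k)) i) a * monom_eval (vec_nth (x (r k))) a =
            of_real (exp (exponent_vec b \<bullet> y (r k))) * summand a k"
          unfolding summand_def monom_eval_exp[OF x_eq] by simp
      qed
      finally show ?thesis by simp
    qed
    have lim: "summand a \<longlonglongrightarrow> (if weight (vec_nth w) a = v then Poly_Mapping.lookup (F i) a *
        (of_real (exp (?d a \<bullet> zl)) * monom_eval (vec_nth \<sigma>l) a) else 0)" if a: "a \<in> support" for a
    proof -
      have wd: "w \<bullet> ?d a = weight (vec_nth w) a - v"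
        using b(2) by (simp add: inner_diff_right weight_eq_inner)
      have d: "?d a \<in> ?\<Delta>" using a bS by (intro UnI1 image_eqI[of _ _ "(a, b)"]) simp_all
      have m: "(\<lambda>k. monom_eval (vec_nth (\<sigma> (r k))) a) \<longlonglongrightarrow> monom_eval (vec_nth \<sigma>l) a"
        by (rule tendsto_monom_eval) (rule \<sigma>)
      consider "weight (vec_nth w) a > v" | "weight (vec_nth w) a = v" | "weight (vec_nth w) a < v"
        by linarith
      then show ?thesis
      proof cases
        case 1
        \<comment> \<open>Such terms could grow without bound after the rescaling; the inclusion of
          Newton polytopes excludes them at every time.\<close>
        have "Poly_Mapping.lookup (H (T (r k)) i) a = 0" for k
        proof (rule ccontr)
          assume "Poly_Mapping.lookup (H (T (r k)) i) a \<noteq> 0"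
          then have "weight (vec_nth w) a \<le> v"
            by (intro weight_le_newton_polytope[OF H_newton[OF T(2)] _ v]) (simp add: in_keys_iff)
          then show False using 1 by simp
        qed
        then have "summand a = (\<lambda>k. 0)" by (auto simp: summand_def)
        then show ?thesis using 1 by simp
      next
        case 2
        then have "?d a \<bullet> y (r k) = ?d a \<bullet> z k" for k
          using dir0[OF d, of k] wd by (simp add: r_def)
        then have "summand a = (\<lambda>k. Poly_Mapping.lookup (H (T (r k)) i) a *
            (of_real (exp (?d a \<bullet> z k)) * monom_eval (vec_nth (\<sigma> (r k))) a))"
          by (simp add: summand_def[abs_def])
        also have "\<dots> \<longlonglongrightarrow> Poly_Mapping.lookup (F i) a * (of_real (exp (?d a \<bullet> zl)) * monom_eval (vec_nth \<sigma>l) a)"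
          by (intro tendsto_intros coeff m zl)
        finally show ?thesis using 2 by simp
      next
        case 3
        then have "filterlim (\<lambda>k. ?d a \<bullet> y (r k)) at_bot sequentially"
          using dir1[OF d] wd by (simp add: r_def)
        then have "(\<lambda>k. exp (?d a \<bullet> y (r k))) \<longlonglongrightarrow> 0"
          using filterlim_compose[OF exp_at_bot] by blast
        then have "(\<lambda>k. complex_of_real (exp (?d a \<bullet> y (r k)))) \<longlonglongrightarrow> complex_of_real 0"
          by (rule tendsto_of_real)
        then have "summand a \<longlonglongrightarrow> Poly_Mapping.lookup (F i) a * (complex_of_real 0 * monom_eval (vec_nth \<sigma>l) a)"
          unfolding summand_def[abs_def] by (intro tendsto_mult coeff m)
        then show ?thesis using 3 by simp
      qed
    qed
    have "(\<lambda>k. \<Sum>a\<in>support. summand a k) \<longlonglongrightarrow> (\<Sum>a\<in>support. if weight (vec_nth w) a = v then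
        Poly_Mapping.lookup (F i) a * (of_real (exp (?d a \<bullet> zl)) * monom_eval (vec_nth \<sigma>l) a) else 0)"
      by (rule tendsto_sum) (rule lim)
    then have "(\<Sum>a\<in>support. if weight (vec_nth w) a = v then
        Poly_Mapping.lookup (F i) a * (of_real (exp (?d a \<bullet> zl)) * monom_eval (vec_nth \<sigma>l) a) else 0) = 0"
      by (simp add: sum0 LIMSEQ_const_iff)
    moreover have "weight_part (vec_nth w) v (F i) \<xi> = of_real (exp (exponent_vec b \<bullet> zl)) *
      (\<Sum>a\<in>support. if weight (vec_nth w) a = v then
        Poly_Mapping.lookup (F i) a * (of_real (exp (?d a \<bullet> zl)) * monom_eval (vec_nth \<sigma>l) a) else 0)"
      unfolding sum_distrib_left
    proof (subst weight_part_superset[OF finite_support])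
      show "Poly_Mapping.keys (F i) \<subseteq> support" using keys_support[of 0 i] H_0 by simp
      show "(\<Sum>a\<in>support. if weight (vec_nth w) a = v then Poly_Mapping.lookup (F i) a * monom_eval \<xi> a else 0) =
        (\<Sum>a\<in>support. of_real (exp (exponent_vec b \<bullet> zl)) * (if weight (vec_nth w) a = v then
          Poly_Mapping.lookup (F i) a * (of_real (exp (?d a \<bullet> zl)) * monom_eval (vec_nth \<sigma>l) a) else 0))"
      proof (rule sum.cong[OF refl])
        fix a
        have "exp (exponent_vec a \<bullet> zl) = exp (exponent_vec b \<bullet> zl) * exp (?d a \<bullet> zl)"
          by (simp add: inner_diff_left flip: exp_add)
        then have "monom_eval \<xi> a = of_real (exp (exponent_vec b \<bullet> zl)) * (of_real (exp (?d a \<bullet> zl)) * monom_eval (vec_nth \<sigma>l) a)"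
          by (simp only: monom_eval_exp[OF \<xi>_def] of_real_mult mult.assoc)
        then show "(if weight (vec_nth w) a = v then Poly_Mapping.lookup (F i) a * monom_eval \<xi> a else 0) =
          of_real (exp (exponent_vec b \<bullet> zl)) * (if weight (vec_nth w) a = v then
            Poly_Mapping.lookup (F i) a * (of_real (exp (?d a \<bullet> zl)) * monom_eval (vec_nth \<sigma>l) a) else 0)"
          by (simp only: if_distrib[of "\<lambda>z. _ * z"] mult_zero_right mult.left_commute)
      qed
    qed
    ultimately show ?thesis by simp
  qed
  have w0: "w $ i = 0" for i
    using initial[OF \<xi>0 init] .
  then have w: "w = 0" by (simp add: vec_eq_iff)
  have "(x \<circ> r) \<longlonglongrightarrow> (\<chi> i. \<xi> i)"
  proof (rule vec_tendstoI)
    fix i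
    have "y (r k) $ i = z k $ i" for k
      using dir0[of "axis i 1" k] w by (simp add: inner_axis' r_def)
    then have "(x \<circ> r) k $ i = of_real (exp (z k $ i)) * \<sigma> (r k) $ i" for k
      using x_eq[of "r k" i] by simp
    moreover have "(\<lambda>k. of_real (exp (z k $ i)) * \<sigma> (r k) $ i) \<longlonglongrightarrow> \<xi> i"
      unfolding \<xi>_def by (intro tendsto_intros zl \<sigma>)
    ultimately show "(\<lambda>k. (x \<circ> r) k $ i) \<longlonglongrightarrow> (\<chi> i. \<xi> i) $ i" by simp
  qed
  moreover have "poly_eval \<xi> (F i) = 0" for i
  proof -
    \<comment> \<open>For \<open>w = 0\<close> the initial forms are the whole equations, which
      makes the limit a zero of \<open>F\<close>.\<close>
    have "weight (vec_nth w) a = 0" for a by (simp add: weight_def w)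
    then have "weight_part (vec_nth w) 0 (F i) \<xi> = 0" by (intro init) simp
    moreover have "weight_part (vec_nth w) 0 (F i) \<xi> = poly_eval \<xi> (F i)"
      by (rule weight_part_nonpos) (simp_all add: w)
    ultimately show ?thesis by simp
  qed
  then have "(\<chi> i. \<xi> i) \<in> zeros F" by (simp add: zeros_def vec_lambda_inverse)
  ultimately show ?thesis by (rule that[OF r, rotated])
qed

end

section \<open>Continuation of regular zeros\<close>

lemma norm_vec_le_sum:
  fixes v :: "complex ^ 'v::finite"
  shows "norm v \<le> (\<Sum>i\<in>UNIV. norm (v $ i))"
  unfolding norm_vec_def by (rule L2_set_le_sum) simp

lemma continuous_on_monom_eval:
  assumes "\<And>i. continuous_on S (\<lambda>s. f s i :: complex)"
  shows "continuous_on S (\<lambda>s. monom_eval (f s) a)"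
  unfolding monom_eval_def by (intro continuous_intros assms)

context convex_homotopy
begin

lemma poly_eval_pderiv_at_H:
  assumes "t \<in> {0..1}"
  shows "poly_eval x (pderiv_at j (H t i)) = (\<Sum>a\<in>support. Poly_Mapping.lookup (H t i) a *
     (of_nat (Poly_Mapping.lookup a j) * monom_eval x (a - Poly_Mapping.single j 1)))"
  unfolding poly_eval_pderiv_at
  by (rule sum.mono_neutral_left) (use finite_support keys_support[OF assms, of i] in \<open>auto simp: in_keys_iff\<close>)

lemma continuous_on_coeff: "continuous_on ({0..1} \<times> UNIV) (\<lambda>p. Poly_Mapping.lookup (H (fst p) i) a)"
  by (rule continuous_on_compose2[OF H_cont]) (auto intro: continuous_intros)

lemma continuous_on_poly_eval_H:
  "continuous_on ({0..1} \<times> UNIV) (\<lambda>p. poly_eval (vec_nth (snd p)) (H (fst p) i))"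
proof -
  have "continuous_on ({0..1} \<times> UNIV) (\<lambda>p. \<Sum>a\<in>support. Poly_Mapping.lookup (H (fst p) i) a * monom_eval (vec_nth (snd p)) a)"
    by (intro continuous_on_sum continuous_on_mult continuous_on_coeff continuous_on_monom_eval continuous_intros)
  then show ?thesis
    by (rule continuous_on_eq) (auto simp: poly_eval_H)
qed

lemma continuous_on_pderiv_H:
  "continuous_on ({0..1} \<times> UNIV) (\<lambda>p. poly_eval (vec_nth (snd p)) (pderiv_at j (H (fst p) i)))"
proof -
  have "continuous_on ({0..1} \<times> UNIV) (\<lambda>p. \<Sum>a\<in>support. Poly_Mapping.lookup (H (fst p) i) a *
     (of_nat (Poly_Mapping.lookup a j) * monom_eval (vec_nth (snd p)) (a - Poly_Mapping.single j 1)))"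
    by (intro continuous_on_sum continuous_on_mult continuous_on_coeff continuous_on_monom_eval continuous_intros)
  then show ?thesis
    by (rule continuous_on_eq) (auto simp: poly_eval_pderiv_at_H)
qed

text \<open>
  With \<open>B\<close> the inverse of the Jacobian at \<open>z\<close>, the zeros near \<open>z\<close> are the fixed points of
  \<open>x \<mapsto> x - B H\<^sub>t(x)\<close>, a contraction of a small ball for \<open>t\<close> near \<open>t\<^sub>0\<close>.
\<close>

lemma regular_zero_continuation:
  assumes z: "regular_zero (H t0) z" and t0: "t0 \<in> {0..1}"
  obtains e where "e > 0"
    "\<And>e'. e' > 0 \<Longrightarrow> \<exists>d>0. \<forall>t\<in>{0..1}. dist t t0 < d \<longrightarrow> (\<exists>x\<in>cball z e'. x \<in> zeros (H t)) \<and>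
       (\<forall>x\<in>cball z e. \<forall>x'\<in>cball z e. x \<in> zeros (H t) \<longrightarrow> x' \<in> zeros (H t) \<longrightarrow> x = x')"
proof -
  let ?A = "\<chi> i j. poly_eval (vec_nth z) (pderiv_at j (H t0 i))"
  have zz: "poly_eval (vec_nth z) (H t0 i) = 0" for i
    using z by (simp add: regular_zero_def zeros_def)
  have "invertible ?A" using z by (simp add: regular_zero_def invertible_det_nz)
  then obtain B where B: "B ** ?A = mat 1" "?A ** B = mat 1" unfolding invertible_def by blast
  define \<phi> where "\<phi> t x = (\<chi> i. x $ i - (\<Sum>k\<in>UNIV. B $ i $ k * poly_eval (vec_nth x) (H t k)))" for t x
  define N where "N p i j = (if i = j then 1 else 0) -
    (\<Sum>k\<in>UNIV. B $ i $ k * poly_eval (vec_nth (snd p)) (pderiv_at j (H (fst p) k)))" for p i j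
  define g where "g p = (\<Sum>i\<in>UNIV. \<Sum>j\<in>UNIV. norm (N p i j))" for p
  \<comment> \<open>Each of the \<open>CARD('v)\<close> components will have Lipschitz constant
    \<open>c\<close>; their sum gives the constant 1/2.\<close>
  define c where "c = 1 / (2 * real CARD('v))"
  have c: "c > 0" by (simp add: c_def)
  have fixed: "\<phi> t x = x \<longleftrightarrow> x \<in> zeros (H t)" for t x
  proof
    assume "\<phi> t x = x"
    then have s0: "(\<Sum>k\<in>UNIV. B $ i $ k * poly_eval (vec_nth x) (H t k)) = 0" for i
      by (simp add: \<phi>_def vec_eq_iff)
    let ?v = "\<chi> k. poly_eval (vec_nth x) (H t k)"
    have "B *v ?v = 0" using s0 by (simp add: vec_eq_iff matrix_vector_mult_def)
    then have "(?A ** B) *v ?v = 0" by (metis matrix_vector_mul_assoc matrix_vector_mult_0_right)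
    then have "?v = 0" by (simp add: B(2))
    then show "x \<in> zeros (H t)" by (simp add: zeros_def vec_eq_iff)
  next
    assume "x \<in> zeros (H t)"
    then show "\<phi> t x = x" by (simp add: \<phi>_def zeros_def vec_eq_iff)
  qed
  have "N (t0, z) i j = 0" for i j
    using B(1) by (auto simp: N_def vec_eq_iff matrix_matrix_mult_def mat_def)
  then have g0: "g (t0, z) = 0" by (simp add: g_def)
  have "continuous_on ({0..1} \<times> UNIV) g"
    unfolding g_def N_def by (intro continuous_intros continuous_on_pderiv_H)
  then obtain e0 where e0: "e0 > 0"
    "\<And>p. p \<in> {0..1} \<times> UNIV \<Longrightarrow> dist p (t0, z) < e0 \<Longrightarrow> dist (g p) (g (t0, z)) < c"
    unfolding continuous_on_iff using t0 c by (metis UNIV_I mem_Sigma_iff)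
  have small: "g (t, x) < c" if "t \<in> {0..1}" "dist t t0 < e0 / 2" "dist x z < e0 / 2" for t x
  proof -
    have "dist (t, x) (t0, z) \<le> dist t t0 + dist x z"
      unfolding dist_prod_def by (simp add: sqrt_sum_squares_le_sum)
    then have "dist (g (t, x)) (g (t0, z)) < c"
      using that by (intro e0(2)) auto
    then show ?thesis using g0 by (simp add: dist_real_def)
  qed
  \<comment> \<open>Less than \<open>e0 / 2\<close>, so that the closed ball lies where
    \<open>small\<close> applies.\<close>
  define e where "e = e0 / 4"
  have e: "e > 0" using e0 by (simp add: e_def)
  have lip: "dist (\<phi> t x) (\<phi> t x') \<le> 1 / 2 * dist x x'"
    if t: "t \<in> {0..1}" "dist t t0 < e0 / 2" and x: "x \<in> cball z e" "x' \<in> cball z e" for t x x'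
  proof -
    have comp: "norm (\<phi> t x $ i - \<phi> t x' $ i) \<le> c * norm (x - x')" for i
    proof (rule differentiable_bound[OF convex_cball _ _ x])
      fix y assume y: "y \<in> cball z e"
      let ?D = "\<lambda>h :: complex ^ 'v. h $ i - (\<Sum>k\<in>UNIV. B $ i $ k *
        (\<Sum>j\<in>UNIV. poly_eval (vec_nth y) (pderiv_at j (H t k)) * h $ j))"
      show "((\<lambda>y. \<phi> t y $ i) has_derivative ?D) (at y within cball z e)"
        unfolding \<phi>_def vec_lambda_beta
        by (intro has_derivative_diff has_derivative_sum has_derivative_mult_right poly_eval_has_derivative
            bounded_linear_imp_has_derivative bounded_linear_vec_nth) auto
      show "onorm ?D \<le> c"
      proof (rule onorm_le)
        fix h :: "complex ^ 'v"
        have "?D h = (\<Sum>j\<in>UNIV. N (t, y) i j * h $ j)"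
        proof -
          have "(\<Sum>k\<in>UNIV. B $ i $ k * (\<Sum>j\<in>UNIV. poly_eval (vec_nth y) (pderiv_at j (H t k)) * h $ j)) =
            (\<Sum>j\<in>UNIV. (\<Sum>k\<in>UNIV. B $ i $ k * poly_eval (vec_nth y) (pderiv_at j (H t k))) * h $ j)"
            unfolding sum_distrib_left sum_distrib_right by (subst sum.swap) (simp add: mult_ac)
          moreover have "h $ i = (\<Sum>j\<in>UNIV. (if i = j then 1 else 0) * h $ j)"
            by (simp add: if_distrib[of "\<lambda>z. z * _"] cong: if_cong)
          ultimately show ?thesis
            by (simp add: N_def left_diff_distrib sum_subtractf)
        qed
        also have "norm \<dots> \<le> (\<Sum>j\<in>UNIV. norm (N (t, y) i j) * norm h)"
          by (rule sum_norm_le) (simp add: norm_mult mult_left_mono Finite_Cartesian_Product.norm_nth_le)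
        also have "\<dots> = (\<Sum>j\<in>UNIV. norm (N (t, y) i j)) * norm h"
          by (simp add: sum_distrib_right)
        also have "\<dots> \<le> g (t, y) * norm h"
          unfolding g_def by (intro mult_right_mono member_le_sum) (auto intro: sum_nonneg)
        also have "\<dots> \<le> c * norm h"
          using small[OF t, of y] y e by (intro mult_right_mono) (auto simp: e_def dist_commute)
        finally show "norm (?D h) \<le> c * norm h" .
      qed
    qed
    have "norm (\<phi> t x - \<phi> t x') \<le> (\<Sum>i\<in>UNIV. norm ((\<phi> t x - \<phi> t x') $ i))"
      by (rule norm_vec_le_sum)
    also have "\<dots> \<le> (\<Sum>i\<in>(UNIV :: 'v set). c * norm (x - x'))"
      by (rule sum_mono) (simp add: comp)
    also have "\<dots> = 1 / 2 * norm (x - x')" by (simp add: c_def)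
    finally show ?thesis by (simp add: dist_norm)
  qed
  show ?thesis
  proof (rule that[OF e])
    fix e' :: real assume e': "e' > 0"
    define e1 where "e1 = min e e'"
    have e1: "e1 > 0" "e1 \<le> e" "e1 \<le> e'" using e e' by (simp_all add: e1_def)
    have pe: "continuous_on {0..1} (\<lambda>t. poly_eval (vec_nth z) (H t k))" for k
    proof -
      have "continuous_on {0..1} (\<lambda>t. (t, z))" by (intro continuous_intros)
      from continuous_on_compose2[OF continuous_on_poly_eval_H this, of k] show ?thesis by auto
    qed
    have "continuous_on {0..1} (\<lambda>t. dist (\<phi> t z) z)"
      unfolding \<phi>_def by (intro continuous_intros pe)
    moreover have "\<phi> t0 z = z" using fixed z by (simp add: regular_zero_def)
    \<comment> \<open>The ball of radius \<open>e1\<close> is mapped to itself if its centre moves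
      by less than \<open>e1 / 2\<close>, as the contraction contributes at most the other
      half.\<close>
    moreover have "e1 / 2 > 0" using e1 by simp
    ultimately obtain d1 where d1: "d1 > 0"
      "\<And>t. t \<in> {0..1} \<Longrightarrow> dist t t0 < d1 \<Longrightarrow> dist (dist (\<phi> t z) z) (dist (\<phi> t0 z) z) < e1 / 2"
      unfolding continuous_on_iff using t0 by metis
    define d where "d = min d1 (e0 / 2)"
    show "\<exists>d>0. \<forall>t\<in>{0..1}. dist t t0 < d \<longrightarrow> (\<exists>x\<in>cball z e'. x \<in> zeros (H t)) \<and>
       (\<forall>x\<in>cball z e. \<forall>x'\<in>cball z e. x \<in> zeros (H t) \<longrightarrow> x' \<in> zeros (H t) \<longrightarrow> x = x')"
    proof (intro exI[of _ d] conjI ballI impI)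
      show "d > 0" using d1 e0 by (simp add: d_def)
    next
      fix t assume t: "t \<in> {0..1}" "dist t t0 < d"
      then have t': "dist t t0 < e0 / 2" "dist (\<phi> t z) z < e1 / 2"
        using d1(2)[of t] \<open>\<phi> t0 z = z\<close> by (auto simp: d_def)
      have "\<exists>!x\<in>cball z e1. \<phi> t x = x"
      proof (rule Banach_fix)
        show "complete (cball z e1)" by (simp add: complete_eq_closed)
        show "cball z e1 \<noteq> {}" using e1 by simp
        show "0 \<le> (1 / 2 :: real)" "(1 / 2 :: real) < 1" by simp_all
        show "\<phi> t ` cball z e1 \<subseteq> cball z e1"
        proof (rule image_subsetI)
          fix x assume x: "x \<in> cball z e1"
          have "dist z (\<phi> t x) \<le> dist (\<phi> t x) (\<phi> t z) + dist (\<phi> t z) z"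
            by (metis dist_commute dist_triangle)
          also have "dist (\<phi> t x) (\<phi> t z) \<le> 1 / 2 * dist x z"
            using x e1 by (intro lip t(1) t'(1)) auto
          also have "1 / 2 * dist x z + dist (\<phi> t z) z \<le> e1"
            using x t'(2) by (simp add: dist_commute)
          finally show "\<phi> t x \<in> cball z e1" by simp
        qed
        fix x y assume "x \<in> cball z e1" "y \<in> cball z e1"
        then show "dist (\<phi> t x) (\<phi> t y) \<le> 1 / 2 * dist x y"
          using e1 by (intro lip t(1) t'(1)) auto
      qed
      then obtain x where "x \<in> cball z e1" "\<phi> t x = x" by blast
      then show "\<exists>x\<in>cball z e'. x \<in> zeros (H t)"
        using e1 fixed by (intro bexI[of _ x]) auto
    next
      fix t x x' assume t: "t \<in> {0..1}" "dist t t0 < d"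
        and x: "x \<in> cball z e" "x' \<in> cball z e" "x \<in> zeros (H t)" "x' \<in> zeros (H t)"
      then have "dist x x' \<le> 1 / 2 * dist x x'"
        using lip[of t x x'] fixed[of t x] fixed[of t x'] by (simp add: d_def)
      then show "x = x'" using zero_le_dist[of x x'] by (simp add: field_simps)
    qed
  qed
qed

end

section \<open>Optimality\<close>

lemma isolated_zeros_subset: "isolated_zeros K \<subseteq> zeros K"
  by (auto simp: isolated_zeros_def isolated_in_def)

text \<open>The assumption \<open>initial\<close> is Bernstein's condition: for a nonzero weight
  vector the initial forms have no common zero in the torus. Upper bounds \<open>v\<close> take the
  place of the maximum, and a level that is not attained gives a trivial equation.\<close>

locale polyhedral_homotopy_regular = convex_homotopy F H
  for F :: "'v::finite system" and H :: "real \<Rightarrow> 'v system" +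
  fixes G :: "'v system"
  assumes poly_hom: "polyhedral_homotopy F G H"
    and zeros_torus: "zeros F \<subseteq> torus"
    and zeros_regular: "\<And>z. z \<in> zeros F \<Longrightarrow> regular_zero F z"
    and initial: "\<And>w \<xi> i. (\<And>i. \<xi> i \<noteq> 0) \<Longrightarrow>
      (\<And>i v. (\<And>a. a \<in> Poly_Mapping.keys (F i) \<Longrightarrow> weight w a \<le> v) \<Longrightarrow> weight_part w v (F i) \<xi> = 0) \<Longrightarrow> w i = 0"
begin

lemma H_1: "H 1 = G"
  using poly_hom by (simp add: polyhedral_homotopy_def homotopy_def)

lemma isolated_zeros_H:
  assumes "t \<in> {0<..1}"
  shows "finite (isolated_zeros (H t))"
    and "card (isolated_zeros (H t)) = card (isolated_zeros G)"
    and "x \<in> isolated_zeros (H t) \<Longrightarrow> regular_zero (H t) x \<and> x \<in> torus"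
proof -
  have *: "\<forall>t\<in>{0<..1}. finite (isolated_zeros (H t)) \<and>
        real (card (isolated_zeros (H t))) = mixed_volume (\<lambda>i. newton_polytope (F i)) \<and>
        (\<forall>x\<in>isolated_zeros (H t). regular_zero (H t) x \<and> x \<in> torus)"
    using poly_hom unfolding polyhedral_homotopy_def by blast
  then show "finite (isolated_zeros (H t))" "x \<in> isolated_zeros (H t) \<Longrightarrow> regular_zero (H t) x \<and> x \<in> torus"
    using assms by blast+
  have "real (card (isolated_zeros (H t))) = real (card (isolated_zeros (H 1)))"
    using bspec[OF *, of t] bspec[OF *, of 1] assms by simp
  then show "card (isolated_zeros (H t)) = card (isolated_zeros G)" by (simp add: H_1)
qed

text \<open>The compactness statement, used with constant parameter 0, lets infinitely many zeros
  accumulate at a zero; but that one is regular and hence isolated.\<close>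

lemma finite_zeros: "finite (zeros F)"
proof (rule ccontr)
  assume "infinite (zeros F)"
  then obtain x :: "nat \<Rightarrow> complex ^ 'v" where x: "inj x" "range x \<subseteq> zeros F"
    using infinite_countable_subset by blast
  have xz: "x k \<in> zeros F" for k using x(2) by blast
  obtain r z where rz: "strict_mono r" "z \<in> zeros F" "(x \<circ> r) \<longlonglongrightarrow> z"
  proof (rule zeros_subsequence[of "\<lambda>_. 0" x])
    show "x k \<in> torus" "x k \<in> zeros (H 0)" for k
      using xz zeros_torus by (auto simp: H_0)
  qed (use initial in \<open>blast | simp\<close>)+
  obtain e where e: "e > 0"
    "\<And>e'. e' > 0 \<Longrightarrow> \<exists>d>0. \<forall>t\<in>{0..1}. dist t 0 < d \<longrightarrow> (\<exists>x\<in>cball z e'. x \<in> zeros (H t)) \<and>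
       (\<forall>x\<in>cball z e. \<forall>x'\<in>cball z e. x \<in> zeros (H t) \<longrightarrow> x' \<in> zeros (H t) \<longrightarrow> x = x')"
    using zeros_regular[OF rz(2)] by (rule regular_zero_continuation[of 0 z, unfolded H_0]) simp_all
  from e(2)[of 1] have uniq: "x = x'" if "x \<in> cball z e" "x' \<in> cball z e" "x \<in> zeros F" "x' \<in> zeros F" for x x'
    using that by (force simp: H_0)
  have "eventually (\<lambda>k. dist ((x \<circ> r) k) z < e) sequentially"
    using tendstoD[OF rz(3) e(1)] .
  then obtain k where k: "\<And>n. n \<ge> k \<Longrightarrow> dist (x (r n)) z < e"
    unfolding eventually_sequentially by auto
  have "x (r k) = x (r (Suc k))"
    using k[of k] k[of "Suc k"] by (intro uniq xz) (simp_all add: dist_commute)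
  then have "r k = r (Suc k)" using x(1) by (simp add: inj_eq)
  then show False using rz(1) by (metis lessI order_less_irrefl strict_mono_less)
qed

lemma zeros_separated:
  obtains e where "e > 0"
    "\<And>z z'. z \<in> zeros F \<Longrightarrow> z' \<in> zeros F \<Longrightarrow> cball z e \<inter> cball z' e \<noteq> {} \<Longrightarrow> z = z'"
    "\<And>e'. e' > 0 \<Longrightarrow> \<exists>d>0. \<forall>t\<in>{0..1}. t < d \<longrightarrow> (\<forall>z\<in>zeros F. (\<exists>x\<in>cball z e'. x \<in> zeros (H t)) \<and>
       (\<forall>x\<in>cball z e. \<forall>x'\<in>cball z e. x \<in> zeros (H t) \<longrightarrow> x' \<in> zeros (H t) \<longrightarrow> x = x'))"
proof -
  let ?P = "\<lambda>z e e' d t. dist t 0 < d \<longrightarrow> (\<exists>x\<in>cball z e'. x \<in> zeros (H t)) \<and>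
       (\<forall>x\<in>cball z e. \<forall>x'\<in>cball z e. x \<in> zeros (H t) \<longrightarrow> x' \<in> zeros (H t) \<longrightarrow> x = x')"
  have "\<forall>z\<in>zeros F. \<exists>e>0. \<forall>e'>0. \<exists>d>0. \<forall>t\<in>{0..1}. ?P z e e' d t"
  proof
    fix z assume "z \<in> zeros F"
    then have "regular_zero (H 0) z" using zeros_regular by (simp add: H_0)
    then show "\<exists>e>0. \<forall>e'>0. \<exists>d>0. \<forall>t\<in>{0..1}. ?P z e e' d t"
      by (rule regular_zero_continuation) (simp, blast)
  qed
  from bchoice[OF this] obtain e where
    e: "\<And>z. z \<in> zeros F \<Longrightarrow> e z > 0" and
    P: "\<And>z e'. z \<in> zeros F \<Longrightarrow> e' > 0 \<Longrightarrow> \<exists>d>0. \<forall>t\<in>{0..1}. ?P z (e z) e' d t"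
    by blast
  \<comment> \<open>If balls of radius \<open>e0\<close> meet, their centres are at distance at most
    \<open>2 * e0\<close>, so both lie in the ball of uniqueness around \<open>z\<close>. The
    inserted 1 covers the case without zeros.\<close>
  define e0 where "e0 = Min (insert 1 (e ` zeros F)) / 3"
  have e0: "e0 > 0" using finite_zeros e by (simp add: e0_def)
  have e0_le: "3 * e0 \<le> e z" if "z \<in> zeros F" for z
    using finite_zeros that by (simp add: e0_def)
  show ?thesis
  proof (rule that[OF e0])
    fix z z' assume z: "z \<in> zeros F" "z' \<in> zeros F" and "cball z e0 \<inter> cball z' e0 \<noteq> {}"
    then obtain x where "dist z x \<le> e0" "dist z' x \<le> e0" by auto
    then have "dist z z' \<le> e0 + e0" using dist_triangle2[of z z' x] by linarith
    then have "dist z z' \<le> e z" using e0_le[OF z(1)] e0 by linarith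
    moreover obtain d where d: "d > 0" "\<forall>t\<in>{0..1}. ?P z (e z) 1 d t"
      using P[OF z(1), of 1] by auto
    have "?P z (e z) 1 d 0" by (rule bspec[OF d(2)]) simp
    with d(1) have "\<forall>x\<in>cball z (e z). \<forall>x'\<in>cball z (e z). x \<in> zeros F \<longrightarrow> x' \<in> zeros F \<longrightarrow> x = x'"
      by (simp add: H_0)
    ultimately show "z = z'"
      using z e[OF z(1)] by auto
  next
    fix e' :: real assume e': "e' > 0"
    have "\<forall>z\<in>zeros F. \<exists>d>0. \<forall>t\<in>{0..1}. ?P z (e z) e' d t" using P e' by blast
    from bchoice[OF this] obtain d where
      d: "\<And>z. z \<in> zeros F \<Longrightarrow> d z > 0" "\<And>z t. z \<in> zeros F \<Longrightarrow> t \<in> {0..1} \<Longrightarrow> ?P z (e z) e' (d z) t"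
      by blast
    define d0 where "d0 = Min (insert 1 (d ` zeros F))"
    have d0: "d0 > 0" using finite_zeros d(1) by (simp add: d0_def)
    have d0_le: "d0 \<le> d z" if "z \<in> zeros F" for z
      using finite_zeros that by (simp add: d0_def)
    show "\<exists>d>0. \<forall>t\<in>{0..1}. t < d \<longrightarrow> (\<forall>z\<in>zeros F. (\<exists>x\<in>cball z e'. x \<in> zeros (H t)) \<and>
       (\<forall>x\<in>cball z e0. \<forall>x'\<in>cball z e0. x \<in> zeros (H t) \<longrightarrow> x' \<in> zeros (H t) \<longrightarrow> x = x'))"
    proof (intro exI[of _ d0] conjI ballI impI)
      show "d0 > 0" by (rule d0)
    next
      fix t z assume t: "t \<in> {0..1}" "t < d0" and z: "z \<in> zeros F"
      then have dt: "dist t 0 < d z" using d0_le[OF z] by simp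
      from d(2)[OF z t(1)] dt show "\<exists>x\<in>cball z e'. x \<in> zeros (H t)" by blast
      fix x x' assume x: "x \<in> cball z e0" "x' \<in> cball z e0" "x \<in> zeros (H t)" "x' \<in> zeros (H t)"
      then have "x \<in> cball z (e z)" "x' \<in> cball z (e z)" using e0_le[OF z] e0 by auto
      with d(2)[OF z t(1)] dt x(3,4) show "x = x'" by blast
    qed
  qed
qed

text \<open>Otherwise torus zeros with parameters tending to 0 would stay away from all zeros of
  \<open>F\<close>, although a subsequence converges to one.\<close>

lemma zeros_near:
  assumes e: "e > 0"
  obtains d where "d > 0" "\<And>t x. t \<in> {0<..1} \<Longrightarrow> t < d \<Longrightarrow> x \<in> zeros (H t) \<Longrightarrow> x \<in> torus \<Longrightarrow> \<exists>z\<in>zeros F. dist z x < e"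
proof -
  have "\<exists>d>0. \<forall>t\<in>{0<..1}. \<forall>x\<in>zeros (H t) \<inter> torus. t < d \<longrightarrow> (\<exists>z\<in>zeros F. dist z x < e)"
  proof (rule ccontr)
    assume "\<not> ?thesis"
    then have "\<forall>n :: nat. \<exists>t x. t \<in> {0<..1} \<and> x \<in> zeros (H t) \<inter> torus \<and> t < 1 / real (Suc n) \<and> (\<forall>z\<in>zeros F. \<not> dist z x < e)"
      by (metis divide_pos_pos less_numeral_extra(1) of_nat_0_less_iff zero_less_Suc)
    from choice[OF this] obtain T where "\<forall>n. \<exists>x. T n \<in> {0<..1} \<and> x \<in> zeros (H (T n)) \<inter> torus \<and>
        T n < 1 / real (Suc n) \<and> (\<forall>z\<in>zeros F. \<not> dist z x < e)" ..
    from choice[OF this] obtain x where Tx: "\<forall>n. T n \<in> {0<..1} \<and> x n \<in> zeros (H (T n)) \<inter> torus \<and>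
        T n < 1 / real (Suc n) \<and> (\<forall>z\<in>zeros F. \<not> dist z (x n) < e)" ..
    have "T \<longlonglongrightarrow> 0"
    proof (rule tendsto_sandwich[OF _ _ tendsto_const lim_inverse_n'[THEN LIMSEQ_Suc]])
      show "eventually (\<lambda>n. 0 \<le> T n) sequentially" "eventually (\<lambda>n. T n \<le> 1 / real (Suc n)) sequentially"
        using Tx by (auto intro!: always_eventually less_imp_le)
    qed
    then obtain r z where rz: "strict_mono r" "z \<in> zeros F" "(x \<circ> r) \<longlonglongrightarrow> z"
    proof (rule zeros_subsequence[rotated])
      show "T k \<in> {0..1}" "x k \<in> torus" "x k \<in> zeros (H (T k))" for k
        using Tx[rule_format, of k] by auto
    qed (use initial in blast)+
    then obtain k where "dist (x (r k)) z < e"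
      using tendstoD[OF rz(3) e] eventually_happens'[OF sequentially_bot] by fastforce
    then show False using Tx rz(2) by (metis dist_commute)
  qed
  then show ?thesis using that by blast
qed

text \<open>For small \<open>t\<close> disjoint balls around the zeros of \<open>F\<close> match
  these with the isolated zeros of \<open>H t\<close>. Connectedness then assigns a single ball,
  hence a single limit, to each path.\<close>

lemma optimal: "optimal_homotopy F G H"
proof -
  obtain e where e: "e > 0"
    and sep: "\<And>z z'. z \<in> zeros F \<Longrightarrow> z' \<in> zeros F \<Longrightarrow> cball z e \<inter> cball z' e \<noteq> {} \<Longrightarrow> z = z'"
    and cont: "\<And>e'. e' > 0 \<Longrightarrow> \<exists>d>0. \<forall>t\<in>{0..1}. t < d \<longrightarrow> (\<forall>z\<in>zeros F. (\<exists>x\<in>cball z e'. x \<in> zeros (H t)) \<and>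
       (\<forall>x\<in>cball z e. \<forall>x'\<in>cball z e. x \<in> zeros (H t) \<longrightarrow> x' \<in> zeros (H t) \<longrightarrow> x = x'))"
    by (rule zeros_separated) blast
  obtain d1 where d1: "d1 > 0" "\<And>t x. t \<in> {0<..1} \<Longrightarrow> t < d1 \<Longrightarrow> x \<in> zeros (H t) \<Longrightarrow> x \<in> torus \<Longrightarrow> \<exists>z\<in>zeros F. dist z x < e"
    by (rule zeros_near[OF e]) blast
  have "e / 2 > 0" using e by simp
  from cont[OF this] obtain d2 where d2: "d2 > 0" and
    t2: "\<And>t. t \<in> {0..1} \<Longrightarrow> t < d2 \<Longrightarrow> (\<forall>z\<in>zeros F. (\<exists>x\<in>cball z (e / 2). x \<in> zeros (H t)) \<and>
       (\<forall>x\<in>cball z e. \<forall>x'\<in>cball z e. x \<in> zeros (H t) \<longrightarrow> x' \<in> zeros (H t) \<longrightarrow> x = x'))"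
    by blast
  have ex: "\<exists>x\<in>cball z (e / 2). x \<in> zeros (H t)" if "t \<in> {0..1}" "t < d2" "z \<in> zeros F" for t z
    using t2[OF that(1,2)] that(3) by blast
  have uniq: "x = x'" if "t \<in> {0..1}" "t < d2" "z \<in> zeros F" "x \<in> cball z e" "x' \<in> cball z e"
    "x \<in> zeros (H t)" "x' \<in> zeros (H t)" for t z x x'
    using t2[OF that(1,2)] that(3-) by blast
  define d where "d = min 1 (min d1 d2)"
  have d: "d > 0" "d \<le> 1" "d \<le> d1" "d \<le> d2" using d1 d2 by (auto simp: d_def)
  have near: "\<exists>z\<in>zeros F. x \<in> ball z e" if "t \<in> {0<..<d}" "x \<in> isolated_zeros (H t)" for t x
    using d1(2)[of t x] that d isolated_zeros_subset isolated_zeros_H(3)[of t x] by auto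
  have "\<exists>x. x \<in> isolated_zeros (H t) \<and> x \<in> ball z e" if t: "t \<in> {0<..<d}" and z: "z \<in> zeros F" for t z
  proof -
    obtain x where x: "x \<in> cball z (e / 2)" "x \<in> zeros (H t)"
      using ex[of t z] t d z by auto
    have "x \<in> ball z e" using x(1) e by auto
    \<comment> \<open>Uniqueness in the ball makes the nearby zero isolated, so that it is among the
      zeros counted by the homotopy.\<close>
    have "ball z e \<inter> zeros (H t) = {x}"
      using uniq[of t z _ x] x \<open>x \<in> ball z e\<close> t d z by force
    then have "x \<in> isolated_zeros (H t)"
      unfolding isolated_zeros_def isolated_in_def using x(2) by blast
    then show ?thesis using \<open>x \<in> ball z e\<close> by blast
  qed
  then obtain \<nu> where \<nu>: "\<And>t z. t \<in> {0<..<d} \<Longrightarrow> z \<in> zeros F \<Longrightarrow> \<nu> t z \<in> isolated_zeros (H t) \<and> \<nu> t z \<in> ball z e"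
    by metis
  have card: "card (isolated_zeros G) = card (zeros F)"
  proof -
    \<comment> \<open>One small parameter suffices, as the number of isolated zeros is the same for
      all \<open>t\<close> in \<open>{0<..1}\<close>.\<close>
    define t where "t = d / 2"
    have t: "t \<in> {0<..<d}" "t \<in> {0<..1}" "t \<in> {0..1}" "t < d2" using d by (auto simp: t_def)
    have "bij_betw (\<nu> t) (zeros F) (isolated_zeros (H t))"
      unfolding bij_betw_def
    proof (intro conjI equalityI subsetI inj_onI)
      fix z z' assume "z \<in> zeros F" "z' \<in> zeros F" "\<nu> t z = \<nu> t z'"
      then have "z \<in> zeros F" "z' \<in> zeros F" "\<nu> t z \<in> cball z e \<inter> cball z' e"
        using \<nu>[OF t(1), of z] \<nu>[OF t(1), of z'] by auto
      then show "z = z'" by (intro sep) blast+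
    next
      fix x assume "x \<in> \<nu> t ` zeros F"
      then show "x \<in> isolated_zeros (H t)" using \<nu>[OF t(1)] by blast
    next
      fix x assume x: "x \<in> isolated_zeros (H t)"
      then obtain z where z: "z \<in> zeros F" "x \<in> ball z e" using near[OF t(1)] by blast
      have "x = \<nu> t z"
        using \<nu>[OF t(1) z(1)] z x isolated_zeros_subset by (intro uniq[OF t(3,4) z(1)]) auto
      then show "x \<in> \<nu> t ` zeros F" using z(1) by blast
    qed
    then have "card (zeros F) = card (isolated_zeros (H t))" by (rule bij_betw_same_card)
    then show ?thesis using isolated_zeros_H(2)[OF t(2)] by simp
  qed
  have converges: "(\<gamma> \<longlongrightarrow> z) (at_right 0)"
    if \<gamma>: "continuous_on {0<..1} \<gamma>" "\<And>t. t \<in> {0<..1} \<Longrightarrow> \<gamma> t \<in> isolated_zeros (H t)"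
      and s: "s \<in> {0<..<d}" and z: "z \<in> zeros F" "\<gamma> s \<in> ball z e" for \<gamma> z s
  proof -
    \<comment> \<open>The image of the interval is connected and covered by disjoint open balls, so
      it cannot leave the one it meets.\<close>
    have in_ball: "\<gamma> t \<in> ball z e" if t: "t \<in> {0<..<d}" for t
    proof (rule ccontr)
      assume nb: "\<gamma> t \<notin> ball z e"
      have "connected (\<gamma> ` {0<..<d})"
        using d by (intro connected_continuous_image continuous_on_subset[OF \<gamma>(1)]) auto
      moreover have "\<gamma> ` {0<..<d} \<subseteq> ball z e \<union> (\<Union>z'\<in>zeros F - {z}. ball z' e)"
      proof (rule image_subsetI)
        fix u assume u: "u \<in> {0<..<d}"
        then have "\<exists>z'\<in>zeros F. \<gamma> u \<in> ball z' e" using \<gamma>(2)[of u] d by (intro near) auto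
        then show "\<gamma> u \<in> ball z e \<union> (\<Union>z'\<in>zeros F - {z}. ball z' e)" by blast
      qed
      moreover have "ball z e \<inter> (\<Union>z'\<in>zeros F - {z}. ball z' e) = {}"
        using sep[OF z(1)] ball_subset_cball by blast
      ultimately have "ball z e \<inter> \<gamma> ` {0<..<d} = {} \<or> (\<Union>z'\<in>zeros F - {z}. ball z' e) \<inter> \<gamma> ` {0<..<d} = {}"
        by (intro connectedD) auto
      moreover have "\<gamma> s \<in> ball z e \<inter> \<gamma> ` {0<..<d}" using s z(2) by blast
      moreover have "\<exists>z'\<in>zeros F. \<gamma> t \<in> ball z' e" using \<gamma>(2)[of t] t d by (intro near) auto
      ultimately show False using nb t by blast
    qed
    show ?thesis
    proof (rule tendstoI)
      fix e' :: real assume e': "e' > 0"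
      then have "min e e' > 0" using e by simp
      then obtain d3 where d3: "d3 > 0" "\<And>t x. t \<in> {0<..1} \<Longrightarrow> t < d3 \<Longrightarrow> x \<in> zeros (H t) \<Longrightarrow> x \<in> torus \<Longrightarrow> \<exists>z\<in>zeros F. dist z x < min e e'"
        by (rule zeros_near) blast
      have "dist (\<gamma> t) z < e'" if t: "t \<in> {0<..<min d d3}" for t
      proof -
        have t1: "t \<in> {0<..1}" "t \<in> {0<..<d}" using t d by auto
        have "\<gamma> t \<in> zeros (H t)" "\<gamma> t \<in> torus"
          using \<gamma>(2)[OF t1(1)] isolated_zeros_subset isolated_zeros_H(3)[OF t1(1)] by blast+
        then obtain z' where z': "z' \<in> zeros F" "dist z' (\<gamma> t) < min e e'"
          using d3(2)[OF t1(1)] t by auto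
        have "\<gamma> t \<in> cball z e \<inter> cball z' e" using in_ball[OF t1(2)] z'(2) by auto
        then have "z = z'" using z(1) z'(1) by (intro sep) auto
        then show ?thesis using z'(2) by (simp add: dist_commute)
      qed
      then show "eventually (\<lambda>t. dist (\<gamma> t) z < e') (at_right 0)"
        unfolding eventually_at_right_field using d(1) d3(1) by (intro exI[of _ "min d d3"]) auto
    qed
  qed
  obtain \<Gamma> where \<Gamma>: "\<And>k. k < card (isolated_zeros G) \<Longrightarrow> continuation_path G H (\<Gamma> k)"
    and bij: "\<And>t. t \<in> {0<..1} \<Longrightarrow> bij_betw (\<lambda>k. \<Gamma> k t) {..<card (isolated_zeros G)} (isolated_zeros (H t))"
    using poly_hom unfolding polyhedral_homotopy_def by blast
  have \<Gamma>_iso: "\<Gamma> k t \<in> isolated_zeros (H t)" if "k < card (isolated_zeros G)" "t \<in> {0<..1}" for k t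
    using bij_betwE[OF bij[OF that(2)]] that(1) by blast
  have \<Gamma>_cont: "continuous_on {0<..1} (\<Gamma> k)" if "k < card (isolated_zeros G)" for k
    using \<Gamma>[OF that] by (simp add: continuation_path_def)
  \<comment> \<open>Apart from its start, a continuation path is only known to consist of zeros,
    isolated or not. The set where it agrees with \<open>\<Gamma> k\<close> is closed by continuity
    and open because \<open>\<Gamma> k t\<close> is regular, hence locally the only zero.\<close>
  have path: "\<exists>k<card (isolated_zeros G). \<forall>t\<in>{0<..1}. \<gamma> t = \<Gamma> k t" if \<gamma>: "continuation_path G H \<gamma>" for \<gamma>
  proof -
    have \<gamma>c: "continuous_on {0<..1} \<gamma>" and \<gamma>z: "\<And>t. t \<in> {0<..1} \<Longrightarrow> \<gamma> t \<in> zeros (H t)"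
      and "\<gamma> 1 \<in> isolated_zeros (H 1)"
      using \<gamma> by (auto simp: continuation_path_def H_1)
    then have "\<gamma> 1 \<in> (\<lambda>k. \<Gamma> k 1) ` {..<card (isolated_zeros G)}"
      using bij_betw_imp_surj_on[OF bij[of 1]] by simp
    then obtain k where k: "k < card (isolated_zeros G)" "\<gamma> 1 = \<Gamma> k 1" by blast
    define E where "E = {t \<in> {0<..1}. \<gamma> t = \<Gamma> k t}"
    have "closedin (top_of_set {0<..1}) {t \<in> {0<..1}. \<gamma> t - \<Gamma> k t = 0}"
      by (intro continuous_closedin_preimage_constant continuous_on_diff \<gamma>c \<Gamma>_cont k(1))
    then have closed: "closedin (top_of_set {0<..1}) E" by (simp add: E_def)
    have "openin (top_of_set {0<..1}) E"
      unfolding openin_euclidean_subtopology_iff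
    proof (intro conjI ballI)
      show "E \<subseteq> {0<..1}" by (auto simp: E_def)
      fix t0 assume t0: "t0 \<in> E"
      then have t01: "t0 \<in> {0<..1}" and eq: "\<gamma> t0 = \<Gamma> k t0" by (auto simp: E_def)
      have "regular_zero (H t0) (\<Gamma> k t0)"
        using isolated_zeros_H(3)[OF t01] \<Gamma>_iso[OF k(1) t01] by blast
      moreover have "t0 \<in> {0..1}" using t01 by simp
      ultimately obtain \<epsilon> where \<epsilon>: "\<epsilon> > 0"
        "\<And>e'. e' > 0 \<Longrightarrow> \<exists>d>0. \<forall>t\<in>{0..1}. dist t t0 < d \<longrightarrow> (\<exists>x\<in>cball (\<Gamma> k t0) e'. x \<in> zeros (H t)) \<and>
       (\<forall>x\<in>cball (\<Gamma> k t0) \<epsilon>. \<forall>x'\<in>cball (\<Gamma> k t0) \<epsilon>. x \<in> zeros (H t) \<longrightarrow> x' \<in> zeros (H t) \<longrightarrow> x = x')"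
        by (rule regular_zero_continuation) blast
      obtain a where a: "a > 0" "\<And>t x x'. t \<in> {0..1} \<Longrightarrow> dist t t0 < a \<Longrightarrow> x \<in> cball (\<Gamma> k t0) \<epsilon> \<Longrightarrow>
          x' \<in> cball (\<Gamma> k t0) \<epsilon> \<Longrightarrow> x \<in> zeros (H t) \<Longrightarrow> x' \<in> zeros (H t) \<Longrightarrow> x = x'"
        using \<epsilon>(2)[of 1] by auto
      obtain b where b: "b > 0" "\<And>t. t \<in> {0<..1} \<Longrightarrow> dist t t0 < b \<Longrightarrow> dist (\<gamma> t) (\<gamma> t0) < \<epsilon>"
        using \<gamma>c \<epsilon>(1) t01 unfolding continuous_on_iff by metis
      obtain c where c: "c > 0" "\<And>t. t \<in> {0<..1} \<Longrightarrow> dist t t0 < c \<Longrightarrow> dist (\<Gamma> k t) (\<Gamma> k t0) < \<epsilon>"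
        using \<Gamma>_cont[OF k(1)] \<epsilon>(1) t01 unfolding continuous_on_iff by metis
      show "\<exists>e>0. \<forall>x'\<in>{0<..1}. dist x' t0 < e \<longrightarrow> x' \<in> E"
      proof (intro exI[of _ "min a (min b c)"] conjI ballI impI)
        show "min a (min b c) > 0" using a b c by simp
        fix t assume t: "t \<in> {0<..1}" "dist t t0 < min a (min b c)"
        have "\<gamma> t = \<Gamma> k t"
        proof (rule a(2)[of t])
          show "\<gamma> t \<in> cball (\<Gamma> k t0) \<epsilon>" "\<Gamma> k t \<in> cball (\<Gamma> k t0) \<epsilon>"
            using b(2)[OF t(1)] c(2)[OF t(1)] t(2) by (simp_all add: eq dist_commute)
          show "\<gamma> t \<in> zeros (H t)" "\<Gamma> k t \<in> zeros (H t)"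
            using \<gamma>z[OF t(1)] \<Gamma>_iso[OF k(1) t(1)] isolated_zeros_subset by blast+
        qed (use t in auto)
        then show "t \<in> E" using t(1) by (simp add: E_def)
      qed
    qed
    moreover have "1 \<in> E" using k(2) by (simp add: E_def)
    moreover have "connected {0<..1::real}" by simp
    ultimately have "E = {0<..1}" using closed unfolding connected_clopen by blast
    then show ?thesis using k(1) by (auto simp: E_def)
  qed
  show ?thesis
    unfolding optimal_homotopy_def
  proof (intro conjI allI impI ballI)
    show "finite (isolated_zeros G)" using isolated_zeros_H(1)[of 1] by (simp add: H_1)
    show "finite (zeros F)" by (rule finite_zeros)
    show "card (isolated_zeros G) = card (zeros F)" by (rule card)
  next
    fix \<gamma> assume \<gamma>: "continuation_path G H \<gamma>"
    then obtain k where k: "k < card (isolated_zeros G)" "\<forall>t\<in>{0<..1}. \<gamma> t = \<Gamma> k t" using path by blast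
    have iso: "\<gamma> t \<in> isolated_zeros (H t)" if "t \<in> {0<..1}" for t
      using k \<Gamma>_iso[OF k(1) that] that by simp
    have s: "d / 2 \<in> {0<..<d}" "d / 2 \<in> {0<..1}" using d by auto
    obtain z where z: "z \<in> zeros F" "\<gamma> (d / 2) \<in> ball z e" using near[OF s(1) iso[OF s(2)]] by blast
    have "continuous_on {0<..1} \<gamma>" using \<gamma> by (simp add: continuation_path_def)
    from converges[OF this iso s(1) z] z(1) show "\<exists>z\<in>zeros F. (\<gamma> \<longlongrightarrow> z) (at_right 0)" by blast
  next
    fix z assume z: "z \<in> zeros F"
    have s: "d / 2 \<in> {0<..<d}" "d / 2 \<in> {0<..1}" using d by auto
    have "\<nu> (d / 2) z \<in> (\<lambda>k. \<Gamma> k (d / 2)) ` {..<card (isolated_zeros G)}"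
      using \<nu>[OF s(1) z] bij_betw_imp_surj_on[OF bij[OF s(2)]] by simp
    then obtain k where k: "k < card (isolated_zeros G)" "\<Gamma> k (d / 2) = \<nu> (d / 2) z" by auto
    then have "\<Gamma> k (d / 2) \<in> ball z e" using \<nu>[OF s(1) z] by simp
    from converges[OF \<Gamma>_cont[OF k(1)] \<Gamma>_iso[OF k(1)] s(1) z this] \<Gamma>[OF k(1)]
    show "\<exists>\<gamma>. continuation_path G H \<gamma> \<and> (\<gamma> \<longlongrightarrow> z) (at_right 0)" by blast
  qed
qed

end

theorem corollary5:
  fixes A :: "'n::finite exponent set"
  assumes "finite A" and "0 \<in> A"
  shows "holds_for_general_poly A (\<lambda>f. holds_for_general_point (\<lambda>u.
           \<forall>G H. polyhedral_homotopy (lagrange_system f u) G H \<longrightarrow>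
                 optimal_homotopy (lagrange_system f u) G H))"
proof (rule holds_for_general_poly_transversal[OF assms(1)])
  fix f :: "'n cpoly"
  assume keys: "Poly_Mapping.keys f = A" and "transversal_coeffs A (Poly_Mapping.lookup f)"
  then have f: "transversal_coeffs (Poly_Mapping.keys f) (Poly_Mapping.lookup f)" and const: "0 \<in> Poly_Mapping.keys f"
    using assms(2) by simp_all
  show "holds_for_general_point (\<lambda>u. \<forall>G H. polyhedral_homotopy (lagrange_system f u) G H \<longrightarrow>
      optimal_homotopy (lagrange_system f u) G H)"
  proof (rule holds_for_general_point_general_data[OF f const], intro allI impI)
    fix u :: "complex ^ 'n" and G H
    assume u: "general_data f (vec_nth u)" and hom: "polyhedral_homotopy (lagrange_system f u) G H"
    interpret polyhedral_homotopy_regular "lagrange_system f u" H G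
    proof unfold_locales
      show "H 0 = lagrange_system f u" "\<And>i a. continuous_on {0..1} (\<lambda>t. Poly_Mapping.lookup (H t i) a)"
        "\<And>t i. t \<in> {0..1} \<Longrightarrow> newton_polytope (H t i) \<subseteq> newton_polytope (lagrange_system f u i)"
        using hom by (auto simp: polyhedral_homotopy_def homotopy_def)
      show "zeros (lagrange_system f u) \<subseteq> torus" by (rule zeros_lagrange_torus[OF f const u])
      show "regular_zero (lagrange_system f u) z" if "z \<in> zeros (lagrange_system f u)" for z
        by (rule regular_zero_lagrange[OF f const u that])
      show "w i = 0" if "\<And>i. \<xi> i \<noteq> 0" "\<And>i v. (\<And>a. a \<in> Poly_Mapping.keys (lagrange_system f u i) \<Longrightarrow> weight w a \<le> v) \<Longrightarrow>
          weight_part w v (lagrange_system f u i) \<xi> = 0" for w \<xi> i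
        by (rule initial_lagrange_system_no_torus_zero[OF f const u that])
    qed (rule hom)
    show "optimal_homotopy (lagrange_system f u) G H" by (rule optimal)
  qed
qed

end
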